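(* Let $k$ be a field of characteristic zero, let $X=X_0\cup X_1=\{1,x_1,\dots,x_n\}$ be a set of even and odd generators (with $1$ even), linearly ordered by $1<x_1<\dots<x_n$, and let $GenP$ be the free unital generalized Poisson superalgebra over $k$ generated by $X$ (with $1$ as unit). Then the set $U$ of ordered monomials defined in the context is a basis of $GenP$ (as a vector space over $k$).
   Context: A unital generalized Poisson superalgebra is a $\mathbb{Z}_2$-graded vector space with two even bilinear products: an associative supercommutative product $\cdot$ with (even) unit $1$, and a superanticommutative bracket $\{,\}$, i.e. $\{a,b\}=-(-1)^{|a||b|}\{b,a\}$, such that for homogeneous $a,b,c$, with $D(a)=\{a,1\}$, $$\{a,bc\}=\{a,b\}c+(-1)^{|a||b|}b\{a,c\}-D(a)bc,$$ $$\{a,\{b,c\}\}=\{\{a,b\},c\}+(-1)^{|a||b|}\{b,\{a,c\}\}.$$ $GenP=D_X/I$, where $D_X$ is the free non-associative superalgebra with two multiplications $\cdot$ and $\{,\}$ on the generators $X=\{1,x_1,\dots,x_n\}$, and $I$ is the ideal generated by all the relations expressing that $\cdot$ is associative and supercommutative, that $1\cdot a=a$, that $\{,\}$ is superanticommutative, and that the two displayed identities hold. Good words in the alphabet $X$ (note that the letter $1$ is included) are bracket words defined recursively. All elements of $X$ are good words. A word $w$ of length at least $2$ is good if: 1) $w=\{u,v\}$ with $u,v$ good words and $u>v$; and 2) if $w=\{\{u_1,u_2\},v\}$, then $u_2\le v$. Let $M=\{u,\{v,v\} \mid u,v \text{ good words in } X,\ v \text{ odd}\}$. The linear order on $M$ (used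 also for good words) is: on $X$ the given order; $u>v$ if $\deg u>\deg v$ ($\deg$ = number of letters); if $\deg u=\deg v\geq 2$, $u=\{u_1,u_2\}$, $v=\{v_1,v_2\}$, then $u>v$ if $u_1>v_1$, or if $u_1=v_1$ and $u_2>v_2$. The elements of $M$ are denoted $e_i$, with $e_i<e_j$ if $i<j$. Finally, $$U=\{e_{i_1}^{k_1}\cdots e_{i_r}^{k_r}\mid r\ge 1,\ e_{i_m}\in M,\ i_1<\dots<i_r,\ e_{i_1}\ne 1,\ k_j\ge 1,\ k_j=1 \text{ if } e_{i_j}\text{ is odd}\}\cup\{1\},$$ where the products are with respect to $\cdot$ and elements are identified with their images in $GenP$. *)

theory Defs
  imports
    "HOL-Library.Poly_Mapping"
    "Jordan_Normal_Form.VS_Connect"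
begin

section \<open>The free non-associative superalgebra with two multiplications\<close>

text \<open>
  The generating set is \<open>X = {1, x\<^sub>1, \<dots>, x\<^sub>n}\<close>; the letter \<open>1\<close> is encoded as \<open>Letter 0\<close> and
  \<open>x\<^sub>i\<close> as \<open>Letter i\<close>, so that the given order on \<open>X\<close> is the order of the indices.
  The parameter \<open>X1 \<subseteq> {1..n}\<close> is the set of indices of the odd generators.
\<close>

datatype mon = Letter nat | Prod mon mon | Brack mon mon

fun letters :: "mon \<Rightarrow> nat set" where
  "letters (Letter i) = {i}"
| "letters (Prod u v) = letters u \<union> letters v"
| "letters (Brack u v) = letters u \<union> letters v"

fun odd_mon :: "nat set \<Rightarrow> mon \<Rightarrow> bool" where
  "odd_mon X1 (Letter i) \<longleftrightarrow> i \<in> X1"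
| "odd_mon X1 (Prod u v) \<longleftrightarrow> odd_mon X1 u \<noteq> odd_mon X1 v"
| "odd_mon X1 (Brack u v) \<longleftrightarrow> odd_mon X1 u \<noteq> odd_mon X1 v"

definition bilin_ext :: "(mon \<Rightarrow> mon \<Rightarrow> mon) \<Rightarrow> (mon \<Rightarrow>\<^sub>0 'k) \<Rightarrow> (mon \<Rightarrow>\<^sub>0 'k) \<Rightarrow> (mon \<Rightarrow>\<^sub>0 'k::field)" where
  "bilin_ext f p q = (\<Sum>u\<in>Poly_Mapping.keys p. \<Sum>v\<in>Poly_Mapping.keys q. Poly_Mapping.single (f u v) (Poly_Mapping.lookup p u * Poly_Mapping.lookup q v))"

definition dmul :: "(mon \<Rightarrow>\<^sub>0 'k::field) \<Rightarrow> (mon \<Rightarrow>\<^sub>0 'k) \<Rightarrow> (mon \<Rightarrow>\<^sub>0 'k)"  (infixl \<open>\<star>\<close> 75) where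
  "p \<star> q = bilin_ext Prod p q"

definition dbrack :: "(mon \<Rightarrow>\<^sub>0 'k::field) \<Rightarrow> (mon \<Rightarrow>\<^sub>0 'k) \<Rightarrow> (mon \<Rightarrow>\<^sub>0 'k)"  (\<open>\<lbrace>_, _\<rbrace>\<close>) where
  "\<lbrace>p, q\<rbrace> = bilin_ext Brack p q"

definition dscale :: "'k::field \<Rightarrow> (mon \<Rightarrow>\<^sub>0 'k) \<Rightarrow> (mon \<Rightarrow>\<^sub>0 'k)"  (infixr \<open>*\<^sub>s\<close> 72) where
  "c *\<^sub>s p = Poly_Mapping.map ((*) c) p"

abbreviation dmon :: "mon \<Rightarrow> (mon \<Rightarrow>\<^sub>0 'k::field)" where
  "dmon w \<equiv> Poly_Mapping.single w 1"

definition DX :: "nat \<Rightarrow> (mon \<Rightarrow>\<^sub>0 'k::field) set" where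
  "DX n = {p. \<forall>w\<in>Poly_Mapping.keys p. letters w \<subseteq> {0..n}}"

text \<open>\<open>DX_part n X1 s\<close> is the odd part of \<open>DX n\<close> if \<open>s\<close> holds and the even part otherwise.\<close>

definition DX_part :: "nat \<Rightarrow> nat set \<Rightarrow> bool \<Rightarrow> (mon \<Rightarrow>\<^sub>0 'k::field) set" where
  "DX_part n X1 s = {p \<in> DX n. \<forall>w\<in>Poly_Mapping.keys p. odd_mon X1 w = s}"

definition koszul :: "bool \<Rightarrow> bool \<Rightarrow> 'k::field" where
  "koszul s t = (if s \<and> t then - 1 else 1)"


section \<open>The free unital generalized Poisson superalgebra\<close>

definition relators :: "nat \<Rightarrow> nat set \<Rightarrow> (mon \<Rightarrow>\<^sub>0 'k::field) set" where
  "relators n X1 =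
     {(a \<star> b) \<star> c - a \<star> (b \<star> c) | a b c. a \<in> DX n \<and> b \<in> DX n \<and> c \<in> DX n}
   \<union> {a \<star> b - koszul s t *\<^sub>s (b \<star> a) | a b s t. a \<in> DX_part n X1 s \<and> b \<in> DX_part n X1 t}
   \<union> {dmon (Letter 0) \<star> a - a | a. a \<in> DX n}
   \<union> {\<lbrace>a, b\<rbrace> - (- (koszul s t *\<^sub>s \<lbrace>b, a\<rbrace>)) | a b s t. a \<in> DX_part n X1 s \<and> b \<in> DX_part n X1 t}
   \<union> {\<lbrace>a, b \<star> c\<rbrace> -
        (\<lbrace>a, b\<rbrace> \<star> c + koszul s t *\<^sub>s (b \<star> \<lbrace>a, c\<rbrace>) - \<lbrace>a, dmon (Letter 0)\<rbrace> \<star> (b \<star> c))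
       | a b c s t r. a \<in> DX_part n X1 s \<and> b \<in> DX_part n X1 t \<and> c \<in> DX_part n X1 r}
   \<union> {\<lbrace>a, \<lbrace>b, c\<rbrace>\<rbrace> - (\<lbrace>\<lbrace>a, b\<rbrace>, c\<rbrace> + koszul s t *\<^sub>s \<lbrace>b, \<lbrace>a, c\<rbrace>\<rbrace>)
       | a b c s t r. a \<in> DX_part n X1 s \<and> b \<in> DX_part n X1 t \<and> c \<in> DX_part n X1 r}"

definition is_ideal :: "nat \<Rightarrow> (mon \<Rightarrow>\<^sub>0 'k::field) set \<Rightarrow> bool" where
  "is_ideal n J \<longleftrightarrow> J \<subseteq> DX n \<and> 0 \<in> J
     \<and> (\<forall>p\<in>J. \<forall>q\<in>J. p + q \<in> J) \<and> (\<forall>c. \<forall>p\<in>J. c *\<^sub>s p \<in> J)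
     \<and> (\<forall>p\<in>J. \<forall>a\<in>DX n. a \<star> p \<in> J \<and> p \<star> a \<in> J \<and> \<lbrace>a, p\<rbrace> \<in> J \<and> \<lbrace>p, a\<rbrace> \<in> J)"

definition relation_ideal :: "nat \<Rightarrow> nat set \<Rightarrow> (mon \<Rightarrow>\<^sub>0 'k::field) set" where
  "relation_ideal n X1 = is_ideal n hull relators n X1"

lemma bilin_ext_DX:
  assumes "p \<in> DX n" "q \<in> DX n"
    and "\<And>u v. letters u \<subseteq> {0..n} \<Longrightarrow> letters v \<subseteq> {0..n} \<Longrightarrow> letters (f u v) \<subseteq> {0..n}"
  shows "bilin_ext f p q \<in> DX n"
proof -
  have *: "Poly_Mapping.keys (bilin_ext f p q) \<subseteq>
      (\<Union>u\<in>Poly_Mapping.keys p. \<Union>v\<in>Poly_Mapping.keys q. {f u v})"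
    unfolding bilin_ext_def
    by (rule order_trans[OF Poly_Mapping.keys_sum], rule UN_mono, rule subset_refl,
        rule order_trans[OF Poly_Mapping.keys_sum], rule UN_mono, rule subset_refl) simp
  show ?thesis
    unfolding DX_def
  proof (intro CollectI ballI)
    fix w assume "w \<in> Poly_Mapping.keys (bilin_ext f p q)"
    with * obtain u v where "u \<in> Poly_Mapping.keys p" "v \<in> Poly_Mapping.keys q" "w = f u v"
      by blast
    with assms show "letters w \<subseteq> {0..n}"
      by (auto simp: DX_def)
  qed
qed

lemma lookup_dscale [simp]: "Poly_Mapping.lookup (c *\<^sub>s p) w = c * Poly_Mapping.lookup p w"
  by (simp add: dscale_def Poly_Mapping.map.rep_eq when_def)

lemma dscale_simps:
  "c *\<^sub>s (p + q) = c *\<^sub>s p + c *\<^sub>s q" "c *\<^sub>s (p - q) = c *\<^sub>s p - c *\<^sub>s q"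
  "(a + b) *\<^sub>s p = a *\<^sub>s p + b *\<^sub>s p" "(a * b) *\<^sub>s p = a *\<^sub>s (b *\<^sub>s p)" "1 *\<^sub>s p = p"
  "(- 1) *\<^sub>s p = - p" "c *\<^sub>s 0 = 0" "0 *\<^sub>s p = 0"
  by (rule poly_mapping_eqI; simp add: lookup_add lookup_minus algebra_simps)+

lemma DX_closed:
  "p \<in> DX n \<Longrightarrow> q \<in> DX n \<Longrightarrow> p \<star> q \<in> DX n"
  "p \<in> DX n \<Longrightarrow> q \<in> DX n \<Longrightarrow> \<lbrace>p, q\<rbrace> \<in> DX n"
  "p \<in> DX n \<Longrightarrow> q \<in> DX n \<Longrightarrow> p + q \<in> DX n"
  "p \<in> DX n \<Longrightarrow> q \<in> DX n \<Longrightarrow> p - q \<in> DX n"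
  "p \<in> DX n \<Longrightarrow> - p \<in> DX n"
  "p \<in> DX n \<Longrightarrow> c *\<^sub>s p \<in> DX n"
proof -
  assume p: "p \<in> DX n"
  then show "- p \<in> DX n" "c *\<^sub>s p \<in> DX n"
    by (auto simp: DX_def in_keys_iff)
  assume q: "q \<in> DX n"
  show "p \<star> q \<in> DX n" "\<lbrace>p, q\<rbrace> \<in> DX n"
    unfolding dmul_def dbrack_def by (rule bilin_ext_DX[OF p q]; simp)+
  show "p + q \<in> DX n" "p - q \<in> DX n"
    using p q Poly_Mapping.keys_add[of p q] keys_diff[of p q] unfolding DX_def by blast+
qed

lemma DX_0 [simp]: "0 \<in> DX n"
  by (simp add: DX_def)

lemma DX_dmon: "letters w \<subseteq> {0..n} \<Longrightarrow> dmon w \<in> DX n"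
  by (simp add: DX_def)

lemma DX_part_DX: "p \<in> DX_part n X1 s \<Longrightarrow> p \<in> DX n"
  by (simp add: DX_part_def)

lemma relators_subset: "(relators n X1 :: (mon \<Rightarrow>\<^sub>0 'k::field) set) \<subseteq> DX n"
proof -
  have "(dmon (Letter 0) :: mon \<Rightarrow>\<^sub>0 'k) \<in> DX n"
    by (simp add: DX_dmon)
  then show ?thesis
    unfolding relators_def
    by - (intro Un_least subsetI; elim CollectE exE conjE; hypsubst; intro DX_closed; (assumption | erule DX_part_DX))
qed

lemma is_ideal_Inter:
  assumes "S \<noteq> {}" "\<And>J. J \<in> S \<Longrightarrow> is_ideal n J"
  shows "is_ideal n (\<Inter>S)"
proof -
  note J = assms(2)[unfolded is_ideal_def]
  show ?thesis
    unfolding is_ideal_def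
  proof (intro conjI ballI allI InterI)
    from assms(1) obtain J where "J \<in> S"
      by blast
    with J[OF this] show "\<Inter>S \<subseteq> DX n"
      by blast
  qed (simp_all add: J)
qed

lemma is_ideal_relation_ideal: "is_ideal n (relation_ideal n X1)"
  unfolding relation_ideal_def hull_def
proof (rule is_ideal_Inter)
  have "is_ideal n (DX n)"
    by (simp add: is_ideal_def DX_closed)
  with relators_subset[of n X1] show "{t. is_ideal n t \<and> relators n X1 \<subseteq> t} \<noteq> {}"
    by blast
qed simp

lemma relators_relation_ideal: "relators n X1 \<subseteq> relation_ideal n X1"
  unfolding relation_ideal_def by (rule hull_subset)

record ('a, 'b) bracket_algebra = "('a, 'b) module" +
  bracket :: "'b \<Rightarrow> 'b \<Rightarrow> 'b"

definition coset :: "nat \<Rightarrow> nat set \<Rightarrow> (mon \<Rightarrow>\<^sub>0 'k::field) \<Rightarrow> (mon \<Rightarrow>\<^sub>0 'k) set" where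
  "coset n X1 p = (\<lambda>r. p + r) ` relation_ideal n X1"

text \<open>
  The quotient of \<open>DX n\<close> by \<open>relation_ideal n X1\<close>. The operations are the induced ones; their
  independence of representatives is \<open>GenP_ops\<close> below.
\<close>

definition GenP :: "nat \<Rightarrow> nat set \<Rightarrow> ('k::field, (mon \<Rightarrow>\<^sub>0 'k) set) bracket_algebra" where
  "GenP n X1 = \<lparr>
     carrier = coset n X1 ` DX n,
     mult = (\<lambda>A B. \<Union>a\<in>A. \<Union>b\<in>B. coset n X1 (a \<star> b)),
     one = coset n X1 (dmon (Letter 0)),
     zero = coset n X1 0,
     add = (\<lambda>A B. \<Union>a\<in>A. \<Union>b\<in>B. coset n X1 (a + b)),
     smult = (\<lambda>c A. \<Union>a\<in>A. coset n X1 (c *\<^sub>s a)),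
     bracket = (\<lambda>A B. \<Union>a\<in>A. \<Union>b\<in>B. coset n X1 \<lbrace>a, b\<rbrace>)\<rparr>"

lemma bilin_ext_superset:
  assumes "finite S" "Poly_Mapping.keys p \<subseteq> S" "finite T" "Poly_Mapping.keys q \<subseteq> T"
  shows "bilin_ext f p q =
    (\<Sum>u\<in>S. \<Sum>v\<in>T. Poly_Mapping.single (f u v) (Poly_Mapping.lookup p u * Poly_Mapping.lookup q v))"
proof -
  have "bilin_ext f p q = (\<Sum>u\<in>Poly_Mapping.keys p. \<Sum>v\<in>T.
      Poly_Mapping.single (f u v) (Poly_Mapping.lookup p u * Poly_Mapping.lookup q v))"
    unfolding bilin_ext_def using assms
    by (intro sum.cong refl sum.mono_neutral_left) (auto simp: in_keys_iff)
  also have "\<dots> = (\<Sum>u\<in>S. \<Sum>v\<in>T.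
      Poly_Mapping.single (f u v) (Poly_Mapping.lookup p u * Poly_Mapping.lookup q v))"
    using assms by (intro sum.mono_neutral_left) (auto simp: in_keys_iff)
  finally show ?thesis .
qed

lemma bilin_ext_add:
  fixes p q :: "mon \<Rightarrow>\<^sub>0 'k::field"
  shows
  "bilin_ext f (p + p') q = bilin_ext f p q + bilin_ext f p' q"
  "bilin_ext f p (q + q') = bilin_ext f p q + bilin_ext f p q'"
proof -
  let ?K = Poly_Mapping.keys
  have "bilin_ext f (p + p') q = bilin_ext f p q + bilin_ext f p' q"
    using bilin_ext_superset[of "?K p \<union> ?K p'" "p + p'" "?K q" q f]
      bilin_ext_superset[of "?K p \<union> ?K p'" p "?K q" q f]
      bilin_ext_superset[of "?K p \<union> ?K p'" p' "?K q" q f] Poly_Mapping.keys_add[of p p']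
    by (simp add: lookup_add distrib_right single_add sum.distrib)
  moreover have "bilin_ext f p (q + q') = bilin_ext f p q + bilin_ext f p q'"
    using bilin_ext_superset[of "?K p" p "?K q \<union> ?K q'" "q + q'" f]
      bilin_ext_superset[of "?K p" p "?K q \<union> ?K q'" q f]
      bilin_ext_superset[of "?K p" p "?K q \<union> ?K q'" q' f] Poly_Mapping.keys_add[of q q']
    by (simp add: lookup_add distrib_left single_add sum.distrib)
  ultimately show
    "bilin_ext f (p + p') q = bilin_ext f p q + bilin_ext f p' q"
    "bilin_ext f p (q + q') = bilin_ext f p q + bilin_ext f p q'" .
qed

lemma relation_ideal_closed:
  fixes p q a :: "mon \<Rightarrow>\<^sub>0 'k::field"
  shows "p \<in> relation_ideal n X1 \<Longrightarrow> p \<in> DX n"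
  "(0 :: mon \<Rightarrow>\<^sub>0 'k) \<in> relation_ideal n X1"
  "p \<in> relation_ideal n X1 \<Longrightarrow> q \<in> relation_ideal n X1 \<Longrightarrow> p + q \<in> relation_ideal n X1"
  "p \<in> relation_ideal n X1 \<Longrightarrow> c *\<^sub>s p \<in> relation_ideal n X1"
  "p \<in> relation_ideal n X1 \<Longrightarrow> a \<in> DX n \<Longrightarrow> a \<star> p \<in> relation_ideal n X1"
  "p \<in> relation_ideal n X1 \<Longrightarrow> a \<in> DX n \<Longrightarrow> p \<star> a \<in> relation_ideal n X1"
  "p \<in> relation_ideal n X1 \<Longrightarrow> a \<in> DX n \<Longrightarrow> \<lbrace>a, p\<rbrace> \<in> relation_ideal n X1"
  "p \<in> relation_ideal n X1 \<Longrightarrow> a \<in> DX n \<Longrightarrow> \<lbrace>p, a\<rbrace> \<in> relation_ideal n X1"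
  using is_ideal_relation_ideal[of n X1, where ?'a = 'k] unfolding is_ideal_def by blast+

lemma relation_ideal_uminus: "p \<in> relation_ideal n X1 \<Longrightarrow> - p \<in> relation_ideal n X1"
  using relation_ideal_closed(4)[of p n X1 "- 1"] by (simp add: dscale_simps)

lemma coset_eq_iff:
  fixes p q :: "mon \<Rightarrow>\<^sub>0 'k::field"
  shows "coset n X1 p = coset n X1 q \<longleftrightarrow> p - q \<in> relation_ideal n X1"
proof
  assume "coset n X1 p = coset n X1 q"
  moreover have "p \<in> coset n X1 p"
    unfolding coset_def using relation_ideal_closed(2)[of n X1] by (auto intro!: image_eqI[of _ _ 0])
  ultimately show "p - q \<in> relation_ideal n X1"
    by (auto simp: coset_def)
next
  have *: "coset n X1 p \<subseteq> coset n X1 q" if "p - q \<in> relation_ideal n X1" for p q :: "mon \<Rightarrow>\<^sub>0 'k"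
    unfolding coset_def
  proof clarify
    fix r :: "mon \<Rightarrow>\<^sub>0 'k" assume "r \<in> relation_ideal n X1"
    with that have "(p - q) + r \<in> relation_ideal n X1"
      by (rule relation_ideal_closed)
    then show "p + r \<in> (\<lambda>r. q + r) ` relation_ideal n X1"
      by (rule image_eqI[rotated]) simp
  qed
  assume "p - q \<in> relation_ideal n X1"
  moreover from relation_ideal_uminus[OF this] have "q - p \<in> relation_ideal n X1"
    by simp
  ultimately show "coset n X1 p = coset n X1 q"
    by (intro equalityI *)
qed

lemma coset_mem: "q \<in> coset n X1 p \<longleftrightarrow> coset n X1 q = coset n X1 p"
  unfolding coset_eq_iff by (auto simp: coset_def intro!: image_eqI[of _ _ "q - p"])

lemma coset_DX: "p \<in> DX n \<Longrightarrow> q \<in> coset n X1 p \<Longrightarrow> q \<in> DX n"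
  by (auto simp: coset_def intro: DX_closed relation_ideal_closed)

lemma coset_self: "p \<in> coset n X1 p"
  by (simp add: coset_mem)

lemma coset_bilin:
  fixes p q :: "mon \<Rightarrow>\<^sub>0 'k::field"
  assumes "\<And>p a :: mon \<Rightarrow>\<^sub>0 'k. p \<in> relation_ideal n X1 \<Longrightarrow> a \<in> DX n \<Longrightarrow>
      bilin_ext f a p \<in> relation_ideal n X1 \<and> bilin_ext f p a \<in> relation_ideal n X1"
    and "p \<in> DX n" "q \<in> DX n" "a \<in> coset n X1 p" "b \<in> coset n X1 q"
  shows "coset n X1 (bilin_ext f a b) = coset n X1 (bilin_ext f p q)"
proof -
  from assms(4,5) obtain r t where r: "r \<in> relation_ideal n X1" "a = p + r"
    and t: "t \<in> relation_ideal n X1" "b = q + t"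
    by (auto simp: coset_def)
  have "bilin_ext f a b - bilin_ext f p q = bilin_ext f p t + bilin_ext f r b"
    by (simp add: r t bilin_ext_add)
  moreover have "bilin_ext f p t \<in> relation_ideal n X1" "bilin_ext f r b \<in> relation_ideal n X1"
    using assms(1)[OF t(1) assms(2)] assms(1)[OF r(1) coset_DX[OF assms(3,5)]] by auto
  ultimately show ?thesis
    by (simp add: coset_eq_iff relation_ideal_closed)
qed

lemma UN_const:
  assumes "a \<in> A" "\<And>x. x \<in> A \<Longrightarrow> f x = C"
  shows "(\<Union>x\<in>A. f x) = C"
  using assms by blast

lemma UN2_const:
  assumes "a \<in> A" "b \<in> B" "\<And>x y. x \<in> A \<Longrightarrow> y \<in> B \<Longrightarrow> f x y = C"
  shows "(\<Union>x\<in>A. \<Union>y\<in>B. f x y) = C"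
  using assms by blast

lemma GenP_ops:
  fixes p q :: "mon \<Rightarrow>\<^sub>0 'k::field"
  assumes "p \<in> DX n" "q \<in> DX n"
  shows "coset n X1 p \<otimes>\<^bsub>GenP n X1\<^esub> coset n X1 q = coset n X1 (p \<star> q)"
    and "bracket (GenP n X1) (coset n X1 p) (coset n X1 q) = coset n X1 \<lbrace>p, q\<rbrace>"
    and "coset n X1 p \<oplus>\<^bsub>GenP n X1\<^esub> coset n X1 q = coset n X1 (p + q)"
    and "c \<odot>\<^bsub>GenP n X1\<^esub> coset n X1 p = coset n X1 (c *\<^sub>s p)"
proof -
  have m: "coset n X1 (a \<star> b) = coset n X1 (p \<star> q)"
    and br: "coset n X1 \<lbrace>a, b\<rbrace> = coset n X1 \<lbrace>p, q\<rbrace>"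
    if "a \<in> coset n X1 p" "b \<in> coset n X1 q" for a b :: "mon \<Rightarrow>\<^sub>0 'k"
    unfolding dmul_def dbrack_def
    by (rule coset_bilin[OF _ assms that];
        simp flip: dmul_def dbrack_def add: relation_ideal_closed)+
  have ad: "coset n X1 (a + b) = coset n X1 (p + q)"
    if "a \<in> coset n X1 p" "b \<in> coset n X1 q" for a b :: "mon \<Rightarrow>\<^sub>0 'k"
    using relation_ideal_closed(3)[of "a - p" n X1 "b - q"] that
    by (simp add: coset_mem coset_eq_iff algebra_simps)
  have sc: "coset n X1 (c *\<^sub>s a) = coset n X1 (c *\<^sub>s p)" if "a \<in> coset n X1 p" for a
    using relation_ideal_closed(4)[of "a - p" n X1 c] that
    by (simp add: coset_mem coset_eq_iff dscale_simps)
  show "coset n X1 p \<otimes>\<^bsub>GenP n X1\<^esub> coset n X1 q = coset n X1 (p \<star> q)"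
    by (simp add: GenP_def UN2_const[OF coset_self coset_self m])
  show "bracket (GenP n X1) (coset n X1 p) (coset n X1 q) = coset n X1 \<lbrace>p, q\<rbrace>"
    by (simp add: GenP_def UN2_const[OF coset_self coset_self br])
  show "coset n X1 p \<oplus>\<^bsub>GenP n X1\<^esub> coset n X1 q = coset n X1 (p + q)"
    by (simp add: GenP_def UN2_const[OF coset_self coset_self ad])
  show "c \<odot>\<^bsub>GenP n X1\<^esub> coset n X1 p = coset n X1 (c *\<^sub>s p)"
    by (simp add: GenP_def UN_const[OF coset_self sc])
qed

lemma GenP_carrier: "carrier (GenP n X1) = coset n X1 ` DX n"
  and GenP_zero: "\<zero>\<^bsub>GenP n X1\<^esub> = coset n X1 0"
  and GenP_one: "\<one>\<^bsub>GenP n X1\<^esub> = coset n X1 (dmon (Letter 0))"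
  by (simp_all add: GenP_def)

lemma vectorspace_GenP:
  "vectorspace (class_ring :: 'k ring) (GenP n X1 :: ('k::field, _) bracket_algebra)"
proof -
  have ab: "abelian_group (GenP n X1 :: ('k, _) bracket_algebra)"
  proof (rule abelian_groupI)
    fix x assume "x \<in> carrier (GenP n X1 :: ('k, _) bracket_algebra)"
    then obtain p where "p \<in> DX n" "x = coset n X1 p"
      by (auto simp: GenP_carrier)
    then show "\<exists>y\<in>carrier (GenP n X1). y \<oplus>\<^bsub>GenP n X1\<^esub> x = \<zero>\<^bsub>GenP n X1\<^esub>"
      by (intro bexI[of _ "coset n X1 (- p)"])
        (auto simp: GenP_carrier GenP_zero GenP_ops DX_closed)
  qed (auto simp: GenP_carrier GenP_zero GenP_ops DX_closed add.assoc add.commute add.left_commute)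
  have "module (class_ring :: 'k ring) (GenP n X1)"
    using ab fieldE(1)[OF class_field]
    by (intro moduleI)
      (auto simp: GenP_carrier GenP_ops DX_closed dscale_simps)
  then show ?thesis
    by (simp add: vectorspace_def class_field.field_axioms)
qed


section \<open>Good words and ordered monomials\<close>

fun deg :: "mon \<Rightarrow> nat" where
  "deg (Letter i) = 1"
| "deg (Prod u v) = deg u + deg v"
| "deg (Brack u v) = deg u + deg v"

text \<open>The order is only meaningful on words built from letters with \<open>Brack\<close>.\<close>

fun wless :: "mon \<Rightarrow> mon \<Rightarrow> bool"  (infix \<open>\<prec>\<close> 50) where
  "Letter i \<prec> Letter j \<longleftrightarrow> i < j"
| "Brack u1 u2 \<prec> Brack v1 v2 \<longleftrightarrow>
     deg (Brack u1 u2) < deg (Brack v1 v2) \<or>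
     deg (Brack u1 u2) = deg (Brack v1 v2) \<and> (u1 \<prec> v1 \<or> u1 = v1 \<and> u2 \<prec> v2)"
| "u \<prec> v \<longleftrightarrow> deg u < deg v"

inductive_set good_words :: "nat \<Rightarrow> mon set" for n :: nat where
  letter: "i \<le> n \<Longrightarrow> Letter i \<in> good_words n"
| brack: "u \<in> good_words n \<Longrightarrow> v \<in> good_words n \<Longrightarrow> v \<prec> u \<Longrightarrow>
    (\<And>u1 u2. u = Brack u1 u2 \<Longrightarrow> u2 = v \<or> u2 \<prec> v) \<Longrightarrow> Brack u v \<in> good_words n"

definition M_words :: "nat \<Rightarrow> nat set \<Rightarrow> mon set" where
  "M_words n X1 = good_words n \<union> {Brack v v | v. v \<in> good_words n \<and> odd_mon X1 v}"

text \<open>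
  The list \<open>[(e\<^sub>1, k\<^sub>1), \<dots>, (e\<^sub>r, k\<^sub>r)]\<close> stands for the ordered product of the powers
  \<open>e\<^sub>i ^ k\<^sub>i\<close>, and \<open>[]\<close> for the element \<open>1\<close>.
\<close>

definition ordered_monomials :: "nat \<Rightarrow> nat set \<Rightarrow> (mon \<times> nat) list set" where
  "ordered_monomials n X1 =
     {es. es \<noteq> [] \<and> sorted_wrt (\<prec>) (map fst es) \<and> fst (hd es) \<noteq> Letter 0 \<and>
          (\<forall>(e, k)\<in>set es. e \<in> M_words n X1 \<and> k \<ge> 1 \<and> (odd_mon X1 e \<longrightarrow> k = 1))}
     \<union> {[]}"

definition monomial_value :: "nat \<Rightarrow> nat set \<Rightarrow> (mon \<times> nat) list \<Rightarrow> (mon \<Rightarrow>\<^sub>0 'k::field) set" where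
  "monomial_value n X1 es =
     foldr (\<lambda>(e, k) z. (coset n X1 (dmon e) [^]\<^bsub>GenP n X1\<^esub> k) \<otimes>\<^bsub>GenP n X1\<^esub> z) es \<one>\<^bsub>GenP n X1\<^esub>"

end

theory Submission
  imports Defs "HOL-Computational_Algebra.Formal_Laurent_Series"
begin

text \<open>
  Spanning is rewriting: the Leibniz rule reduces every element to products of bracket words, and
  brackets of good words are straightened by the Jacobi identity as in a Hall basis.

  For independence, let \<open>T\<close> be the free associative algebra on \<open>e = x\<^sub>0, x\<^sub>1, \<dots>, x\<^sub>n\<close>, filtered by
  \<open>F\<^sub>p\<close>, the span of products of at most \<open>p\<close> iterated supercommutators. In the Laurent series over \<open>T\<close>
  in a central variable \<open>X\<close>, with \<open>X\<^sup>-\<^sup>1\<close> of filtration degree 1, the element \<open>\<xi> = X\<^sup>-\<^sup>1 + e\<close> is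
  invertible and has the same commutators with \<open>T\<close> as \<open>e\<close>. Sending \<open>1\<close> to \<open>\<xi>\<close>, the bracket to the
  supercommutator and the product to \<open>a \<xi>\<^sup>-\<^sup>1 b\<close> satisfies all the identities modulo filtration degree
  0, so \<open>GenP\<close> maps to the quotient of degree 1 by degree 0. The lowest coefficient of the image
  of an ordered monomial is the product of its factors in \<open>T\<close>. Such products are independent by a
  count: they span, and unique factorization of letter sequences into nondecreasing good words
  shows that there are at most as many of them as words in the letters.
\<close>

text \<open>In the filtration products add degrees and supercommutators lose one, so degree 1 is
  closed under the bracket but not under the product. Inserting the inverse of \<xi>, of degree -1,
  brings products back to degree 1 and makes \<xi> the unit. As \<xi> is not central, the Leibniz
  rule acquires a term with [a, \<xi>], and this is -D(a)bc. The letter 1 has two roles: as a factor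
  it is the unit, inside brackets it is an ordinary even generator. Adding the central X^-1 to e
  yields invertibility and leaves the second role intact. Powers of X then count factors: a monomial
  with r of them starts at X^(r-1), and in a series of degree 0 that coefficient lies in the span of
  products of at most r-1 brackets. So the shortest terms of a relation in \<open>GenP\<close> give
  a relation in T modulo shorter products. Characteristic zero is used to divide by 2 (squares of
  even words, repeated odd factors) and by 3 (the brackets {v, {v, v}} with v odd).\<close>

unbundle fps_syntax
no_notation index_mat (infixl "$$" 100)

section \<open>Words\<close>

text \<open>Agrees with \<open>\<prec>\<close> on bracket words; \<open>\<prec>\<close> itself is not total on terms containing \<open>Prod\<close>.\<close>

fun mon_less :: "mon \<Rightarrow> mon \<Rightarrow> bool" where
  "mon_less (Letter i) (Letter j) \<longleftrightarrow> i < j"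
| "mon_less (Letter i) v \<longleftrightarrow> True"
| "mon_less (Prod u1 u2) (Letter j) \<longleftrightarrow> False"
| "mon_less (Prod u1 u2) (Prod v1 v2) \<longleftrightarrow>
     deg (Prod u1 u2) < deg (Prod v1 v2) \<or>
     deg (Prod u1 u2) = deg (Prod v1 v2) \<and> (mon_less u1 v1 \<or> u1 = v1 \<and> mon_less u2 v2)"
| "mon_less (Prod u1 u2) (Brack v1 v2) \<longleftrightarrow> deg (Prod u1 u2) \<le> deg (Brack v1 v2)"
| "mon_less (Brack u1 u2) (Letter j) \<longleftrightarrow> False"
| "mon_less (Brack u1 u2) (Prod v1 v2) \<longleftrightarrow> deg (Brack u1 u2) < deg (Prod v1 v2)"
| "mon_less (Brack u1 u2) (Brack v1 v2) \<longleftrightarrow>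
     deg (Brack u1 u2) < deg (Brack v1 v2) \<or>
     deg (Brack u1 u2) = deg (Brack v1 v2) \<and> (mon_less u1 v1 \<or> u1 = v1 \<and> mon_less u2 v2)"

lemma mon_less_irrefl: "\<not> mon_less u u"
  by (induction u) auto

lemma mon_less_trans: "mon_less u v \<Longrightarrow> mon_less v w \<Longrightarrow> mon_less u w"
proof (induction u arbitrary: v w)
  case (Letter i)
  then show ?case by (cases v; cases w) auto
next
  case (Prod u1 u2)
  then show ?case by (cases v; cases w) auto
next
  case (Brack u1 u2)
  then show ?case by (cases v; cases w) auto
qed

lemma mon_less_total: "mon_less u v \<or> u = v \<or> mon_less v u"
proof (induction u arbitrary: v)
  case (Letter i)
  then show ?case by (cases v) auto
next
  case (Prod u1 u2)
  show ?case
  proof (cases v)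
    case (Prod v1 v2)
    with Prod.IH(1)[of v1] Prod.IH(2)[of v2] show ?thesis by auto
  qed auto
next
  case (Brack u1 u2)
  show ?case
  proof (cases v)
    case (Brack v1 v2)
    with Brack.IH(1)[of v1] Brack.IH(2)[of v2] show ?thesis by auto
  qed auto
qed

instantiation mon :: linorder
begin

definition less_mon :: "mon \<Rightarrow> mon \<Rightarrow> bool" where
  "less_mon = mon_less"

definition less_eq_mon :: "mon \<Rightarrow> mon \<Rightarrow> bool" where
  "less_eq_mon u v \<longleftrightarrow> u = v \<or> mon_less u v"

instance
proof
  fix u v w :: mon
  show "u < v \<longleftrightarrow> u \<le> v \<and> \<not> v \<le> u"
    unfolding less_mon_def less_eq_mon_def using mon_less_irrefl mon_less_trans by blast
  show "u \<le> u" by (simp add: less_eq_mon_def)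
  show "u \<le> v \<Longrightarrow> v \<le> w \<Longrightarrow> u \<le> w"
    unfolding less_eq_mon_def using mon_less_trans by blast
  show "u \<le> v \<Longrightarrow> v \<le> u \<Longrightarrow> u = v"
    unfolding less_eq_mon_def using mon_less_irrefl mon_less_trans by blast
  show "u \<le> v \<or> v \<le> u"
    unfolding less_eq_mon_def using mon_less_total by blast
qed

end

lemma deg_pos [simp]: "deg w > 0"
  by (induction w) auto

lemma deg_neq_0 [simp]: "deg w \<noteq> 0"
  using deg_pos[of w] by simp

lemma deg_add_gt_1 [simp]: "Suc 0 < deg u + deg v"
  using deg_pos[of u] deg_pos[of v] by linarith

lemma less_deg: "deg u < deg v \<Longrightarrow> u < v"
  by (cases u; cases v) (auto simp: less_mon_def Suc_lessI)

lemma Brack_greater [simp]: "u < Brack u v" "v < Brack u v"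
  by (simp_all add: less_deg)

lemma Letter_0_le: "Letter 0 \<le> w"
  by (cases w) (auto simp: less_eq_mon_def)

text \<open>Straightening passes through brackets that are not good, so an ambient set closed under
  \<open>Brack\<close> is needed; on it \<open>\<prec>\<close> is still a linear order.\<close>

inductive_set brack_words :: "nat \<Rightarrow> mon set" for n :: nat where
  letter: "i \<le> n \<Longrightarrow> Letter i \<in> brack_words n"
| brack: "u \<in> brack_words n \<Longrightarrow> v \<in> brack_words n \<Longrightarrow> Brack u v \<in> brack_words n"

lemma brack_words_iff [simp]:
  "Letter i \<in> brack_words n \<longleftrightarrow> i \<le> n"
  "Prod u v \<notin> brack_words n"
  "Brack u v \<in> brack_words n \<longleftrightarrow> u \<in> brack_words n \<and> v \<in> brack_words n"
  by (auto intro: brack_words.intros elim: brack_words.cases)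

lemma brack_words_letters: "w \<in> brack_words n \<Longrightarrow> letters w \<subseteq> {0..n}"
  by (induction rule: brack_words.induct) auto

lemma wless_iff_less:
  "u \<in> brack_words n \<Longrightarrow> v \<in> brack_words n \<Longrightarrow> u \<prec> v \<longleftrightarrow> u < v"
proof (induction u arbitrary: v rule: brack_words.induct)
  case (letter i)
  then show ?case by (cases v) (auto simp: less_mon_def Suc_lessI)
next
  case (brack u1 u2)
  then show ?case by (cases v) (auto simp: less_mon_def)
qed

lemma good_words_brack_words: "w \<in> good_words n \<Longrightarrow> w \<in> brack_words n"
  by (induction rule: good_words.induct) auto

lemma good_words_Letter [simp]: "Letter i \<in> good_words n \<longleftrightarrow> i \<le> n"
  by (auto intro: good_words.intros elim: good_words.cases)

lemma wless_good:
  "u \<in> good_words n \<Longrightarrow> v \<in> good_words n \<Longrightarrow> u \<prec> v \<longleftrightarrow> u < v"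
  using wless_iff_less good_words_brack_words by blast

lemma good_words_Brack:
  "Brack u v \<in> good_words n \<longleftrightarrow> u \<in> good_words n \<and> v \<in> good_words n \<and> v < u \<and>
     (\<forall>u1 u2. u = Brack u1 u2 \<longrightarrow> u2 \<le> v)" (is "?L \<longleftrightarrow> ?R")
proof -
  have snd: "u2 \<in> good_words n" if "Brack u1 u2 \<in> good_words n" for u1 u2
    using that by (cases rule: good_words.cases)
  show ?thesis
  proof
    assume ?L
    then show ?R
      by (cases rule: good_words.cases)
        (metis snd wless_good order_le_less)
  next
    assume ?R
    then show ?L
      by (intro good_words.brack) (metis snd wless_good order_le_less)+
  qed
qed

lemma not_good_square [simp]: "Brack v v \<notin> good_words n"
  by (simp add: good_words_Brack)

lemma good_words_M_words: "w \<in> good_words n \<Longrightarrow> w \<in> M_words n X1"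
  by (simp add: M_words_def)

lemma M_words_brack_words: "w \<in> M_words n X1 \<Longrightarrow> w \<in> brack_words n"
  by (auto simp: M_words_def good_words_brack_words)

lemma square_M_words:
  "v \<in> good_words n \<Longrightarrow> odd_mon X1 v \<Longrightarrow> Brack v v \<in> M_words n X1"
  by (auto simp: M_words_def)

lemma odd_M_words_good: "w \<in> M_words n X1 \<Longrightarrow> odd_mon X1 w \<Longrightarrow> w \<in> good_words n"
  by (auto simp: M_words_def)

text \<open>Allows induction downward along the order within a bounded degree.\<close>

lemma finite_brack_words_deg: "finite {w \<in> brack_words n. deg w \<le> d}"
proof (induction d)
  case 0
  have "{w \<in> brack_words n. deg w \<le> 0} = {}"
    using deg_pos by (auto simp: not_le)
  then show ?case by (simp only: finite.emptyI)
next
  case (Suc d)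
  let ?A = "{w \<in> brack_words n. deg w \<le> d}"
  have *: "deg u \<le> d \<and> deg v \<le> d" if "deg u + deg v \<le> Suc d" for u v
    using that deg_pos[of u] deg_pos[of v] by linarith
  have "{w \<in> brack_words n. deg w \<le> Suc d} \<subseteq>
      Letter ` {0..n} \<union> (\<lambda>(u, v). Brack u v) ` (?A \<times> ?A)"
  proof
    fix w assume "w \<in> {w \<in> brack_words n. deg w \<le> Suc d}"
    then show "w \<in> Letter ` {0..n} \<union> (\<lambda>(u, v). Brack u v) ` (?A \<times> ?A)"
      by (cases w) (auto dest: *)
  qed
  moreover have "finite (Letter ` {0..n} \<union> (\<lambda>(u, v). Brack u v) ` (?A \<times> ?A))"
    using Suc by simp
  ultimately show ?case
    by (rule finite_subset)
qed

section \<open>Factorization of letter sequences into good words\<close>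

fun foliage :: "mon \<Rightarrow> nat list" where
  "foliage (Letter i) = [i]"
| "foliage (Prod u v) = foliage u @ foliage v"
| "foliage (Brack u v) = foliage u @ foliage v"

text \<open>Reading letters from the right, a word greater than its right neighbour absorbs it. This recovers
  a nondecreasing sequence of good words from its letters, so that there are at most as many such
  sequences as sequences of letters.\<close>

fun absorb :: "mon \<Rightarrow> mon list \<Rightarrow> mon list" where
  "absorb h [] = [h]"
| "absorb h (s # ss) = (if h \<le> s then h # s # ss else absorb (Brack h s) ss)"

definition parse :: "nat list \<Rightarrow> mon list \<Rightarrow> mon list" where
  "parse is ss = foldr (\<lambda>i. absorb (Letter i)) is ss"

lemma parse_append: "parse (is @ js) ss = parse is (parse js ss)"
  by (simp add: parse_def)

text \<open>The result is \<open>absorb h ss\<close> and not \<open>h # ss\<close> because in the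
  induction the left component \<open>u\<close> meets the smaller word \<open>v\<close> and has to
  absorb it. The last hypothesis lets \<open>v\<close> settle in front of \<open>ss\<close>
  beforehand; it passes on to u = {u1, u2} by the condition \<open>u2 \<le> v\<close> on good
  words.\<close>

lemma parse_foliage:
  assumes "h \<in> good_words n" "sorted ss" "\<And>u v s. h = Brack u v \<Longrightarrow> s \<in> set ss \<Longrightarrow> v \<le> s"
  shows "parse (foliage h) ss = absorb h ss"
  using assms
proof (induction h arbitrary: ss rule: mon.induct)
  case (Letter i)
  then show ?case by (simp add: parse_def)
next
  case (Prod u v)
  then show ?case using good_words_brack_words[OF Prod.prems(1)] by simp
next
  case (Brack u v)
  then have g: "u \<in> good_words n" "v \<in> good_words n" "v < u" "\<And>u1 u2. u = Brack u1 u2 \<Longrightarrow> u2 \<le> v"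
    by (auto simp: good_words_Brack)
  have vs: "v \<le> s" if "s \<in> set ss" for s
    using Brack.prems(3) that by blast
  have "parse (foliage v) ss = absorb v ss"
  proof (rule Brack.IH(2)[OF g(2) Brack.prems(2)])
    fix v1 v2 s assume "v = Brack v1 v2" "s \<in> set ss"
    then show "v2 \<le> s"
      using vs[of s] Brack_greater(2)[of v2 v1] by (metis order_less_imp_le order_trans)
  qed
  also have "\<dots> = v # ss"
    using vs by (cases ss) auto
  finally have 1: "parse (foliage v) ss = v # ss" .
  have "parse (foliage u) (v # ss) = absorb u (v # ss)"
  proof (rule Brack.IH(1)[OF g(1)])
    show "sorted (v # ss)" using vs Brack.prems(2) by simp
    fix u1 u2 s assume "u = Brack u1 u2" "s \<in> set (v # ss)"
    with g(4) vs show "u2 \<le> s" by fastforce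
  qed
  moreover have "\<not> u \<le> v" using g(3) by simp
  ultimately show ?case
    using 1 by (simp add: parse_append)
qed

text \<open>In a nondecreasing sequence the last hypothesis of \<open>parse_foliage\<close> is
  automatic, since the second component of a word lies below the word, and nothing is absorbed
  across the boundary between two factors.\<close>

lemma parse_concat_foliage:
  "sorted hs \<Longrightarrow> set hs \<subseteq> good_words n \<Longrightarrow> parse (concat (map foliage hs)) [] = hs"
proof (induction hs)
  case Nil
  then show ?case by (simp add: parse_def)
next
  case (Cons h hs)
  have "parse (foliage h) hs = absorb h hs"
  proof (rule parse_foliage)
    fix u v s assume "h = Brack u v" "s \<in> set hs"
    with Cons.prems(1) have "Brack u v \<le> s" by simp
    with Brack_greater(2)[of v u] show "v \<le> s" by (meson order_less_imp_le order_trans)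
  qed (use Cons.prems in auto)
  also have "\<dots> = h # hs"
    using Cons.prems by (cases hs) auto
  finally show ?case
    using Cons by (simp add: parse_append)
qed

lemma inj_on_concat_foliage:
  "inj_on (\<lambda>hs. concat (map foliage hs)) {hs. sorted hs \<and> set hs \<subseteq> good_words n}"
  by (rule inj_on_inverseI[where g = "\<lambda>is. parse is []"]) (auto intro: parse_concat_foliage)

lemma length_foliage [simp]: "length (foliage w) = deg w"
  by (induction w) auto

lemma set_foliage: "set (foliage w) = letters w"
  by (induction w) auto

lemma length_concat_foliage: "length (concat (map foliage hs)) = sum_list (map deg hs)"
  by (induction hs) auto

text \<open>Powers are written out as repeated entries. \<open>Letter 0\<close> is allowed, because
  in the free associative algebra it is a generator and not the unit.\<close>

definition pbw_lists :: "nat \<Rightarrow> nat set \<Rightarrow> mon list set" where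
  "pbw_lists n X1 = {ws. set ws \<subseteq> M_words n X1 \<and> sorted ws \<and>
     (\<forall>w\<in>set ws. odd_mon X1 w \<longrightarrow> count (mset ws) w = 1)}"

text \<open>Trades the square {u, u} for two copies of u. The restriction on the multiplicity of odd
  words thereby turns into free multiplicities of good words, as in the factorization of letter
  sequences.\<close>

fun unsquare :: "mon \<Rightarrow> mon list" where
  "unsquare (Brack u v) = (if u = v then [u, u] else [Brack u v])"
| "unsquare w = [w]"

lemma sum_list_deg_unsquare: "sum_list (map deg (unsquare w)) = deg w"
  by (cases w) auto

lemma unsquare_good: "w \<in> M_words n X1 \<Longrightarrow> set (unsquare w) \<subseteq> good_words n"
  by (cases w) (auto simp: M_words_def good_words_Brack)

lemma unsquare_of_good: "g \<in> good_words n \<Longrightarrow> unsquare g = [g]"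
  by (cases g) auto

lemma count_concat_unsquare:
  assumes "set ws \<subseteq> M_words n X1" "g \<in> good_words n"
  shows "count (mset (concat (map unsquare ws))) g = count (mset ws) g + 2 * count (mset ws) (Brack g g)"
  using assms(1)
proof (induction ws)
  case (Cons w ws)
  then have "w \<in> good_words n \<or> (\<exists>v\<in>good_words n. w = Brack v v)"
    by (auto simp: M_words_def)
  with Cons show ?case
    using assms(2) by (auto simp: unsquare_of_good)
qed simp

text \<open>In the image a good word g has multiplicity c(g) + 2 c({g, g}), with c the multiplicity
  in the original list. For odd g the first summand is at most 1, so parity separates the two; for
  even g the square is not in M.\<close>

lemma inj_on_unsquare:
  "inj_on (\<lambda>ws. sort (concat (map unsquare ws))) (pbw_lists n X1)"
proof
  fix ws vs assume ws: "ws \<in> pbw_lists n X1" and vs: "vs \<in> pbw_lists n X1"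
    and eq: "sort (concat (map unsquare ws)) = sort (concat (map unsquare vs))"
  from eq have "mset (concat (map unsquare ws)) = mset (concat (map unsquare vs))"
    by (metis mset_sort)
  then have c: "count (mset ws) g + 2 * count (mset ws) (Brack g g) =
      count (mset vs) g + 2 * count (mset vs) (Brack g g)" if "g \<in> good_words n" for g
    using count_concat_unsquare[of ws n X1 g] count_concat_unsquare[of vs n X1 g] ws vs that
    by (simp add: pbw_lists_def)
  have M: "w \<notin> M_words n X1 \<Longrightarrow> count (mset us) w = 0" if "us \<in> pbw_lists n X1" for us w
    using that by (auto simp: pbw_lists_def count_eq_zero_iff)
  have o: "odd_mon X1 w \<Longrightarrow> count (mset us) w \<le> 1" if "us \<in> pbw_lists n X1" for us w
    using that by (cases "w \<in> set us") (auto simp: pbw_lists_def simp flip: count_mset_0_iff)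
  have both: "count (mset ws) g = count (mset vs) g \<and>
      count (mset ws) (Brack g g) = count (mset vs) (Brack g g)" if g: "g \<in> good_words n" for g
  proof (cases "odd_mon X1 g")
    case True
    then have "count (mset ws) g \<le> 1" "count (mset vs) g \<le> 1"
      using o ws vs by auto
    with c[OF g] show ?thesis by presburger
  next
    case False
    then have "Brack g g \<notin> M_words n X1"
      by (auto simp: M_words_def)
    then have "count (mset ws) (Brack g g) = 0" "count (mset vs) (Brack g g) = 0"
      using M ws vs by blast+
    with c[OF g] show ?thesis by presburger
  qed
  have "count (mset ws) w = count (mset vs) w" for w
  proof (cases "w \<in> M_words n X1")
    case True
    then consider "w \<in> good_words n" | v where "w = Brack v v" "v \<in> good_words n"
      by (auto simp: M_words_def)
    then show ?thesis using both by cases auto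
  next
    case False
    show ?thesis using M[OF ws False] M[OF vs False] by presburger
  qed
  then have "mset ws = mset vs" by (rule multiset_eqI)
  with ws vs show "ws = vs"
    by (metis (mono_tags, lifting) mem_Collect_eq pbw_lists_def properties_for_sort)
qed

text \<open>Splitting squares, sorting and reading off letters is a composition of injections, and
  the total degree of a list becomes the number of letters.\<close>

lemma card_pbw_lists_le:
  fixes n d :: nat and X1 :: "nat set"
  defines "L \<equiv> {is. set is \<subseteq> {0..n} \<and> length is \<le> d}"
    and "Q \<equiv> {ws \<in> pbw_lists n X1. sum_list (map deg ws) \<le> d}"
  shows "finite Q" "card Q \<le> card L"
proof -
  let ?f = "\<lambda>ws. concat (map foliage (sort (concat (map unsquare ws))))"
  have g: "sort (concat (map unsquare ws)) \<in> {hs. sorted hs \<and> set hs \<subseteq> good_words n}"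
    if "ws \<in> pbw_lists n X1" for ws
    using that unsquare_good by (fastforce simp: pbw_lists_def)
  have "inj_on ((\<lambda>hs. concat (map foliage hs)) \<circ> (\<lambda>ws. sort (concat (map unsquare ws)))) Q"
  proof (rule comp_inj_on)
    show "inj_on (\<lambda>ws. sort (concat (map unsquare ws))) Q"
      by (rule inj_on_subset[OF inj_on_unsquare]) (auto simp: Q_def)
    show "inj_on (\<lambda>hs. concat (map foliage hs)) ((\<lambda>ws. sort (concat (map unsquare ws))) ` Q)"
      by (rule inj_on_subset[OF inj_on_concat_foliage[of n]]) (use g in \<open>unfold Q_def, blast\<close>)
  qed
  then have inj: "inj_on ?f Q"
    by (simp add: comp_def)
  have len: "length (?f ws) = sum_list (map deg ws)" for ws
  proof -
    have "length (?f ws) = sum_mset (image_mset deg (mset (sort (concat (map unsquare ws)))))"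
      by (simp only: length_concat_foliage mset_map[symmetric] sum_mset_sum_list)
    also have "\<dots> = sum_mset (image_mset deg (mset (concat (map unsquare ws))))"
      by (simp only: mset_sort)
    also have "\<dots> = sum_list (map deg (concat (map unsquare ws)))"
      by (simp only: mset_map[symmetric] sum_mset_sum_list)
    also have "\<dots> = sum_list (map deg ws)"
      by (induction ws) (simp_all add: sum_list_deg_unsquare)
    finally show ?thesis .
  qed
  have sub: "?f ` Q \<subseteq> L"
  proof clarify
    fix ws assume ws: "ws \<in> Q"
    have "set (?f ws) \<subseteq> {0..n}"
    proof
      fix i assume "i \<in> set (?f ws)"
      then obtain h where "h \<in> set (sort (concat (map unsquare ws)))" "i \<in> letters h"
        by (auto simp: set_foliage)
      moreover from this g[of ws] ws have "h \<in> brack_words n"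
        using good_words_brack_words by (auto simp: Q_def)
      ultimately show "i \<in> {0..n}" using brack_words_letters by blast
    qed
    with ws len[of ws] show "?f ws \<in> L"
      by (simp add: L_def Q_def)
  qed
  have fin: "finite L"
    unfolding L_def by (rule finite_lists_length_le) simp
  show "finite Q" using inj sub fin by (rule inj_on_finite)
  show "card Q \<le> card L" using inj sub fin by (rule card_inj_on_le)
qed

text \<open>Reduces reordering of factors to exchanging neighbours, both in the associative and in
  the supercommutative setting: the head of the target list is carried leftwards to its place, then
  the tail is treated behind it.\<close>

lemma adjacent_swaps:
  assumes swap: "\<And>xs a b ys. P (xs @ a # b # ys) \<Longrightarrow> P (xs @ b # a # ys)"
    and "mset ws = mset vs" "P ws"
  shows "P vs"
proof -
  have move: "P (xs @ ys @ a # zs) \<Longrightarrow> P (xs @ a # ys @ zs)" for xs ys zs a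
  proof (induction ys arbitrary: zs rule: rev_induct)
    case (snoc y ys)
    from swap[of "xs @ ys" y a zs] snoc.IH[of "y # zs"] snoc.prems show ?case by simp
  qed simp
  have "P (xs @ ws) \<Longrightarrow> P (xs @ vs)" for xs
    using assms(2)
  proof (induction vs arbitrary: ws xs)
    case (Cons a vs)
    from Cons.prems(2) have "a \<in> set ws"
      by (metis list.set_intros(1) mset_eq_setD)
    then obtain ys zs where ws: "ws = ys @ a # zs"
      by (meson split_list)
    with Cons.prems(2) have "mset (ys @ zs) = mset vs" by simp
    moreover have "P (xs @ a # ys @ zs)"
      using move Cons.prems(1) ws by simp
    ultimately show ?case
      using Cons.IH[of "xs @ [a]" "ys @ zs"] by simp
  qed simp
  from this[of "[]"] assms(3) show ?thesis by simp
qed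

lemma repeated_odd:
  assumes "\<not> (\<forall>w\<in>set ws. odd_mon X1 w \<longrightarrow> count (mset ws) w = 1)"
  obtains w rest where "odd_mon X1 w" "mset ws = mset (w # w # rest)"
proof -
  from assms obtain w where w: "w \<in> set ws" "odd_mon X1 w" "count (mset ws) w \<noteq> 1" by blast
  then have "count (mset ws) w \<ge> 2"
    using count_greater_zero_iff[of "mset ws" w] by (simp del: count_greater_zero_iff)
  then have "{#w, w#} \<subseteq># mset ws"
    by (auto simp: subseteq_mset_def)
  then obtain rest where "mset ws = mset (w # w # rest)"
    by (metis add_mset_add_single mset.simps(2) subset_mset.le_iff_add union_mset_add_mset_left
        ex_mset empty_neutral(1))
  with w(2) that show thesis by blast
qed

section \<open>Linear algebra\<close>

context vector_space_pair
begin

lemma linear_in_subspace: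
  assumes "\<And>x y. f (x + y) = f x + f y" "\<And>c x. f (s1 c x) = s2 c (f x)"
    and "vs2.subspace S" "\<And>a. a \<in> A \<Longrightarrow> f a \<in> S" "x \<in> vs1.span A"
  shows "f x \<in> S"
proof -
  have "vs1.subspace {x. f x \<in> S}"
    unfolding vs1.subspace_def
    using assms(1,2) vs2.subspace_0[OF assms(3)] vs2.subspace_add[OF assms(3)]
      vs2.subspace_scale[OF assms(3)] assms(2)[of 0 0]
    by auto
  with assms(4) have "vs1.span A \<subseteq> {x. f x \<in> S}"
    by (intro vs1.span_minimal) auto
  with assms(5) show ?thesis by blast
qed

end

lemma (in vector_space) bilinear_in_subspace:
  assumes "\<And>x y z. f (x + y) z = f x z + f y z" "\<And>x y z. f z (x + y) = f z x + f z y"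
    and "\<And>c x y. f (scale c x) y = scale c (f x y)" "\<And>c x y. f x (scale c y) = scale c (f x y)"
    and "subspace S" "\<And>a b. a \<in> A \<Longrightarrow> b \<in> B \<Longrightarrow> f a b \<in> S" "x \<in> span A" "y \<in> span B"
  shows "f x y \<in> S"
proof -
  interpret vector_space_pair scale scale ..
  have "f a y \<in> S" if "a \<in> A" for a
    using linear_in_subspace[of "f a" S B y] assms that by blast
  then show ?thesis
    using linear_in_subspace[of "\<lambda>x. f x y" S A x] assms by blast
qed

interpretation dv: vector_space "dscale :: 'k::field \<Rightarrow> (mon \<Rightarrow>\<^sub>0 'k) \<Rightarrow> _"
  by unfold_locales (simp_all add: dscale_simps)

lemma dscale_single: "c *\<^sub>s Poly_Mapping.single w d = Poly_Mapping.single w (c * d)"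
  by (rule poly_mapping_eqI) (simp add: lookup_single when_def)

lemma sum_dmon:
  fixes p :: "mon \<Rightarrow>\<^sub>0 'k::field"
  shows "p = (\<Sum>w\<in>Poly_Mapping.keys p. Poly_Mapping.lookup p w *\<^sub>s dmon w)"
  by (rule poly_mapping_eqI)
    (simp add: dscale_single lookup_sum lookup_single when_def sum.delta in_keys_iff)

lemma bilin_ext_dmon:
  "bilin_ext f (dmon u) (dmon v) = (dmon (f u v) :: mon \<Rightarrow>\<^sub>0 'k::field)"
  by (simp add: bilin_ext_def)

lemma bilin_ext_0 [simp]: "bilin_ext f 0 q = 0" "bilin_ext f p 0 = 0"
  by (simp_all add: bilin_ext_def)

lemma bilin_ext_scale:
  "bilin_ext f (c *\<^sub>s p) q = c *\<^sub>s bilin_ext f p q"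
  "bilin_ext f p (c *\<^sub>s q) = c *\<^sub>s bilin_ext f p q"
proof -
  have k: "Poly_Mapping.keys (c *\<^sub>s r) \<subseteq> Poly_Mapping.keys r" for r
    by (auto simp: in_keys_iff)
  show "bilin_ext f (c *\<^sub>s p) q = c *\<^sub>s bilin_ext f p q"
    using bilin_ext_superset[OF finite_keys k finite_keys order_refl, where q = q and f = f]
    by (simp add: bilin_ext_def dv.scale_sum_right dscale_single mult.assoc)
  show "bilin_ext f p (c *\<^sub>s q) = c *\<^sub>s bilin_ext f p q"
    using bilin_ext_superset[OF finite_keys order_refl finite_keys k, where p = p and f = f]
    by (simp add: bilin_ext_def dv.scale_sum_right dscale_single mult.left_commute)
qed

lemmas dops_simps = bilin_ext_add[of Prod, folded dmul_def] bilin_ext_add[of Brack, folded dbrack_def]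
  bilin_ext_scale[of Prod, folded dmul_def] bilin_ext_scale[of Brack, folded dbrack_def]
  bilin_ext_0[of Prod, folded dmul_def] bilin_ext_0[of Brack, folded dbrack_def]
  bilin_ext_dmon[of Prod, folded dmul_def] bilin_ext_dmon[of Brack, folded dbrack_def]

lemma dmul_diff:
  fixes p q r :: "mon \<Rightarrow>\<^sub>0 'k::field"
  shows "r \<star> (p - q) = r \<star> p - r \<star> q" "(p - q) \<star> r = p \<star> r - q \<star> r"
  using dops_simps(2)[of r "p - q" q] dops_simps(1)[of "p - q" q r] by (simp_all add: eq_diff_eq)

lemma koszul_simps:
  "koszul False t = 1" "koszul s False = 1" "koszul True True = - 1"
  by (simp_all add: koszul_def)

section \<open>Reduction of bracket words\<close>

text \<open>Isolates what the straightening of brackets uses, because it is carried out twice: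
  modulo the relation ideal, for spanning, and modulo the kernel of an evaluation in an associative
  algebra, for the count behind independence.\<close>

locale lie_congruence =
  fixes n :: nat and X1 :: "nat set" and I :: "(mon \<Rightarrow>\<^sub>0 'k::field_char_0) set"
  assumes subspace_I: "dv.subspace I"
    and left: "u \<in> brack_words n \<Longrightarrow> p \<in> I \<Longrightarrow> \<lbrace>dmon u, p\<rbrace> \<in> I"
    and right: "u \<in> brack_words n \<Longrightarrow> p \<in> I \<Longrightarrow> \<lbrace>p, dmon u\<rbrace> \<in> I"
    and anticomm: "u \<in> brack_words n \<Longrightarrow> v \<in> brack_words n \<Longrightarrow>
      dmon (Brack u v) + koszul (odd_mon X1 u) (odd_mon X1 v) *\<^sub>s dmon (Brack v u) \<in> I"
    and jacobi: "u \<in> brack_words n \<Longrightarrow> v \<in> brack_words n \<Longrightarrow> w \<in> brack_words n \<Longrightarrow>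
      dmon (Brack u (Brack v w)) - (dmon (Brack (Brack u v) w) +
        koszul (odd_mon X1 u) (odd_mon X1 v) *\<^sub>s dmon (Brack v (Brack u w))) \<in> I"
begin

definition reducible :: "mon set \<Rightarrow> mon \<Rightarrow> bool" where
  "reducible Y w \<longleftrightarrow> dmon w \<in> dv.span (dmon ` Y \<union> I)"

lemma I_span: "p \<in> I \<Longrightarrow> p \<in> dv.span (dmon ` Y \<union> I)"
  by (simp add: dv.span_base)

lemma reducible_mono: "reducible Y w \<Longrightarrow> Y \<subseteq> Z \<Longrightarrow> reducible Z w"
  unfolding reducible_def by (meson dv.span_mono Un_mono image_mono order_refl subsetD)

lemma reducible_base: "w \<in> Y \<Longrightarrow> reducible Y w"
  by (simp add: reducible_def dv.span_base)

lemma reducible_I: "c *\<^sub>s dmon w \<in> I \<Longrightarrow> c \<noteq> 0 \<Longrightarrow> reducible Y w"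
  unfolding reducible_def using dv.span_scale[OF I_span, of "c *\<^sub>s dmon w" "inverse c" Y]
  by (simp flip: dscale_simps(4) add: dscale_simps(5))

lemma reducible_brack_left:
  assumes "reducible Y w" "u \<in> brack_words n" "\<And>y. y \<in> Y \<Longrightarrow> reducible Z (Brack y u)"
  shows "reducible Z (Brack w u)"
proof -
  have "\<lbrace>dmon w, dmon u\<rbrace> \<in> dv.span (dmon ` Z \<union> I)"
    by (rule dv.bilinear_in_subspace[of dbrack _ "dmon ` Y \<union> I" "{dmon u}"])
      (use assms in \<open>auto simp: dops_simps reducible_def intro: dv.span_base I_span right\<close>)
  then show ?thesis by (simp add: dops_simps reducible_def)
qed

lemma reducible_brack_right:
  assumes "reducible Y w" "u \<in> brack_words n" "\<And>y. y \<in> Y \<Longrightarrow> reducible Z (Brack u y)"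
  shows "reducible Z (Brack u w)"
proof -
  have "\<lbrace>dmon u, dmon w\<rbrace> \<in> dv.span (dmon ` Z \<union> I)"
    by (rule dv.bilinear_in_subspace[of dbrack _ "{dmon u}" "dmon ` Y \<union> I"])
      (use assms in \<open>auto simp: dops_simps reducible_def intro: dv.span_base I_span left\<close>)
  then show ?thesis by (simp add: dops_simps reducible_def)
qed

lemma reducible_swap:
  assumes "reducible Y (Brack v u)" "u \<in> brack_words n" "v \<in> brack_words n"
  shows "reducible Y (Brack u v)"
  using dv.span_diff[OF I_span[OF anticomm[OF assms(2,3)]]
      dv.span_scale[OF assms(1)[unfolded reducible_def], of "koszul (odd_mon X1 u) (odd_mon X1 v)"]]
  unfolding reducible_def by simp

lemma reducible_jacobi:
  assumes "reducible Y (Brack u (Brack v w))" "reducible Y (Brack v (Brack u w))"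
    and "u \<in> brack_words n" "v \<in> brack_words n" "w \<in> brack_words n"
  shows "reducible Y (Brack (Brack u v) w)"
proof -
  let ?k = "koszul (odd_mon X1 u) (odd_mon X1 v) :: 'k"
  have "dmon (Brack (Brack u v) w) = dmon (Brack u (Brack v w)) - ?k *\<^sub>s dmon (Brack v (Brack u w))
      - (dmon (Brack u (Brack v w)) - (dmon (Brack (Brack u v) w) + ?k *\<^sub>s dmon (Brack v (Brack u w))))"
    by simp
  also have "\<dots> \<in> dv.span (dmon ` Y \<union> I)"
    using assms(1,2) unfolding reducible_def
    by (rule dv.span_diff[OF dv.span_diff[OF _ dv.span_scale] I_span[OF jacobi[OF assms(3-5)]]])
  finally show ?thesis by (simp add: reducible_def)
qed

lemma reducible_even_square:
  assumes "v \<in> brack_words n" "\<not> odd_mon X1 v"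
  shows "reducible Y (Brack v v)"
proof (rule reducible_I[of 2])
  show "2 *\<^sub>s dmon (Brack v v) \<in> I"
    using anticomm[OF assms(1,1)] assms(2)
    by (simp add: koszul_simps dscale_simps(5) flip: single_add) (simp add: dscale_single)
qed simp

text \<open>Jacobi for three equal odd arguments reads {v, {v, v}} = {{v, v}, v} - {v, {v, v}}, and
  anticommutativity turns {{v, v}, v} into -{v, {v, v}}. Hence 3 {v, {v, v}} vanishes modulo
  \<open>I\<close>.\<close>

lemma reducible_odd_cube:
  assumes "v \<in> brack_words n" "odd_mon X1 v"
  shows "reducible Y (Brack (Brack v v) v)"
proof (rule reducible_swap[OF reducible_I[of 3]])
  let ?a = "dmon (Brack v (Brack v v))" and ?b = "dmon (Brack (Brack v v) v)"
  have "(?a - (?b + (- 1) *\<^sub>s ?a)) + (?b + ?a) \<in> I"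
    using anticomm[of "Brack v v" v] jacobi[of v v v] assms
    by (rule_tac dv.subspace_add[OF subspace_I]) (simp_all add: koszul_simps dscale_simps(5))
  also have "(?a - (?b + (- 1) *\<^sub>s ?a)) + (?b + ?a) = 3 *\<^sub>s ?a"
    by (rule poly_mapping_eqI) (simp add: lookup_add lookup_minus)
  finally show "3 *\<^sub>s ?a \<in> I" .
qed (use assms in auto)

text \<open>The size that controls the straightening. A square {u, u} counts only as u, since
  bracketing with it is replaced by bracketing twice with u.\<close>

fun base :: "mon \<Rightarrow> mon" where
  "base (Brack u v) = (if u = v then u else Brack u v)"
| "base w = w"

lemma base_good: "w \<in> good_words n \<Longrightarrow> base w = w"
  by (cases w) auto

text \<open>The two different inequalities yield \<open>m < base w\<close> uniformly in degree above
  1: for u different from v the word {u, v} is its own base and exceeds v, whereas the base of {v,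
  v} is v itself.\<close>

definition targets :: "nat \<Rightarrow> mon \<Rightarrow> mon set" where
  "targets d m = {w \<in> M_words n X1. deg w = d \<and>
     (\<forall>u v. w = Brack u v \<longrightarrow> (u \<noteq> v \<longrightarrow> m \<le> v) \<and> (u = v \<longrightarrow> m < v))}"

lemma targets_mono: "m \<le> m' \<Longrightarrow> targets d m' \<subseteq> targets d m"
  unfolding targets_def by fastforce

lemma targets_base:
  assumes "w \<in> targets d m" "d > 1"
  shows "w \<in> M_words n X1" "deg w = d" "m < base w"
proof -
  from assms show "w \<in> M_words n X1" "deg w = d" by (auto simp: targets_def)
  with assms obtain u v where "w = Brack u v"
    using M_words_brack_words by (cases w) fastforce+
  with assms show "m < base w"
    using Brack_greater(2)[of v u] by (auto simp: targets_def intro: order_le_less_trans order_less_trans)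
qed

text \<open>The second components of the words produced never drop below the smaller of the two arguments,
  which makes the recursion on the total degree and, inside one degree, downward on that minimum
  well founded. A square \<open>{x, x}\<close> is bracketed with \<open>b\<close> through \<open>{{x, x}, b} = 2 {x, {x, b}}\<close>.\<close>

lemma reducible_M_words:
  "a \<in> M_words n X1 \<Longrightarrow> b \<in> M_words n X1 \<Longrightarrow> a \<noteq> b \<Longrightarrow> deg a + deg b = d \<Longrightarrow>
   m = min (base a) (base b) \<Longrightarrow> reducible (targets d m) (Brack a b)"
proof (induction d arbitrary: a b m rule: less_induct)
  case (less d)
  note IHd = less.IH
  from less.prems show ?case
  proof (induction "card {g \<in> brack_words n. deg g \<le> d \<and> m < g}" arbitrary: a b m rule: less_induct)
    case (less m)
    note a = \<open>a \<in> M_words n X1\<close> and b = \<open>b \<in> M_words n X1\<close>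
    have bw: "w \<in> brack_words n" if "w \<in> good_words n \<or> w \<in> M_words n X1" for w
      using that good_words_brack_words M_words_brack_words by blast
    have gM: "w \<in> M_words n X1" if "w \<in> good_words n" for w
      using that by (rule good_words_M_words)
    have base_bw: "base w \<in> brack_words n" "deg (base w) \<le> deg w" if "w \<in> brack_words n" for w
      using that by (cases w; simp)+
    \<comment> \<open>Both bases exceed \<open>m\<close>, so the inner induction applies at the
      larger minimum \<open>m'\<close>. Equal arguments, excluded there, give an odd square lying in
      \<open>targets\<close> or an even square that vanishes modulo \<open>I\<close>.\<close>
    have above: "reducible (targets d m) (Brack p w)"
      if p: "p \<in> M_words n X1" "m < base p" and w: "w \<in> M_words n X1" "m < base w"
        and d: "deg p + deg w = d" for p w
    proof (cases "p = w")
      case True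
      show ?thesis
      proof (cases "odd_mon X1 w")
        case odd: True
        have "w \<in> good_words n" using w(1) odd by (rule odd_M_words_good)
        with odd w d True show ?thesis
          by (intro reducible_base) (auto simp: targets_def base_good square_M_words)
      next
        case False
        with bw w True show ?thesis by (simp add: reducible_even_square)
      qed
    next
      case False
      define m' where "m' = min (base p) (base w)"
      have "base p \<in> brack_words n \<and> deg (base p) \<le> d" "base w \<in> brack_words n \<and> deg (base w) \<le> d"
        using base_bw[of p] base_bw[of w] p(1) w(1) bw d by fastforce+
      then have m': "m' \<in> brack_words n" "deg m' \<le> d" "m < m'"
        using p(2) w(2) by (simp_all add: m'_def min_def)
      then have "{g \<in> brack_words n. deg g \<le> d \<and> m' < g} \<subset> {g \<in> brack_words n. deg g \<le> d \<and> m < g}"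
        by (intro psubsetI subsetI; (fastforce intro: order_less_trans)?)
      moreover have "finite {g \<in> brack_words n. deg g \<le> d \<and> m < g}"
        by (rule finite_subset[OF _ finite_brack_words_deg[of n d]]) auto
      ultimately have "card {g \<in> brack_words n. deg g \<le> d \<and> m' < g} < card {g \<in> brack_words n. deg g \<le> d \<and> m < g}"
        by (simp add: psubset_card_mono)
      from less.hyps[OF this p(1) w(1) False d m'_def] show ?thesis
        by (rule reducible_mono) (rule targets_mono[OF order_less_imp_le[OF m'(3)]])
    qed
    \<comment> \<open>The argument attaining the minimum is a good word \<open>c\<close>. Either {p,
      c} is a word of M already, or p = {u, v} with c < v and Jacobi moves \<open>c\<close> into an
      inner bracket.\<close>
    have good: "reducible (targets d m) (Brack p c)"
      if p: "p \<in> M_words n X1" "m < base p" and c: "c \<in> good_words n" "c = m"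
        and d: "deg p + deg c = d" for p c
    proof -
      \<comment> \<open>The inner bracket has smaller degree and reduces to words whose base exceeds
        \<open>m\<close>; after that the outer bracket is a case of \<open>above\<close>.\<close>
      have nested: "reducible (targets d m) (Brack p1 (Brack p2 c))"
        if q: "p1 \<in> good_words n" "m < p1" "p2 \<in> good_words n" "m < p2" "deg p1 + (deg p2 + deg c) = d"
        for p1 p2
      proof (rule reducible_brack_right[of "targets (deg p2 + deg c) m"])
        show "reducible (targets (deg p2 + deg c) m) (Brack p2 c)"
          by (rule IHd) (use q c gM deg_pos[of p1] in \<open>auto simp: base_good min_def\<close>)
        fix y assume "y \<in> targets (deg p2 + deg c) m"
        then have "y \<in> M_words n X1" "deg y = deg p2 + deg c" "m < base y"
          using targets_base deg_add_gt_1 by (metis One_nat_def)+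
        then show "reducible (targets d m) (Brack p1 y)"
          by (intro above) (use q gM in \<open>auto simp: base_good\<close>)
      qed (use q bw in auto)
      show ?thesis
      proof (cases p)
        case (Letter i)
        with p c d have "Brack p c \<in> good_words n"
          by (auto simp: good_words_Brack M_words_def)
        with p c d show ?thesis
          by (intro reducible_base) (auto simp: targets_def gM Letter)
      next
        case (Prod u v)
        with p bw show ?thesis by fastforce
      next
        case (Brack u v)
        show ?thesis
        proof (cases "p \<in> good_words n \<and> v \<le> c")
          case True
          then have "base p = p" by (simp add: base_good)
          with p c have "c < p" by simp
          with True c Brack have "Brack p c \<in> good_words n" "p \<noteq> c"
            by (auto simp: good_words_Brack)
          with p c d show ?thesis
            by (intro reducible_base) (auto simp: targets_def gM)
        next
          case False
          \<comment> \<open>Covers a good \<open>p\<close> whose second component is too large as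
            well as a square {v, v} with c < v; equality of \<open>u\<close> and \<open>v\<close> is
            therefore permitted.\<close>
          with p c Brack have uv: "u \<in> good_words n" "v \<in> good_words n" "c < v" "v \<le> u"
            by (auto simp: M_words_def good_words_Brack)
          show ?thesis
            unfolding Brack
            by (rule reducible_jacobi; (rule nested)?)
              (use uv c d Brack bw in auto)
        qed
      qed
    qed
    have square: "reducible (targets d m) (Brack (Brack x x) c)"
      if x: "x \<in> good_words n" "odd_mon X1 x" "x = m"
        and c: "c \<in> M_words n X1" "m < base c" and d: "deg (Brack x x) + deg c = d" for x c
    proof -
      have "reducible (targets d m) (Brack x (Brack x c))"
      proof (rule reducible_brack_right[of "targets (deg x + deg c) m"])
        show "reducible (targets (deg x + deg c) m) (Brack x c)"
          by (rule IHd) (use x c d gM deg_pos[of x] in \<open>auto simp: base_good min_def\<close>)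
        fix y assume "y \<in> targets (deg x + deg c) m"
        then have y: "y \<in> M_words n X1" "deg y = deg x + deg c" "m < base y"
          using targets_base deg_add_gt_1 by (metis One_nat_def)+
        then have "reducible (targets d m) (Brack y x)"
          by (intro good) (use x d in auto)
        then show "reducible (targets d m) (Brack x y)"
          by (rule reducible_swap) (use x y bw in auto)
      qed (use x bw in auto)
      then show ?thesis
        by (rule reducible_jacobi[rotated]) (use \<open>reducible (targets d m) (Brack x (Brack x c))\<close> x c bw in auto)
    qed
    have ordered: "reducible (targets d m) (Brack p q)"
      if p: "p \<in> M_words n X1" and q: "q \<in> M_words n X1" and "p \<noteq> q" and le: "base q \<le> base p"
        and m: "m = base q" and d: "deg p + deg q = d" for p q
    proof (cases "q \<in> good_words n")
      case True
      show ?thesis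
      proof (cases "m < base p")
        case True
        with \<open>q \<in> good_words n\<close> m p d show ?thesis by (intro good) (auto simp: base_good)
      next
        case False
        \<comment> \<open>Distinct words with the same base are a square {q, q} and its root q, so
          an odd cube remains.\<close>
        with le m True have "base p = q" by (simp add: base_good)
        with p \<open>p \<noteq> q\<close> have "p = Brack q q" "odd_mon X1 q"
          by (auto simp: M_words_def base_good)
        with bw q show ?thesis by (simp add: reducible_odd_cube)
      qed
    next
      case False
      with q obtain x where x: "q = Brack x x" "x \<in> good_words n" "odd_mon X1 x"
        by (auto simp: M_words_def)
      have "reducible (targets d m) (Brack q p)"
      proof (cases "m < base p")
        case True
        show ?thesis
          unfolding x(1) by (rule square) (use True x m p d in auto)
      next
        case False
        with le m x have "base p = x" by simp
        with p \<open>p \<noteq> q\<close> x have "p = x"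
          by (auto simp: M_words_def base_good)
        with bw p x show ?thesis by (simp add: reducible_odd_cube)
      qed
      then show ?thesis
        by (rule reducible_swap) (use p q bw in auto)
    qed
    show ?case
    proof (cases "base b \<le> base a")
      case True
      with less.prems show ?thesis by (intro ordered) (auto simp: min_def)
    next
      case False
      with less.prems have "reducible (targets d m) (Brack b a)"
        by (intro ordered) (auto simp: min_def)
      then show ?thesis
        by (rule reducible_swap) (use a b bw in auto)
    qed
  qed
qed

text \<open>The degree is carried along because independence rests on counting words of bounded
  degree.\<close>

lemma reducible_brack_words:
  "w \<in> brack_words n \<Longrightarrow> reducible {m \<in> M_words n X1. deg m = deg w} w"
proof (induction rule: brack_words.induct)
  case (letter i)
  then show ?case by (intro reducible_base) (simp add: good_words_M_words)
next
  case (brack u v)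
  let ?M = "\<lambda>w. {m \<in> M_words n X1. deg m = deg w}"
  have *: "reducible (?M (Brack u v)) (Brack a b)"
    if "a \<in> ?M u" "b \<in> ?M v" for a b
  proof (cases "a = b")
    case True
    show ?thesis
    proof (cases "odd_mon X1 a")
      case odd: True
      with True that show ?thesis
        using odd_M_words_good[of a n X1] by (intro reducible_base) (auto simp: square_M_words)
    next
      case False
      with True that show ?thesis
        using reducible_even_square[OF M_words_brack_words[of a n X1]] by blast
    qed
  next
    case False
    with that have "reducible (targets (deg a + deg b) (min (base a) (base b))) (Brack a b)"
      by (intro reducible_M_words) auto
    then show ?thesis
      by (rule reducible_mono) (use that in \<open>auto simp: targets_def\<close>)
  qed
  have "reducible (?M (Brack u v)) (Brack a v)" if "a \<in> ?M u" for a
    by (rule reducible_brack_right[OF brack.IH(2)]) (use that * M_words_brack_words in auto)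
  then show ?case
    by (rule reducible_brack_left[OF brack.IH(1) brack.hyps(2)])
qed

end

section \<open>Evaluation in associative algebras\<close>

definition ssign :: "bool \<Rightarrow> bool \<Rightarrow> 'r::ring_1" where
  "ssign s t = (if s \<and> t then - 1 else 1)"

text \<open>The target ring has no grading, so the parities of the two arguments are supplied
  explicitly.\<close>

definition scomm :: "bool \<Rightarrow> bool \<Rightarrow> 'r \<Rightarrow> 'r \<Rightarrow> 'r::ring_1" where
  "scomm s t a b = a * b - ssign s t * (b * a)"

lemma ssign_simps [simp]:
  "ssign False t = 1" "ssign s False = 1" "ssign True True = - 1"
  by (simp_all add: ssign_def)

lemma scomm_mult_right:
  "scomm s (t \<noteq> r) a (b * c) = scomm s t a b * c + ssign s t * (b * scomm s r a c)"
  by (cases s; cases t; cases r) (simp_all add: scomm_def algebra_simps)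

lemma scomm_mult_left:
  "scomm (s \<noteq> t) r (a * b) c = a * scomm t r b c + ssign t r * (scomm s r a c * b)"
  by (cases s; cases t; cases r) (simp_all add: scomm_def algebra_simps)

lemma scomm_1 [simp]: "scomm s False a 1 = 0" "scomm False s 1 a = 0"
  by (simp_all add: scomm_def)

lemma scomm_add:
  "scomm s t (a + b) c = scomm s t a c + scomm s t b c"
  "scomm s t c (a + b) = scomm s t c a + scomm s t c b"
  by (simp_all add: scomm_def algebra_simps)

text \<open>The element \<open>c\<close> placed between the factors of a product becomes the inverse
  of the image of 1 in the Laurent model.\<close>

fun ev :: "(nat \<Rightarrow> 'r) \<Rightarrow> 'r \<Rightarrow> nat set \<Rightarrow> mon \<Rightarrow> 'r::ring_1" where
  "ev x c X1 (Letter i) = x i"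
| "ev x c X1 (Prod u v) = ev x c X1 u * c * ev x c X1 v"
| "ev x c X1 (Brack u v) = scomm (odd_mon X1 u) (odd_mon X1 v) (ev x c X1 u) (ev x c X1 v)"

text \<open>Parity is read off the formal monomials, the target being ungraded. Even and odd parts
  are kept apart because the image of a bracket depends on both of them and not only on their
  sum.\<close>

definition ev_part :: "(nat \<Rightarrow> 'r) \<Rightarrow> 'r \<Rightarrow> nat set \<Rightarrow> bool \<Rightarrow> mon \<Rightarrow> 'r::ring_1" where
  "ev_part x c X1 s w = (if odd_mon X1 w = s then ev x c X1 w else 0)"

lemma D_induct [case_names dmon add scale]:
  fixes p :: "mon \<Rightarrow>\<^sub>0 'k::field"
  assumes "\<And>w. P (dmon w)" "\<And>p q. P p \<Longrightarrow> P q \<Longrightarrow> P (p + q)" "\<And>c p. P p \<Longrightarrow> P (c *\<^sub>s p)"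
  shows "P p"
proof -
  have P_0: "P (0 *\<^sub>s dmon (Letter 0))"
    by (intro assms)
  have "P (\<Sum>w\<in>W. Poly_Mapping.lookup p w *\<^sub>s dmon w)" if "finite W" for W
    using that
  proof (induction W rule: finite_induct)
    case empty
    with P_0 show ?case by (simp add: dscale_simps)
  next
    case (insert w W)
    then show ?case by (simp add: assms)
  qed
  then show ?thesis
    by (subst sum_dmon[of p]) simp
qed

text \<open>Scalars enter through a central ring homomorphism, so that the same development serves
  the free associative algebra and the Laurent series over it.\<close>

locale k_algebra =
  fixes \<iota> :: "'k::field_char_0 \<Rightarrow> 'r::ring_1"
  assumes \<iota>_add: "\<iota> (a + b) = \<iota> a + \<iota> b"
    and \<iota>_mult: "\<iota> (a * b) = \<iota> a * \<iota> b"
    and \<iota>_1: "\<iota> 1 = 1"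
    and \<iota>_comm: "x * \<iota> a = \<iota> a * x"
begin

sublocale vector_space "\<lambda>a x. \<iota> a * x"
  by unfold_locales (simp_all add: \<iota>_add \<iota>_mult \<iota>_1 algebra_simps)

sublocale dr: vector_space_pair "dscale :: 'k \<Rightarrow> (mon \<Rightarrow>\<^sub>0 'k) \<Rightarrow> _" "\<lambda>a x. \<iota> a * x" ..

lemma \<iota>_comm': "x * (\<iota> a * y) = \<iota> a * (x * y)"
  by (metis \<iota>_comm mult.assoc)

lemma \<iota>_0: "\<iota> 0 = 0"
  using \<iota>_add[of 0 0] by simp

lemma \<iota>_minus: "\<iota> (- a) = - \<iota> a"
  using \<iota>_add[of a "- a"] by (simp add: \<iota>_0 eq_neg_iff_add_eq_0 add.commute)

lemma \<iota>_koszul: "\<iota> (koszul s t) = ssign s t"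
  by (simp add: koszul_def ssign_def \<iota>_1 \<iota>_minus)

lemma subspace_mult_ssign: "subspace S \<Longrightarrow> x \<in> S \<Longrightarrow> ssign s t * x \<in> S"
  using subspace_scale[of S x "koszul s t"] by (simp add: \<iota>_koszul)

lemma scomm_scale:
  "scomm s t (\<iota> a * x) y = \<iota> a * scomm s t x y"
  "scomm s t x (\<iota> a * y) = \<iota> a * scomm s t x y"
  by (simp_all add: scomm_def algebra_simps \<iota>_comm')

section \<open>Linear extension of evaluations to formal combinations\<close>

definition lext :: "(mon \<Rightarrow> 'r) \<Rightarrow> (mon \<Rightarrow>\<^sub>0 'k) \<Rightarrow> 'r" where
  "lext f p = (\<Sum>w\<in>Poly_Mapping.keys p. \<iota> (Poly_Mapping.lookup p w) * f w)"

lemma lext_superset: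
  "finite S \<Longrightarrow> Poly_Mapping.keys p \<subseteq> S \<Longrightarrow> lext f p = (\<Sum>w\<in>S. \<iota> (Poly_Mapping.lookup p w) * f w)"
  unfolding lext_def by (rule sum.mono_neutral_left) (auto simp: in_keys_iff \<iota>_0)

lemma lext_add: "lext f (p + q) = lext f p + lext f q"
  using Poly_Mapping.keys_add[of p q]
  by (simp add: lext_superset[of "Poly_Mapping.keys p \<union> Poly_Mapping.keys q"]
      lookup_add \<iota>_add distrib_right sum.distrib)

lemma lext_scale: "lext f (c *\<^sub>s p) = \<iota> c * lext f p"
proof -
  have "Poly_Mapping.keys (c *\<^sub>s p) \<subseteq> Poly_Mapping.keys p"
    by (auto simp: in_keys_iff)
  from lext_superset[OF finite_keys this] show ?thesis
    by (simp add: lext_def sum_distrib_left)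
qed

lemma lext_dmon: "lext f (dmon w) = f w"
  by (simp add: lext_def \<iota>_1)

lemma lext_0 [simp]: "lext f 0 = 0"
  by (simp add: lext_def)

lemma lext_uminus: "lext f (- p) = - lext f p"
  using lext_add[of f p "- p"] by (simp add: eq_neg_iff_add_eq_0 add.commute)

lemma lext_diff: "lext f (p - q) = lext f p - lext f q"
  using lext_add[of f p "- q"] by (simp add: lext_uminus)

lemma lext_in_subspace:
  "subspace S \<Longrightarrow> (\<And>w. w \<in> Poly_Mapping.keys p \<Longrightarrow> f w \<in> S) \<Longrightarrow> lext f p \<in> S"
  unfolding lext_def by (intro subspace_sum subspace_scale)

lemmas lext_simps = lext_add lext_scale lext_dmon lext_uminus lext_diff

abbreviation evp :: "(nat \<Rightarrow> 'r) \<Rightarrow> 'r \<Rightarrow> nat set \<Rightarrow> bool \<Rightarrow> (mon \<Rightarrow>\<^sub>0 'k) \<Rightarrow> 'r" where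
  "evp x c X1 s \<equiv> lext (ev_part x c X1 s)"

lemma evp_dmul:
  "evp x c X1 s (p \<star> q) = evp x c X1 False p * c * evp x c X1 s q + evp x c X1 True p * c * evp x c X1 (\<not> s) q"
proof (induction p rule: D_induct)
  case (dmon u)
  show ?case
    by (induction q rule: D_induct)
      (auto simp: lext_simps dops_simps ev_part_def algebra_simps \<iota>_comm')
qed (simp_all add: lext_simps dops_simps algebra_simps \<iota>_comm')

lemma evp_dbrack:
  "evp x c X1 s \<lbrace>p, q\<rbrace> = scomm False s (evp x c X1 False p) (evp x c X1 s q)
     + scomm True (\<not> s) (evp x c X1 True p) (evp x c X1 (\<not> s) q)"
proof (induction p rule: D_induct)
  case (dmon u)
  show ?case
    by (induction q rule: D_induct)
      (auto simp: lext_simps dops_simps ev_part_def scomm_add scomm_scale algebra_simps,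
       simp_all add: scomm_def)
qed (simp_all add: lext_simps dops_simps scomm_add scomm_scale algebra_simps)

lemma evp_DX_part:
  "p \<in> DX_part n X1 s \<Longrightarrow> evp x c X1 t p = (if t = s then evp x c X1 s p else 0)"
  by (auto simp: lext_def DX_part_def ev_part_def intro!: sum.neutral)

lemma evp_sum: "evp x c X1 False p + evp x c X1 True p = lext (ev x c X1) p"
  unfolding lext_def sum.distrib[symmetric]
  by (intro sum.cong) (auto simp: ev_part_def simp flip: distrib_left)

section \<open>The filtration by number of bracket factors\<close>

fun odd_list :: "nat set \<Rightarrow> mon list \<Rightarrow> bool" where
  "odd_list X1 [] \<longleftrightarrow> False"
| "odd_list X1 (w # ws) \<longleftrightarrow> odd_mon X1 w \<noteq> odd_list X1 ws"

lemma odd_list_append: "odd_list X1 (ws @ vs) \<longleftrightarrow> odd_list X1 ws \<noteq> odd_list X1 vs"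
  by (induction ws) auto

definition evl :: "(nat \<Rightarrow> 'r) \<Rightarrow> 'r \<Rightarrow> nat set \<Rightarrow> mon list \<Rightarrow> 'r" where
  "evl x c X1 ws = prod_list (map (ev x c X1) ws)"

lemma evl_simps [simp]:
  "evl x c X1 [] = 1" "evl x c X1 (w # ws) = ev x c X1 w * evl x c X1 ws"
  "evl x c X1 (ws @ vs) = evl x c X1 ws * evl x c X1 vs"
  by (simp_all add: evl_def)

text \<open>The index is an integer because the coefficient of X^a in a Laurent series is tested at
  \<open>p + a\<close>, where \<open>a\<close> may be negative. Below 0 there are no generators, and
  the filtration is zero.\<close>

definition filt_gen :: "(nat \<Rightarrow> 'r) \<Rightarrow> 'r \<Rightarrow> nat set \<Rightarrow> nat \<Rightarrow> int \<Rightarrow> bool \<Rightarrow> 'r set" where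
  "filt_gen x c X1 n p s =
     {evl x c X1 ws | ws. set ws \<subseteq> brack_words n \<and> int (length ws) \<le> p \<and> odd_list X1 ws = s}"

definition filt :: "(nat \<Rightarrow> 'r) \<Rightarrow> 'r \<Rightarrow> nat set \<Rightarrow> nat \<Rightarrow> int \<Rightarrow> bool \<Rightarrow> 'r set" where
  "filt x c X1 n p s = span (filt_gen x c X1 n p s)"

lemma subspace_filt [simp]: "subspace (filt x c X1 n p s)"
  by (simp add: filt_def)

lemma filt_mono: "p \<le> q \<Longrightarrow> filt x c X1 n p s \<subseteq> filt x c X1 n q s"
  unfolding filt_def filt_gen_def by (rule span_mono) force

lemma filt_evl:
  "set ws \<subseteq> brack_words n \<Longrightarrow> int (length ws) \<le> p \<Longrightarrow> s = odd_list X1 ws \<Longrightarrow>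
   evl x c X1 ws \<in> filt x c X1 n p s"
  unfolding filt_def filt_gen_def by (rule span_base) blast

lemma filt_1: "0 \<le> p \<Longrightarrow> 1 \<in> filt x c X1 n p False"
  using filt_evl[of "[]" n p False X1 x c] by simp

lemma filt_ev: "w \<in> brack_words n \<Longrightarrow> 1 \<le> p \<Longrightarrow> ev x c X1 w \<in> filt x c X1 n p (odd_mon X1 w)"
  using filt_evl[of "[w]" n p "odd_mon X1 w" X1 x c] by simp

lemma filt_mult:
  assumes "a \<in> filt x c X1 n p s" "b \<in> filt x c X1 n q t"
  shows "a * b \<in> filt x c X1 n (p + q) (s \<noteq> t)"
proof (rule bilinear_in_subspace[of "(*)" _ "filt_gen x c X1 n p s" "filt_gen x c X1 n q t"])
  fix a b assume "a \<in> filt_gen x c X1 n p s" "b \<in> filt_gen x c X1 n q t"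
  then show "a * b \<in> filt x c X1 n (p + q) (s \<noteq> t)"
    unfolding filt_gen_def
    by clarify (simp flip: evl_simps(3), rule filt_evl, auto simp: odd_list_append)
qed (use assms in \<open>auto simp: filt_def algebra_simps \<iota>_comm'\<close>)

lemma filt_mult':
  "a \<in> filt x c X1 n p s \<Longrightarrow> b \<in> filt x c X1 n q t \<Longrightarrow> p + q = m \<Longrightarrow> (s \<noteq> t) = r \<Longrightarrow>
   a * b \<in> filt x c X1 n m r"
  using filt_mult by blast

text \<open>By the derivation rules the supercommutator is a sum of products in which one factor of
  each argument has been merged into a bracket, so one factor fewer in total. The inner induction
  treats a single word on the left, the outer one a product.\<close>

lemma filt_scomm_evl:
  assumes "set ws \<subseteq> brack_words n" "set vs \<subseteq> brack_words n"
  shows "scomm (odd_list X1 ws) (odd_list X1 vs) (evl x c X1 ws) (evl x c X1 vs)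
    \<in> filt x c X1 n (int (length ws) + int (length vs) - 1) (odd_list X1 ws \<noteq> odd_list X1 vs)"
  using assms(1)
proof (induction ws)
  case Nil
  then show ?case by (simp add: subspace_0)
next
  case (Cons w ws)
  have 1: "scomm (odd_mon X1 w) (odd_list X1 vs) (ev x c X1 w) (evl x c X1 vs)
      \<in> filt x c X1 n (int (length vs)) (odd_mon X1 w \<noteq> odd_list X1 vs)"
    using assms(2)
  proof (induction vs)
    case Nil
    then show ?case by (simp add: subspace_0)
  next
    case (Cons v vs)
    let ?s = "odd_mon X1 w" and ?t = "odd_mon X1 v" and ?r = "odd_list X1 vs"
    have "scomm ?s ?t (ev x c X1 w) (ev x c X1 v) \<in> filt x c X1 n 1 (?s \<noteq> ?t)"
      using filt_ev[of "Brack w v" n 1 x c X1] Cons.prems \<open>set (w # ws) \<subseteq> brack_words n\<close> by simp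
    then have "scomm ?s ?t (ev x c X1 w) (ev x c X1 v) * evl x c X1 vs
        \<in> filt x c X1 n (int (length (v # vs))) (?s \<noteq> odd_list X1 (v # vs))"
      by (rule filt_mult'[OF _ filt_evl[of vs n "int (length vs)" ?r]]) (use Cons.prems in auto)
    moreover have "ev x c X1 v * scomm ?s ?r (ev x c X1 w) (evl x c X1 vs)
        \<in> filt x c X1 n (int (length (v # vs))) (?s \<noteq> odd_list X1 (v # vs))"
      by (rule filt_mult'[OF filt_ev[of v n 1] Cons.IH]) (use Cons.prems in auto)
    ultimately show ?case
      unfolding evl_simps odd_list.simps scomm_mult_right
      by (rule subspace_add[OF subspace_filt _ subspace_mult_ssign[OF subspace_filt]])
  qed
  let ?s = "odd_mon X1 w" and ?t = "odd_list X1 ws" and ?r = "odd_list X1 vs"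
  have "ev x c X1 w * scomm ?t ?r (evl x c X1 ws) (evl x c X1 vs)
      \<in> filt x c X1 n (int (length (w # ws)) + int (length vs) - 1) (odd_list X1 (w # ws) \<noteq> ?r)"
    by (rule filt_mult'[OF filt_ev[of w n 1] Cons.IH]) (use Cons.prems in auto)
  moreover have "scomm ?s ?r (ev x c X1 w) (evl x c X1 vs) * evl x c X1 ws
      \<in> filt x c X1 n (int (length (w # ws)) + int (length vs) - 1) (odd_list X1 (w # ws) \<noteq> ?r)"
    by (rule filt_mult'[OF 1 filt_evl[of ws n "int (length ws)" ?t]]) (use Cons.prems in auto)
  ultimately show ?case
    unfolding evl_simps odd_list.simps scomm_mult_left
    by (rule subspace_add[OF subspace_filt _ subspace_mult_ssign[OF subspace_filt]])
qed

lemma filt_scomm: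
  assumes "a \<in> filt x c X1 n p s" "b \<in> filt x c X1 n q t"
  shows "scomm s t a b \<in> filt x c X1 n (p + q - 1) (s \<noteq> t)"
proof (rule bilinear_in_subspace[of "scomm s t" _ "filt_gen x c X1 n p s" "filt_gen x c X1 n q t"])
  fix a b assume "a \<in> filt_gen x c X1 n p s" "b \<in> filt_gen x c X1 n q t"
  then obtain ws vs where "set ws \<subseteq> brack_words n" "set vs \<subseteq> brack_words n"
    "int (length ws) \<le> p" "int (length vs) \<le> q" "s = odd_list X1 ws" "t = odd_list X1 vs"
    "a = evl x c X1 ws" "b = evl x c X1 vs"
    by (auto simp: filt_gen_def)
  then show "scomm s t a b \<in> filt x c X1 n (p + q - 1) (s \<noteq> t)"
    using subsetD[OF filt_mono filt_scomm_evl[of ws n vs X1 x c], of "p + q - 1"] by simp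
qed (use assms in \<open>auto simp: filt_def scomm_add scomm_scale\<close>)

end

section \<open>Straightening in an associative algebra\<close>

context k_algebra
begin

lemma scomm_0 [simp]: "scomm s t 0 a = 0" "scomm s t a 0 = 0"
  by (simp_all add: scomm_def)

text \<open>Both parity parts must vanish: a combination whose parts merely cancel would not be
  stable under bracketing.\<close>

lemma lie_congruence_kernel:
  "lie_congruence n X1 {p :: mon \<Rightarrow>\<^sub>0 'k. \<forall>s. evp x c X1 s p = 0}"
proof
  show "dv.subspace {p :: mon \<Rightarrow>\<^sub>0 'k. \<forall>s. evp x c X1 s p = 0}"
    by (simp add: dv.subspace_def lext_simps)
next
  fix u v :: mon
  show "dmon (Brack u v) + koszul (odd_mon X1 u) (odd_mon X1 v) *\<^sub>s dmon (Brack v u)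
      \<in> {p :: mon \<Rightarrow>\<^sub>0 'k. \<forall>s. evp x c X1 s p = 0}"
    by (cases "odd_mon X1 u"; cases "odd_mon X1 v")
      (simp_all add: lext_simps \<iota>_koszul ev_part_def scomm_def)
next
  fix u v w :: mon
  show "dmon (Brack u (Brack v w)) - (dmon (Brack (Brack u v) w) +
      koszul (odd_mon X1 u) (odd_mon X1 v) *\<^sub>s dmon (Brack v (Brack u w)))
      \<in> {p :: mon \<Rightarrow>\<^sub>0 'k. \<forall>s. evp x c X1 s p = 0}"
    by (cases "odd_mon X1 u"; cases "odd_mon X1 v"; cases "odd_mon X1 w")
      (simp_all add: lext_simps \<iota>_koszul ev_part_def scomm_def algebra_simps)
qed (simp_all add: evp_dbrack)

lemma ev_M_words:
  assumes "w \<in> brack_words n"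
  shows "ev x c X1 w \<in> span (ev x c X1 ` {m \<in> M_words n X1. deg m = deg w})"
proof -
  interpret lie_congruence n X1 "{p :: mon \<Rightarrow>\<^sub>0 'k. \<forall>s. evp x c X1 s p = 0}"
    by (rule lie_congruence_kernel)
  have "lext (ev x c X1) (dmon w) \<in> span (ev x c X1 ` {m \<in> M_words n X1. deg m = deg w})"
  proof (rule dr.linear_in_subspace[OF _ _ _ _ reducible_brack_words[OF assms, unfolded reducible_def]])
    fix p :: "mon \<Rightarrow>\<^sub>0 'k"
    assume "p \<in> dmon ` {m \<in> M_words n X1. deg m = deg w} \<union> {p. \<forall>s. evp x c X1 s p = 0}"
    then show "lext (ev x c X1) p \<in> span (ev x c X1 ` {m \<in> M_words n X1. deg m = deg w})"
    proof
      assume "p \<in> {p. \<forall>s. evp x c X1 s p = 0}"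
      then show ?thesis by (simp add: span_zero flip: evp_sum[of x c X1])
    qed (auto simp: lext_simps intro: span_base)
  qed (simp_all add: lext_simps)
  then show ?thesis by (simp add: lext_simps)
qed

definition deg_list :: "mon list \<Rightarrow> nat" where
  "deg_list ws = sum_list (map deg ws)"

lemma evl_M_words:
  "set ws \<subseteq> brack_words n \<Longrightarrow> evl x c X1 ws \<in> span (evl x c X1 `
     {vs. set vs \<subseteq> M_words n X1 \<and> length vs = length ws \<and> deg_list vs = deg_list ws})"
proof (induction ws)
  case Nil
  then show ?case
    by (intro span_base) (auto simp: deg_list_def intro!: image_eqI[of _ _ "[]"])
next
  case (Cons w ws)
  let ?V = "{vs. set vs \<subseteq> M_words n X1 \<and> length vs = length (w # ws) \<and> deg_list vs = deg_list (w # ws)}"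
  have "ev x c X1 w * evl x c X1 ws \<in> span (evl x c X1 ` ?V)"
  proof (rule bilinear_in_subspace[where f = "(*)" and S = "span (evl x c X1 ` ?V)"])
    show "ev x c X1 w \<in> span (ev x c X1 ` {m \<in> M_words n X1. deg m = deg w})"
      using Cons.prems by (intro ev_M_words) simp
    show "evl x c X1 ws \<in> span (evl x c X1 `
        {vs. set vs \<subseteq> M_words n X1 \<and> length vs = length ws \<and> deg_list vs = deg_list ws})"
      using Cons by simp
    fix a b assume "a \<in> ev x c X1 ` {m \<in> M_words n X1. deg m = deg w}"
      "b \<in> evl x c X1 ` {vs. set vs \<subseteq> M_words n X1 \<and> length vs = length ws \<and> deg_list vs = deg_list ws}"
    then obtain m vs where "m \<in> M_words n X1" "deg m = deg w" "set vs \<subseteq> M_words n X1"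
      "length vs = length ws" "deg_list vs = deg_list ws" "a = ev x c X1 m" "b = evl x c X1 vs"
      by blast
    then show "a * b \<in> span (evl x c X1 ` ?V)"
      by (intro span_base image_eqI[of _ _ "m # vs"]) (auto simp: deg_list_def)
  qed (auto simp: algebra_simps \<iota>_comm')
  then show ?case by simp
qed

text \<open>Exchanging two factors changes a product by a shorter one, and the square of an odd factor is
  half of a bracket.\<close>

lemma evl_pbw_lists:
  "set ws \<subseteq> brack_words n \<Longrightarrow> evl x c X1 ws \<in> span (evl x c X1 `
     {vs \<in> pbw_lists n X1. length vs \<le> length ws \<and> deg_list vs = deg_list ws})"
proof (induction "length ws" arbitrary: ws rule: less_induct)
  case (less ws0)
  define S where "S = span (evl x c X1 ` {vs \<in> pbw_lists n X1. length vs \<le> length ws0 \<and> deg_list vs = deg_list ws0})"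
  have S: "subspace S" by (simp add: S_def)
  have shorter: "evl x c X1 vs \<in> S"
    if "set vs \<subseteq> brack_words n" "length vs < length ws0" "deg_list vs = deg_list ws0" for vs
    unfolding S_def
    by (rule subsetD[OF span_mono less.hyps[OF that(2,1)]]) (use that in auto)
  let ?P = "\<lambda>ws. set ws \<subseteq> M_words n X1 \<and> length ws = length ws0 \<and> deg_list ws = deg_list ws0 \<and> evl x c X1 ws \<in> S"
  have bw: "w \<in> brack_words n" if "w \<in> M_words n X1" for w
    using that by (rule M_words_brack_words)
  have swap: "?P (ys @ b # a # zs)" if P: "?P (ys @ a # b # zs)" for ys zs a b
  proof -
    have "evl x c X1 (ys @ Brack b a # zs) \<in> S"
      by (rule shorter) (use P bw in \<open>auto simp: deg_list_def\<close>)
    moreover have "evl x c X1 (ys @ b # a # zs) = evl x c X1 (ys @ Brack b a # zs)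
        + ssign (odd_mon X1 b) (odd_mon X1 a) * evl x c X1 (ys @ a # b # zs)"
      by (cases "odd_mon X1 a"; cases "odd_mon X1 b") (simp_all add: scomm_def algebra_simps)
    moreover have "ssign (odd_mon X1 b) (odd_mon X1 a) * evl x c X1 (ys @ a # b # zs) \<in> S"
      using P by (intro subspace_mult_ssign[OF S]) simp
    ultimately have "evl x c X1 (ys @ b # a # zs) \<in> S"
      by (metis subspace_add[OF S])
    with P show ?thesis by (auto simp: deg_list_def)
  qed
  have M: "evl x c X1 ws \<in> S"
    if ws: "set ws \<subseteq> M_words n X1" "length ws = length ws0" "deg_list ws = deg_list ws0" for ws
  proof (cases "\<forall>w\<in>set ws. odd_mon X1 w \<longrightarrow> count (mset ws) w = 1")
    case True
    have dl: "deg_list (sort ws) = deg_list ws"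
      unfolding deg_list_def by (metis mset_map mset_sort sum_mset_sum_list)
    have "sort ws \<in> pbw_lists n X1"
      using True ws by (auto simp: pbw_lists_def)
    with ws dl have "evl x c X1 (sort ws) \<in> S"
      unfolding S_def by (intro span_base) auto
    with ws dl have "?P (sort ws)" by simp
    from adjacent_swaps[of ?P, OF swap _ this] show ?thesis by simp
  next
    case False
    then obtain w rest where w: "odd_mon X1 w" and rest: "mset ws = mset (w # w # rest)"
      by (rule repeated_odd)
    have set: "set ws = set (w # w # rest)" using rest by (rule mset_eq_setD)
    have len: "length ws = length (w # w # rest)" using rest by (rule mset_eq_length)
    have dl: "deg_list ws = deg_list (w # w # rest)"
      unfolding deg_list_def by (metis mset_map rest sum_mset_sum_list)
    have "w \<in> good_words n" using ws(1) w set by (auto intro: odd_M_words_good)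
    have "evl x c X1 (Brack w w # rest) \<in> S"
      by (rule shorter) (use ws bw set len dl in \<open>auto simp: deg_list_def\<close>)
    then have "\<iota> (1/2) * evl x c X1 (Brack w w # rest) \<in> S"
      by (rule subspace_scale[OF S])
    also have "\<iota> (1/2) * evl x c X1 (Brack w w # rest)
        = \<iota> (1/2) * evl x c X1 (w # w # rest) + \<iota> (1/2) * evl x c X1 (w # w # rest)"
      using w by (simp add: scomm_def algebra_simps)
    also have "\<dots> = (\<iota> (1/2) + \<iota> (1/2)) * evl x c X1 (w # w # rest)"
      by (simp only: distrib_right)
    also have "\<iota> (1/2) + \<iota> (1/2) = 1"
      by (simp flip: \<iota>_add add: \<iota>_1)
    finally have "?P (w # w # rest)"
      using ws set len dl by simp
    from adjacent_swaps[of ?P, OF swap _ this] show ?thesis using rest by simp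
  qed
  have "evl x c X1 ws0 \<in> S"
    by (rule subsetD[OF span_minimal[OF _ S] evl_M_words[OF less.prems]]) (use M in auto)
  then show ?case by (simp add: S_def)
qed

end

section \<open>Independence in the free associative algebra\<close>

text \<open>With concatenation as addition, convolution of finitely supported functions on lists is
  the product of the free associative algebra.\<close>

instantiation list :: (type) monoid_add
begin

definition zero_list :: "'a list" where "zero_list = []"

definition plus_list :: "'a list \<Rightarrow> 'a list \<Rightarrow> 'a list" where "plus_list = (@)"

instance by standard (simp_all add: zero_list_def plus_list_def)

end

type_synonym 'k free_algebra = "nat list \<Rightarrow>\<^sub>0 'k"

definition word :: "nat list \<Rightarrow> 'k::zero_neq_one free_algebra" where
  "word is = Poly_Mapping.single is 1"

lemma word_mult: "word is * word js = (word (is @ js) :: 'k::field free_algebra)"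
  by (simp add: word_def mult_single plus_list_def)

lemma word_Nil: "word [] = (1 :: 'k::field free_algebra)"
  by (metis word_def zero_list_def single_one)

definition free_const :: "'k::zero \<Rightarrow> 'k free_algebra" where
  "free_const a = Poly_Mapping.single [] a"

lemma lookup_free_const_mult: "Poly_Mapping.lookup (free_const a * p) w = a * Poly_Mapping.lookup (p :: 'k::field free_algebra) w"
proof -
  have "free_const a * p = Poly_Mapping.map ((*) a) p"
    by (simp add: free_const_def mult_map_scale_conv_mult zero_list_def)
  then show ?thesis
    by (simp add: Poly_Mapping.map.rep_eq when_def)
qed

interpretation free: k_algebra "free_const :: 'k::field_char_0 \<Rightarrow> 'k free_algebra"
proof
  fix a b :: 'k and p :: "'k free_algebra"
  show "free_const (a + b) = free_const a + free_const b" by (simp add: free_const_def single_add)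
  show "free_const (a * b) = free_const a * free_const b"
    by (simp add: free_const_def mult_single plus_list_def)
  show "free_const (1 :: 'k) = 1"
    by (simp add: free_const_def flip: zero_list_def)
  show "p * free_const a = free_const a * p"
  proof (induction p rule: update_induct)
    case const
    then show ?case by simp
  next
    case (update p w b)
    then have u: "Poly_Mapping.update w b p = p + Poly_Mapping.single w b"
      by (intro poly_mapping_eqI) (auto simp: lookup_add lookup_single when_def lookup_update in_keys_iff)
    have "Poly_Mapping.single w b * free_const a = free_const a * Poly_Mapping.single w b"
      by (simp add: free_const_def mult_single plus_list_def mult.commute)
    with update show ?case
      by (simp add: u distrib_left distrib_right)
  qed
qed

abbreviation free_evl :: "nat set \<Rightarrow> mon list \<Rightarrow> 'k::field_char_0 free_algebra" where
  "free_evl X1 \<equiv> free.evl (\<lambda>i. word [i]) 0 X1"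

lemma free_evl_letters: "free_evl X1 (map Letter is) = word is"
proof (induction "is")
  case Nil
  then show ?case by (simp add: word_Nil)
next
  case (Cons i "is")
  then show ?case by (simp add: word_mult)
qed

lemma lookup_word: "Poly_Mapping.lookup (word is) js = (if is = js then 1 else 0)"
  by (simp add: word_def lookup_single when_def)

lemma inj_word: "inj (word :: _ \<Rightarrow> 'k::zero_neq_one free_algebra)"
  by (rule injI) (metis word_def lookup_single_eq lookup_single_not_eq zero_neq_one)

lemma independent_words: "free.independent (range (word :: _ \<Rightarrow> 'k::field_char_0 free_algebra))"
  unfolding free.independent_explicit_module
proof (intro allI impI)
  fix t and u :: "'k free_algebra \<Rightarrow> 'k" and v
  assume *: "finite t" "t \<subseteq> range word" "(\<Sum>v\<in>t. free_const (u v) * v) = 0" "v \<in> t"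
  then obtain "is" where v: "v = word is" by blast
  have "0 = Poly_Mapping.lookup (\<Sum>v\<in>t. free_const (u v) * v) is" by (simp add: *(3))
  also have "\<dots> = (\<Sum>w\<in>t. u w * Poly_Mapping.lookup w is)"
    by (simp add: lookup_sum lookup_free_const_mult)
  also have "\<dots> = (\<Sum>w\<in>t. if w = v then u v else 0)"
  proof (rule sum.cong)
    fix w assume "w \<in> t"
    with *(2) obtain js where "w = word js" by blast
    then show "u w * Poly_Mapping.lookup w is = (if w = v then u v else 0)"
      by (cases "js = is") (auto simp: v lookup_word dest: injD[OF inj_word])
  qed simp
  also have "\<dots> = u v" using *(1,4) by simp
  finally show "u v = 0" by simp
qed

definition pbw_lists_le :: "nat \<Rightarrow> nat set \<Rightarrow> nat \<Rightarrow> mon list set" where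
  "pbw_lists_le n X1 d = {ws \<in> pbw_lists n X1. sum_list (map deg ws) \<le> d}"

text \<open>Straightening keeps the degree, so lists of degree at most \<open>d\<close> correspond
  to letter words of length at most \<open>d\<close>; the bound makes both sides of the count
  finite.\<close>

lemma free_pbw_bounded:
  "inj_on (free_evl X1 :: _ \<Rightarrow> 'k::field_char_0 free_algebra) (pbw_lists_le n X1 d) \<and>
   free.independent ((free_evl X1 :: _ \<Rightarrow> 'k free_algebra) ` pbw_lists_le n X1 d)"
proof -
  let ?L = "{is. set is \<subseteq> {0..n} \<and> length is \<le> d}"
  let ?f = "free_evl X1 :: _ \<Rightarrow> 'k free_algebra" and ?w = "word :: _ \<Rightarrow> 'k free_algebra"
  have fin: "finite (pbw_lists_le n X1 d)" and card: "card (pbw_lists_le n X1 d) \<le> card ?L"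
    unfolding pbw_lists_le_def by (rule card_pbw_lists_le)+
  have span: "?w ` ?L \<subseteq> free.span (?f ` pbw_lists_le n X1 d)"
  proof clarify
    fix "is" assume "is": "set is \<subseteq> {0..n}" "length is \<le> d"
    have "?f (map Letter is) \<in> free.span (?f ` {vs \<in> pbw_lists n X1.
        length vs \<le> length (map Letter is) \<and> free.deg_list vs = free.deg_list (map Letter is)})"
      using "is" by (intro free.evl_pbw_lists) auto
    moreover have "free.deg_list (map Letter is) = length is"
      by (induction "is") (auto simp: free.deg_list_def)
    ultimately show "?w is \<in> free.span (?f ` pbw_lists_le n X1 d)"
      unfolding free_evl_letters
      by (rule_tac subsetD[OF free.span_mono]) (use "is" in \<open>auto simp: pbw_lists_le_def free.deg_list_def\<close>)
  qed
  \<comment> \<open>A finite spanning set has at least as many elements as there are words. This is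
    used for the whole image, which forces injectivity, and for the image with one redundant element
    removed, which is a contradiction.\<close>
  have bound: "card ?L \<le> card B" if "finite B" "?w ` ?L \<subseteq> free.span B" for B
  proof -
    have "free.independent (?w ` ?L)"
      by (rule free.independent_mono[OF independent_words]) auto
    from free.independent_span_bound[OF that(1) this that(2)]
    have "card (?w ` ?L) \<le> card B" by simp
    moreover have "inj_on ?w ?L"
      by (rule inj_on_subset[OF inj_word]) simp
    ultimately show ?thesis
      by (simp add: card_image)
  qed
  from bound[OF finite_imageI[OF fin] span] card card_image_le[OF fin, of ?f]
  have eq: "card (?f ` pbw_lists_le n X1 d) = card (pbw_lists_le n X1 d)" "card ?L = card (pbw_lists_le n X1 d)" by linarith+
  have "free.independent (?f ` pbw_lists_le n X1 d)"
  proof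
    assume "free.dependent (?f ` pbw_lists_le n X1 d)"
    then obtain a where a: "a \<in> ?f ` pbw_lists_le n X1 d" "a \<in> free.span (?f ` pbw_lists_le n X1 d - {a})"
      unfolding free.dependent_def by blast
    from a(2) have "free.span (?f ` pbw_lists_le n X1 d - {a}) = free.span (insert a (?f ` pbw_lists_le n X1 d - {a}))"
      by (rule free.span_redundant[symmetric])
    also have "insert a (?f ` pbw_lists_le n X1 d - {a}) = ?f ` pbw_lists_le n X1 d" using a(1) by blast
    finally have "card ?L \<le> card (?f ` pbw_lists_le n X1 d - {a})"
      using span fin by (intro bound) auto
    moreover have "card (?f ` pbw_lists_le n X1 d - {a}) < card (?f ` pbw_lists_le n X1 d)"
      using a(1) fin by (intro psubset_card_mono) auto
    ultimately show False using eq by simp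
  qed
  moreover have "inj_on ?f (pbw_lists_le n X1 d)"
    using fin eq(1) by (rule eq_card_imp_inj_on)
  ultimately show ?thesis by blast
qed

lemma free_pbw:
  "inj_on (free_evl X1 :: _ \<Rightarrow> 'k::field_char_0 free_algebra) (pbw_lists n X1)"
  "free.independent ((free_evl X1 :: _ \<Rightarrow> 'k free_algebra) ` pbw_lists n X1)"
proof -
  let ?f = "free_evl X1 :: _ \<Rightarrow> 'k free_algebra"
  have U: "pbw_lists n X1 = (\<Union>d. pbw_lists_le n X1 d)"
    by (auto simp: pbw_lists_le_def)
  have mono: "pbw_lists_le n X1 d \<subseteq> pbw_lists_le n X1 d'" if "d \<le> d'" for d d'
    using that by (auto simp: pbw_lists_le_def)
  show "inj_on ?f (pbw_lists n X1)"
  proof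
    fix ws vs assume *: "ws \<in> pbw_lists n X1" "vs \<in> pbw_lists n X1" "?f ws = ?f vs"
    then have "ws \<in> pbw_lists_le n X1 (max (sum_list (map deg ws)) (sum_list (map deg vs)))"
      "vs \<in> pbw_lists_le n X1 (max (sum_list (map deg ws)) (sum_list (map deg vs)))"
      by (auto simp: pbw_lists_le_def)
    with *(3) conjunct1[OF free_pbw_bounded[where ?'k = 'k]] show "ws = vs" by (rule_tac inj_onD)
  qed
  have "free.independent (\<Union>(range (\<lambda>d. ?f ` pbw_lists_le n X1 d)))"
  proof (rule free.independent_Union_directed)
    fix c d assume "c \<in> range (\<lambda>d. ?f ` pbw_lists_le n X1 d)" "d \<in> range (\<lambda>d. ?f ` pbw_lists_le n X1 d)"
    then obtain i j where "c = ?f ` pbw_lists_le n X1 i" "d = ?f ` pbw_lists_le n X1 j" by blast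
    then show "c \<subseteq> d \<or> d \<subseteq> c"
      using mono[of i j] mono[of j i] by (metis image_mono nat_le_linear)
  qed (use free_pbw_bounded in auto)
  then show "free.independent (?f ` pbw_lists n X1)"
    by (simp add: U image_UN)
qed

text \<open>Independence in the associated graded algebra. The shorter products are members of the
  independent family different from that of \<open>w\<close>, so a nonzero coefficient would express
  the product of \<open>w\<close> through the others.\<close>

lemma free_pbw_top:
  fixes a :: "mon list \<Rightarrow> 'k::field_char_0"
  assumes "finite S" "S \<subseteq> pbw_lists n X1" "w \<in> S"
    and len: "\<And>ws. ws \<in> S \<Longrightarrow> length ws = K"
    and low: "(\<Sum>ws\<in>S. free_const (a ws) * free_evl X1 ws) \<in> free.span (free_evl X1 ` {vs \<in> pbw_lists n X1. length vs < K})"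
  shows "a w = 0"
proof (rule ccontr)
  assume nz: "a w \<noteq> 0"
  let ?f = "free_evl X1 :: _ \<Rightarrow> 'k free_algebra"
  let ?R = "?f ` pbw_lists n X1 - {?f w}"
  have w: "w \<in> pbw_lists n X1" using assms by blast
  have R: "?f vs \<in> ?R" if "vs \<in> pbw_lists n X1" "vs \<noteq> w" for vs
    using that w inj_onD[OF free_pbw(1)] by blast
  have 1: "(\<Sum>ws\<in>S - {w}. free_const (a ws) * ?f ws) \<in> free.span ?R"
    by (intro free.span_sum free.span_scale free.span_base R) (use assms in auto)
  have "(\<Sum>ws\<in>S. free_const (a ws) * ?f ws) \<in> free.span ?R"
    by (rule subsetD[OF free.span_mono low]) (use R len[OF assms(3)] in auto)
  from free.span_diff[OF this 1] have "free_const (a w) * ?f w \<in> free.span ?R"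
    using assms(1,3) by (simp add: sum.remove)
  from free.span_scale[OF this, of "inverse (a w)"] nz have "?f w \<in> free.span ?R"
    by simp
  then have "free.dependent (?f ` pbw_lists n X1)"
    unfolding free.dependent_def using w by blast
  with free_pbw(2) show False by blast
qed

section \<open>A generalized Poisson structure from formal Laurent series\<close>

text \<open>The geometric series X - e X^2 + e^2 X^3 - ... for the inverse of X^-1 + e; the shift by
  -1 is multiplication by X.\<close>

definition shifted_inverse :: "'r::ring_1 \<Rightarrow> 'r fls" where
  "shifted_inverse e = fls_shift (- 1) (fps_to_fls (Abs_fps (\<lambda>k. (- e) ^ k)))"

lemma shifted_inverse_nth:
  "shifted_inverse e $$ m = (if m \<ge> 1 then (- e) ^ nat (m - 1) else 0)"
  by (simp add: shifted_inverse_def)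

lemma shifted_inverse:
  "(fls_X_inv + fls_const e) * shifted_inverse e = 1"
  "shifted_inverse e * (fls_X_inv + fls_const e) = 1"
proof -
  have *: "(- e) ^ nat m = - (e * (- e) ^ nat (m - 1))" "(- e) ^ nat m = - ((- e) ^ nat (m - 1) * e)"
    if "m \<ge> 1" for m :: int
  proof -
    have "nat m = Suc (nat (m - 1))" using that by simp
    then show "(- e) ^ nat m = - (e * (- e) ^ nat (m - 1))" by simp
    from \<open>nat m = _\<close> show "(- e) ^ nat m = - ((- e) ^ nat (m - 1) * e)"
      by (simp only: power_Suc2) simp
  qed
  show "(fls_X_inv + fls_const e) * shifted_inverse e = 1"
    by (rule fls_eqI)
      (use * in \<open>auto simp: distrib_right fls_X_inv_times_conv_shift shifted_inverse_nth\<close>)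
  show "shifted_inverse e * (fls_X_inv + fls_const e) = 1"
    by (rule fls_eqI)
      (use * in \<open>auto simp: distrib_left fls_X_inv_times_conv_shift shifted_inverse_nth\<close>)
qed

text \<open>Phrased with lower bounds \<open>a\<close> and \<open>b\<close> instead of subdegrees,
  since the coefficient ring may have zero divisors and the product of lowest coefficients may
  vanish.\<close>

lemma fls_times_lowest:
  fixes f g :: "'r::ring_1 fls"
  assumes f: "\<And>i. i < a \<Longrightarrow> f $$ i = 0" and g: "\<And>i. i < b \<Longrightarrow> g $$ i = 0"
  shows "(f * g) $$ (a + b) = f $$ a * g $$ b" "m < a + b \<Longrightarrow> (f * g) $$ m = 0"
proof -
  have z: "f $$ i * g $$ (m - i) = 0" if "i \<noteq> a \<or> m < a + b" "m \<le> a + b" for i m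
    using that f[of i] g[of "m - i"] by (cases "i < a"; cases "m - i < b") auto
  have "(f * g) $$ (a + b) = (\<Sum>i\<in>{fls_subdegree f..a + b - fls_subdegree g}. if i = a then f $$ a * g $$ b else 0)"
    unfolding fls_times_nth(2) by (intro sum.cong) (use z in auto)
  also have "\<dots> = f $$ a * g $$ b"
    by (auto simp: not_le fls_eq0_below_subdegree)
  finally show "(f * g) $$ (a + b) = f $$ a * g $$ b" .
  show "(f * g) $$ m = 0" if "m < a + b"
    unfolding fls_times_nth(2) by (rule sum.neutral) (use z that in auto)
qed

context k_algebra
begin

lemma evp_dmul_part:
  assumes "p \<in> DX_part n X1 s" "q \<in> DX_part n X1 t"
  shows "evp x c X1 u (p \<star> q) = (if u = (s \<noteq> t) then evp x c X1 s p * c * evp x c X1 t q else 0)"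
  using evp_DX_part[OF assms(1), of x c "\<not> s"] evp_DX_part[OF assms(2), of x c "\<not> t"]
  by (cases s; cases t; cases u) (simp_all add: evp_dmul)

lemma evp_dbrack_part:
  assumes "p \<in> DX_part n X1 s" "q \<in> DX_part n X1 t"
  shows "evp x c X1 u \<lbrace>p, q\<rbrace> = (if u = (s \<noteq> t) then scomm s t (evp x c X1 s p) (evp x c X1 t q) else 0)"
  using evp_DX_part[OF assms(1), of x c "\<not> s"] evp_DX_part[OF assms(2), of x c "\<not> t"]
  by (cases s; cases t; cases u) (simp_all add: evp_dbrack)

lemma lext_ev_dmul: "lext (ev x c X1) (p \<star> q) = lext (ev x c X1) p * c * lext (ev x c X1) q"
proof (induction p rule: D_induct)
  case (dmon u)
  show ?case
    by (induction q rule: D_induct) (simp_all add: lext_simps dops_simps algebra_simps \<iota>_comm')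
qed (simp_all add: lext_simps dops_simps algebra_simps)

lemma k_algebra_fls: "k_algebra (\<lambda>a. fls_const (\<iota> a))"
proof
  show "f * fls_const (\<iota> a) = fls_const (\<iota> a) * f" for f :: "'r fls" and a
    by (rule fls_eqI) (simp add: \<iota>_comm)
qed (simp_all add: \<iota>_add \<iota>_mult \<iota>_1 fls_plus_const)

end

lemma keys_bilin_ext:
  "Poly_Mapping.keys (bilin_ext f p q) \<subseteq>
     (\<Union>u\<in>Poly_Mapping.keys p. \<Union>v\<in>Poly_Mapping.keys q. {f u v})"
  unfolding bilin_ext_def
  by (rule order_trans[OF Poly_Mapping.keys_sum], rule UN_mono, rule subset_refl,
      rule order_trans[OF Poly_Mapping.keys_sum], rule UN_mono, rule subset_refl) simp

lemma DX_part_closed: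
  assumes "p \<in> DX_part n X1 s" "q \<in> DX_part n X1 t"
  shows "p \<star> q \<in> DX_part n X1 (s \<noteq> t)" "\<lbrace>p, q\<rbrace> \<in> DX_part n X1 (s \<noteq> t)"
  using assms keys_bilin_ext[of Prod p q] keys_bilin_ext[of Brack p q]
  by (fastforce simp: DX_part_def DX_closed dmul_def[symmetric] dbrack_def[symmetric])+

lemma dmon_DX_part: "letters w \<subseteq> {0..n} \<Longrightarrow> dmon w \<in> DX_part n X1 (odd_mon X1 w)"
  by (simp add: DX_part_def DX_dmon)

fun dprod :: "mon list \<Rightarrow> (mon \<Rightarrow>\<^sub>0 'k::field)" where
  "dprod [] = dmon (Letter 0)"
| "dprod (w # ws) = dmon w \<star> dprod ws"

locale laurent_model = k_algebra \<iota> for \<iota> :: "'k::field_char_0 \<Rightarrow> 'r::ring_1" +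
  fixes x :: "nat \<Rightarrow> 'r" and n :: nat and X1 :: "nat set"
  assumes even_0: "0 \<notin> X1"
begin

sublocale E: k_algebra "\<lambda>a. fls_const (\<iota> a)"
  by (rule k_algebra_fls)

abbreviation F :: "int \<Rightarrow> bool \<Rightarrow> 'r set" where
  "F \<equiv> filt x 0 X1 n"

definition unit :: "'r fls" where "unit = fls_X_inv + fls_const (x 0)"

definition unit_inv :: "'r fls" where "unit_inv = shifted_inverse (x 0)"

definition gens :: "nat \<Rightarrow> 'r fls" where
  "gens i = (if i = 0 then unit else fls_const (x i))"

abbreviation phi :: "mon \<Rightarrow> 'r fls" where
  "phi \<equiv> ev gens unit_inv X1"

abbreviation phip :: "bool \<Rightarrow> (mon \<Rightarrow>\<^sub>0 'k) \<Rightarrow> 'r fls" where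
  "phip \<equiv> E.evp gens unit_inv X1"

text \<open>As X^-1 has degree 1, a term r X^a has the degree of r minus a; total degree at most
  \<open>p\<close> thus means degree at most \<open>p + a\<close> for r.\<close>

definition laurent_filt :: "int \<Rightarrow> bool \<Rightarrow> 'r fls set" where
  "laurent_filt p s = {f. \<forall>a. f $$ a \<in> F (p + a) s}"

lemma unit_unit_inv: "unit * unit_inv = 1" "unit_inv * unit = 1"
  by (simp_all add: unit_def unit_inv_def shifted_inverse)

lemma subspace_laurent_filt: "E.subspace (laurent_filt p s)"
  unfolding E.subspace_def laurent_filt_def
  by (auto intro: subspace_0 subspace_add subspace_scale)

lemma laurent_filt_mult:
  assumes "f \<in> laurent_filt p s" "g \<in> laurent_filt q t" "p + q = m" "(s \<noteq> t) = r"
  shows "f * g \<in> laurent_filt m r"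
proof -
  have "(f * g) $$ a \<in> F (m + a) r" for a
    unfolding fls_times_nth(2)
  proof (rule subspace_sum[OF subspace_filt])
    fix i
    have "f $$ i \<in> F (p + i) s" "g $$ (a - i) \<in> F (q + (a - i)) t"
      using assms(1,2) by (auto simp: laurent_filt_def)
    then show "f $$ i * g $$ (a - i) \<in> F (m + a) r"
      by (rule filt_mult') (use assms(3,4) in auto)
  qed
  then show ?thesis by (simp add: laurent_filt_def)
qed

lemma laurent_filt_scomm:
  assumes "f \<in> laurent_filt p s" "g \<in> laurent_filt q t"
  shows "scomm s t f g \<in> laurent_filt (p + q - 1) (s \<noteq> t)"
  unfolding laurent_filt_def
proof (intro CollectI allI)
  fix m
  let ?df = "fls_subdegree f" and ?dg = "fls_subdegree g"
  \<comment> \<open>X is central, so once g * f is summed over the same index pairs as f * g, the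
    supercommutator can be formed coefficient by coefficient.\<close>
  have "(g * f) $$ m = (\<Sum>i\<in>{?df..m - ?dg}. g $$ (m - i) * f $$ i)"
    unfolding fls_times_nth(2)[of g f]
    by (rule sum.reindex_bij_witness[of _ "\<lambda>i. m - i" "\<lambda>i. m - i"]) auto
  moreover have "(ssign s t * h) $$ m = ssign s t * h $$ m" for h :: "'r fls"
    by (simp add: ssign_def)
  ultimately have "scomm s t f g $$ m = (\<Sum>i\<in>{?df..m - ?dg}. scomm s t (f $$ i) (g $$ (m - i)))"
    by (simp add: scomm_def fls_times_nth(2)[of f g] sum_subtractf sum_distrib_left)
  also have "\<dots> \<in> F (p + q - 1 + m) (s \<noteq> t)"
  proof (rule subspace_sum[OF subspace_filt])
    fix i
    have "f $$ i \<in> F (p + i) s" "g $$ (m - i) \<in> F (q + (m - i)) t"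
      using assms by (auto simp: laurent_filt_def)
    from filt_scomm[OF this] show "scomm s t (f $$ i) (g $$ (m - i)) \<in> F (p + q - 1 + m) (s \<noteq> t)"
      by (simp add: algebra_simps)
  qed
  finally show "scomm s t f g $$ m \<in> F (p + q - 1 + m) (s \<noteq> t)" .
qed

lemma laurent_filt_const: "r \<in> F p s \<Longrightarrow> fls_const r \<in> laurent_filt p s"
  by (simp add: laurent_filt_def subspace_0)

lemma laurent_filt_unit: "unit \<in> laurent_filt 1 False"
proof -
  have "x 0 \<in> F 1 False"
    using filt_ev[of "Letter 0" n 1 x 0 X1] even_0 by simp
  moreover have "fls_X_inv \<in> laurent_filt 1 False"
    by (auto simp: laurent_filt_def filt_1 subspace_0)
  ultimately show ?thesis
    unfolding unit_def by (intro E.subspace_add[OF subspace_laurent_filt] laurent_filt_const)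
qed

lemma laurent_filt_unit_inv: "unit_inv \<in> laurent_filt (- 1) False"
proof -
  have x: "- x 0 \<in> F 1 False"
    using filt_ev[of "Letter 0" n 1 x 0 X1] even_0 by (simp add: subspace_neg)
  have pw: "(- x 0) ^ k \<in> F (int k) False" for k
  proof (induction k)
    case 0
    then show ?case by (simp add: filt_1)
  next
    case (Suc k)
    from filt_mult'[OF x Suc, of "int (Suc k)" False] show ?case by simp
  qed
  have "unit_inv $$ a \<in> F (- 1 + a) False" for a
    using pw[of "nat (a - 1)"]
    by (cases "a \<ge> 1") (simp_all add: unit_inv_def shifted_inverse_nth subspace_0)
  then show ?thesis by (simp add: laurent_filt_def)
qed

text \<open>Degree 1 reproduces itself: 1 - 1 + 1 for products and 1 + 1 - 1 for brackets.\<close>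

lemma laurent_filt_phi: "letters w \<subseteq> {0..n} \<Longrightarrow> phi w \<in> laurent_filt 1 (odd_mon X1 w)"
proof (induction w)
  case (Letter i)
  then show ?case
    using laurent_filt_unit even_0 filt_ev[of "Letter i" n 1 x 0 X1]
    by (auto simp: gens_def intro!: laurent_filt_const)
next
  case (Prod u v)
  have "phi u * unit_inv \<in> laurent_filt 0 (odd_mon X1 u)"
    by (rule laurent_filt_mult[OF _ laurent_filt_unit_inv]) (use Prod in auto)
  then have "phi u * unit_inv * phi v \<in> laurent_filt 1 (odd_mon X1 u \<noteq> odd_mon X1 v)"
    by (rule laurent_filt_mult[where q = 1 and t = "odd_mon X1 v"]) (use Prod in auto)
  then show ?case by simp
next
  case (Brack u v)
  have "scomm (odd_mon X1 u) (odd_mon X1 v) (phi u) (phi v) \<in> laurent_filt (1 + 1 - 1) (odd_mon X1 u \<noteq> odd_mon X1 v)"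
    by (rule laurent_filt_scomm) (use Brack in auto)
  then show ?case by simp
qed

lemma laurent_filt_phip: "p \<in> DX n \<Longrightarrow> phip s p \<in> laurent_filt 1 s"
  by (intro E.lext_in_subspace subspace_laurent_filt)
    (auto simp: ev_part_def DX_def E.subspace_0[OF subspace_laurent_filt] intro!: laurent_filt_phi)

text \<open>With h = \<open>unit_inv\<close> and the Koszul sign \<epsilon>, the difference a h b -
  \<epsilon> b h a equals [a, h b] + \<epsilon> [h, b] a, and each supercommutator loses one
  degree.\<close>

lemma laurent_filt_commute:
  assumes "a \<in> laurent_filt 1 s" "b \<in> laurent_filt 1 t"
  shows "a * unit_inv * b - ssign s t * (b * unit_inv * a) \<in> laurent_filt 0 (s \<noteq> t)"
proof -
  have "unit_inv * b \<in> laurent_filt 0 t"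
    by (rule laurent_filt_mult[OF laurent_filt_unit_inv assms(2)]) auto
  from laurent_filt_scomm[OF assms(1) this] have 1: "scomm s t a (unit_inv * b) \<in> laurent_filt 0 (s \<noteq> t)"
    by simp
  have "scomm False t unit_inv b * a \<in> laurent_filt 0 (s \<noteq> t)"
    by (rule laurent_filt_mult[OF laurent_filt_scomm[OF laurent_filt_unit_inv assms(2)] assms(1)]) auto
  then have 2: "ssign s t * (scomm False t unit_inv b * a) \<in> laurent_filt 0 (s \<noteq> t)"
    by (rule E.subspace_mult_ssign[OF subspace_laurent_filt])
  have "a * unit_inv * b - ssign s t * (b * unit_inv * a)
      = scomm s t a (unit_inv * b) + ssign s t * (scomm False t unit_inv b * a)"
    by (cases s; cases t) (simp_all add: scomm_def algebra_simps)
  with E.subspace_add[OF subspace_laurent_filt 1 2] show ?thesis by simp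
qed

section \<open>The defining relations modulo degree 0\<close>

definition model_kernel :: "(mon \<Rightarrow>\<^sub>0 'k) set" where
  "model_kernel = {p \<in> DX n. \<forall>s. phip s p \<in> laurent_filt 0 s}"

lemma model_kernel_I:
  assumes "p \<in> DX n" "\<And>u. u = s \<Longrightarrow> phip u p \<in> laurent_filt 0 s" "\<And>u. u \<noteq> s \<Longrightarrow> phip u p = 0"
  shows "p \<in> model_kernel"
proof -
  have "phip u p \<in> laurent_filt 0 u" for u
    using assms(2)[of u] assms(3)[of u] E.subspace_0[OF subspace_laurent_filt, of 0 u]
    by (cases "u = s") simp_all
  with assms(1) show ?thesis by (simp add: model_kernel_def)
qed

lemma is_ideal_model_kernel: "is_ideal n model_kernel"
proof -
  have mult: "a \<star> p \<in> model_kernel \<and> p \<star> a \<in> model_kernel \<and> \<lbrace>a, p\<rbrace> \<in> model_kernel \<and> \<lbrace>p, a\<rbrace> \<in> model_kernel" if p: "p \<in> model_kernel" and a: "a \<in> DX n" for p a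
  proof -
    have P: "phip s p \<in> laurent_filt 0 s" for s using p by (simp add: model_kernel_def)
    have A: "phip s a \<in> laurent_filt 1 s" for s using a by (rule laurent_filt_phip)
    have Ah: "phip s a * unit_inv \<in> laurent_filt 0 s" for s
      by (rule laurent_filt_mult[OF A laurent_filt_unit_inv]) auto
    have Ph: "phip s p * unit_inv \<in> laurent_filt (- 1) s" for s
      by (rule laurent_filt_mult[OF P laurent_filt_unit_inv]) auto
    have "p \<in> DX n" using p by (simp add: model_kernel_def)
    have m1: "phip s a * unit_inv * phip t p \<in> laurent_filt 0 r" and m2: "phip s p * unit_inv * phip t a \<in> laurent_filt 0 r"
      and s1: "scomm s t (phip s a) (phip t p) \<in> laurent_filt 0 r" and s2: "scomm s t (phip s p) (phip t a) \<in> laurent_filt 0 r"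
      if "(s \<noteq> t) = r" for s t r
      using laurent_filt_mult[OF Ah P _ that] laurent_filt_mult[OF Ph A _ that] laurent_filt_scomm[OF A[of s] P[of t]] laurent_filt_scomm[OF P[of s] A[of t]] that
      by auto
    show ?thesis
      using \<open>p \<in> DX n\<close> a
      by (auto simp: model_kernel_def DX_closed E.evp_dmul E.evp_dbrack
          intro!: E.subspace_add[OF subspace_laurent_filt] m1 m2 s1 s2)
  qed
  have "model_kernel \<subseteq> DX n" by (auto simp: model_kernel_def)
  moreover have "0 \<in> model_kernel" by (simp add: model_kernel_def E.subspace_0[OF subspace_laurent_filt])
  moreover have "p + q \<in> model_kernel" if "p \<in> model_kernel" "q \<in> model_kernel" for p q
    using that by (auto simp: model_kernel_def DX_closed E.lext_simps intro: E.subspace_add[OF subspace_laurent_filt])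
  moreover have "c *\<^sub>s p \<in> model_kernel" if "p \<in> model_kernel" for p c
    using that by (auto simp: model_kernel_def DX_closed E.lext_simps intro: E.subspace_scale[OF subspace_laurent_filt])
  ultimately show ?thesis
    using mult by (auto simp: is_ideal_def)
qed

lemma unit_part: "dmon (Letter 0) \<in> DX_part n X1 False"
  using dmon_DX_part[of "Letter 0" n X1] even_0 by simp

lemma phip_unit: "phip False (dmon (Letter 0)) = unit" "phip True (dmon (Letter 0)) = 0"
  using even_0 by (simp_all add: E.lext_dmon ev_part_def gens_def)

text \<open>This relation is satisfied exactly, as are the unit law, anticommutativity and Jacobi;
  only supercommutativity and the Leibniz rule need the passage modulo degree 0. The flag
  \<open>True\<close> is an arbitrary choice, since both parity parts vanish.\<close>

lemma model_kernel_assoc: "a \<in> DX n \<Longrightarrow> b \<in> DX n \<Longrightarrow> c \<in> DX n \<Longrightarrow> (a \<star> b) \<star> c - a \<star> (b \<star> c) \<in> model_kernel"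
  by (rule model_kernel_I[of _ True]; (intro DX_closed)?)
    (simp_all add: E.lext_simps E.evp_dmul algebra_simps E.subspace_0[OF subspace_laurent_filt])

lemma model_kernel_unit: "a \<in> DX n \<Longrightarrow> dmon (Letter 0) \<star> a - a \<in> model_kernel"
  by (rule model_kernel_I[of _ True]; (intro DX_closed DX_part_DX[OF unit_part])?)
    (simp_all only: E.lext_diff E.evp_dmul phip_unit unit_unit_inv, simp_all add: E.subspace_0[OF subspace_laurent_filt])

lemma model_kernel_commute:
  assumes "a \<in> DX_part n X1 s" "b \<in> DX_part n X1 t"
  shows "a \<star> b - koszul s t *\<^sub>s (b \<star> a) \<in> model_kernel"
proof (rule model_kernel_I[of _ "s \<noteq> t"])
  note ab = assms[THEN DX_part_DX]
  show "a \<star> b - koszul s t *\<^sub>s (b \<star> a) \<in> DX n"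
    by (intro DX_closed ab)
  fix u
  show "u = (s \<noteq> t) \<Longrightarrow> phip u (a \<star> b - koszul s t *\<^sub>s (b \<star> a)) \<in> laurent_filt 0 (s \<noteq> t)"
    using laurent_filt_commute[OF laurent_filt_phip[OF ab(1)] laurent_filt_phip[OF ab(2)], of s t]
    by (simp add: E.lext_simps E.\<iota>_koszul E.evp_dmul_part[OF assms] E.evp_dmul_part[OF assms(2,1)] eq_commute[of s t])
  show "u \<noteq> (s \<noteq> t) \<Longrightarrow> phip u (a \<star> b - koszul s t *\<^sub>s (b \<star> a)) = 0"
    by (auto simp: E.lext_simps E.evp_dmul_part[OF assms] E.evp_dmul_part[OF assms(2,1)])
qed

lemma model_kernel_anticommute:
  assumes "a \<in> DX_part n X1 s" "b \<in> DX_part n X1 t"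
  shows "\<lbrace>a, b\<rbrace> - (- (koszul s t *\<^sub>s \<lbrace>b, a\<rbrace>)) \<in> model_kernel"
proof (rule model_kernel_I[of _ "s \<noteq> t"])
  note ab = assms[THEN DX_part_DX]
  show "\<lbrace>a, b\<rbrace> - (- (koszul s t *\<^sub>s \<lbrace>b, a\<rbrace>)) \<in> DX n"
    by (intro DX_closed ab)
  fix u
  have "phip u (\<lbrace>a, b\<rbrace> - (- (koszul s t *\<^sub>s \<lbrace>b, a\<rbrace>))) = 0"
    by (cases s; cases t)
      (auto simp: E.lext_simps E.\<iota>_koszul E.evp_dbrack_part[OF assms] E.evp_dbrack_part[OF assms(2,1)] scomm_def)
  then show "u = (s \<noteq> t) \<Longrightarrow> phip u (\<lbrace>a, b\<rbrace> - (- (koszul s t *\<^sub>s \<lbrace>b, a\<rbrace>))) \<in> laurent_filt 0 (s \<noteq> t)"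
    and "u \<noteq> (s \<noteq> t) \<Longrightarrow> phip u (\<lbrace>a, b\<rbrace> - (- (koszul s t *\<^sub>s \<lbrace>b, a\<rbrace>))) = 0"
    by (simp_all add: E.subspace_0[OF subspace_laurent_filt])
qed

lemma model_kernel_jacobi:
  assumes "a \<in> DX_part n X1 s" "b \<in> DX_part n X1 t" "c \<in> DX_part n X1 r"
  shows "\<lbrace>a, \<lbrace>b, c\<rbrace>\<rbrace> - (\<lbrace>\<lbrace>a, b\<rbrace>, c\<rbrace> + koszul s t *\<^sub>s \<lbrace>b, \<lbrace>a, c\<rbrace>\<rbrace>) \<in> model_kernel"
    (is "?p \<in> model_kernel")
proof (rule model_kernel_I[of _ True])
  note abc = assms[THEN DX_part_DX]
  note [simp] = E.evp_dbrack_part[OF assms(1) DX_part_closed(2)[OF assms(2,3)]]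
    E.evp_dbrack_part[OF DX_part_closed(2)[OF assms(1,2)] assms(3)]
    E.evp_dbrack_part[OF assms(2) DX_part_closed(2)[OF assms(1,3)]]
    E.evp_dbrack_part[OF assms(2,3)] E.evp_dbrack_part[OF assms(1,2)] E.evp_dbrack_part[OF assms(1,3)]
  show "?p \<in> DX n"
    by (intro DX_closed abc)
  fix u
  have "phip u ?p = 0"
    by (cases s; cases t; cases r)
      (auto simp: E.lext_simps E.\<iota>_koszul scomm_def algebra_simps)
  then show "u = True \<Longrightarrow> phip u ?p \<in> laurent_filt 0 True" and "u \<noteq> True \<Longrightarrow> phip u ?p = 0"
    by (simp_all add: E.subspace_0[OF subspace_laurent_filt])
qed

text \<open>The rule for the derivative of an inverse: apply the derivation [a, -] to
  \<open>unit * unit_inv = 1\<close>.\<close>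

lemma scomm_unit_inv: "scomm s False a unit_inv = - (unit_inv * scomm s False a unit * unit_inv)"
proof -
  have "unit_inv * scomm s False a (unit * unit_inv) = 0"
    by (simp add: unit_unit_inv)
  then have "unit_inv * scomm s False a unit * unit_inv + (unit_inv * unit) * scomm s False a unit_inv = 0"
    using scomm_mult_right[of s False False a unit unit_inv] by (simp add: algebra_simps)
  then show ?thesis
    by (simp add: unit_unit_inv eq_neg_iff_add_eq_0 add.commute)
qed

text \<open>Put h = \<open>unit_inv\<close> and D = [a, \<open>unit\<close>], and let \<epsilon> be
  the sign for a and b. Expanding [a, b h c] leaves the extra term \<epsilon> b [a, h] c =
  -\<epsilon> b h D h c. Together with the image D h b h c of D(a)bc, the defect is (D h b -
  \<epsilon> b h D) h c, which has degree 0 by \<open>laurent_filt_commute\<close>.\<close>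

lemma model_kernel_leibniz:
  assumes "a \<in> DX_part n X1 s" "b \<in> DX_part n X1 t" "c \<in> DX_part n X1 r"
  shows "\<lbrace>a, b \<star> c\<rbrace> - (\<lbrace>a, b\<rbrace> \<star> c + koszul s t *\<^sub>s (b \<star> \<lbrace>a, c\<rbrace>)
      - \<lbrace>a, dmon (Letter 0)\<rbrace> \<star> (b \<star> c)) \<in> model_kernel" (is "?p \<in> model_kernel")
proof (rule model_kernel_I[of _ "s \<noteq> (t \<noteq> r)"])
  note abc = assms[THEN DX_part_DX] DX_part_DX[OF unit_part]
  let ?A = "phip s a" and ?B = "phip t b" and ?C = "phip r c"
  let ?D = "scomm s False ?A unit"
  have D: "\<lbrace>a, dmon (Letter 0)\<rbrace> \<in> DX_part n X1 s"
    using DX_part_closed(2)[OF assms(1) unit_part] by simp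
  have phi_D: "phip s \<lbrace>a, dmon (Letter 0)\<rbrace> = ?D"
    using E.evp_dbrack_part[OF assms(1) unit_part, of gens unit_inv s] by (simp add: phip_unit)
  note parts = E.evp_dbrack_part[OF assms(1) DX_part_closed(1)[OF assms(2,3)]]
    E.evp_dmul_part[OF DX_part_closed(2)[OF assms(1,2)] assms(3)]
    E.evp_dmul_part[OF assms(2) DX_part_closed(2)[OF assms(1,3)]]
    E.evp_dmul_part[OF D DX_part_closed(1)[OF assms(2,3)]]
    E.evp_dmul_part[OF assms(2,3)] E.evp_dbrack_part[OF assms(1,2)] E.evp_dbrack_part[OF assms(1,3)]
  show "?p \<in> DX n"
    by (intro DX_closed abc)
  fix u
  show "u \<noteq> (s \<noteq> (t \<noteq> r)) \<Longrightarrow> phip u ?p = 0"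
    by (cases s; cases t; cases r) (auto simp: E.lext_simps parts)
  have "phip (s \<noteq> (t \<noteq> r)) ?p = scomm s (t \<noteq> r) ?A (?B * unit_inv * ?C)
      - (scomm s t ?A ?B * unit_inv * ?C + ssign s t * (?B * unit_inv * scomm s r ?A ?C)
      - ?D * unit_inv * (?B * unit_inv * ?C))"
    using phi_D by (cases s; cases t; cases r) (simp_all add: E.lext_simps parts E.\<iota>_koszul)
  also have "scomm s (t \<noteq> r) ?A (?B * unit_inv * ?C)
      = scomm s t ?A ?B * unit_inv * ?C + ssign s t * (?B * unit_inv * scomm s r ?A ?C)
        + ssign s t * (?B * scomm s False ?A unit_inv * ?C)"
    using scomm_mult_right[of s t r ?A ?B "unit_inv * ?C"] scomm_mult_right[of s False r ?A unit_inv ?C]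
    by (cases s; cases t; cases r) (simp_all add: algebra_simps)
  finally have "phip (s \<noteq> (t \<noteq> r)) ?p
      = (?D * unit_inv * ?B - ssign s t * (?B * unit_inv * ?D)) * (unit_inv * ?C)"
    by (simp add: scomm_unit_inv algebra_simps)
  moreover have "(?D * unit_inv * ?B - ssign s t * (?B * unit_inv * ?D)) * (unit_inv * ?C) \<in> laurent_filt 0 (s \<noteq> (t \<noteq> r))"
  proof (rule laurent_filt_mult[OF laurent_filt_commute])
    show "?D \<in> laurent_filt 1 s"
      using laurent_filt_scomm[OF laurent_filt_phip[OF abc(1)] laurent_filt_unit] by simp
    show "?B \<in> laurent_filt 1 t" by (rule laurent_filt_phip[OF abc(2)])
    show "unit_inv * ?C \<in> laurent_filt 0 r"
      by (rule laurent_filt_mult[OF laurent_filt_unit_inv laurent_filt_phip[OF abc(3)]]) auto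
  qed auto
  ultimately show "u = (s \<noteq> (t \<noteq> r)) \<Longrightarrow> phip u ?p \<in> laurent_filt 0 (s \<noteq> (t \<noteq> r))" by simp
qed

lemma relation_ideal_model_kernel: "relation_ideal n X1 \<subseteq> model_kernel"
  unfolding relation_ideal_def
proof (rule hull_minimal)
  show "relators n X1 \<subseteq> model_kernel"
    unfolding relators_def
    by (intro Un_least subsetI; elim CollectE exE conjE; hypsubst;
        intro model_kernel_assoc model_kernel_commute model_kernel_unit model_kernel_anticommute model_kernel_leibniz model_kernel_jacobi; assumption)
qed (rule is_ideal_model_kernel)

text \<open>The central X^-1 drops out of every supercommutator, so only the bare letter 1 retains
  it.\<close>

lemma phi_brack_words:
  "w \<in> brack_words n \<Longrightarrow> phi w = fls_const (ev x 0 X1 w) + (if w = Letter 0 then fls_X_inv else 0)"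
proof (induction rule: brack_words.induct)
  case (letter i)
  then show ?case by (simp add: gens_def unit_def add.commute)
next
  case (brack u v)
  have c: "scomm s t (fls_const a) (fls_const b) = fls_const (scomm s t a b)" for s t and a b :: 'r
    by (simp add: scomm_def ssign_def fls_minus_const fls_plus_const)
  have X: "scomm False t fls_X_inv f = 0" "scomm t False f fls_X_inv = 0" for t and f :: "'r fls"
    by (simp_all add: scomm_def fls_X_inv_times_comm)
  show ?case
    using brack even_0 by (auto simp: scomm_add c X)
qed

text \<open>The image is w1 h w2 h ... wr h \<open>unit\<close> with h = \<open>unit_inv\<close>.
  Each h starts with X and \<open>unit\<close> with X^-1, both with coefficient 1, whence the
  exponent r - 1. A factor \<open>Letter 0\<close> would contribute a further X^-1 and is
  excluded.\<close>

lemma phi_dprod: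
  assumes "set ws \<subseteq> brack_words n - {Letter 0}"
  shows "E.lext phi (dprod ws) $$ (int (length ws) - 1) = evl x 0 X1 ws"
    and "i < int (length ws) - 1 \<Longrightarrow> E.lext phi (dprod ws) $$ i = 0"
proof -
  have "E.lext phi (dprod ws) $$ (int (length ws) - 1) = evl x 0 X1 ws \<and>
      (\<forall>i < int (length ws) - 1. E.lext phi (dprod ws) $$ i = 0)"
    using assms
  proof (induction ws)
    case Nil
    then show ?case by (simp add: E.lext_dmon gens_def unit_def)
  next
    case (Cons w ws)
    let ?f = "E.lext phi (dprod ws)" and ?m = "int (length ws) - 1"
    from Cons have IH: "?f $$ ?m = evl x 0 X1 ws" "\<And>i. i < ?m \<Longrightarrow> ?f $$ i = 0" by auto
    have h: "unit_inv $$ i = 0" if "i < 1" for i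
      using that by (simp add: unit_inv_def shifted_inverse_nth)
    have eq: "E.lext phi (dprod (w # ws)) = fls_const (ev x 0 X1 w) * (unit_inv * ?f)"
      using Cons.prems by (simp add: E.lext_ev_dmul E.lext_dmon phi_brack_words mult.assoc)
    have "(unit_inv * ?f) $$ (1 + ?m) = evl x 0 X1 ws" "\<And>i. i < 1 + ?m \<Longrightarrow> (unit_inv * ?f) $$ i = 0"
      using fls_times_lowest[of 1 unit_inv ?m ?f, OF h IH(2)] IH(1)
      by (simp_all add: unit_inv_def shifted_inverse_nth)
    then show ?case
      by (simp add: eq del: dprod.simps)
  qed
  then show "E.lext phi (dprod ws) $$ (int (length ws) - 1) = evl x 0 X1 ws"
    "i < int (length ws) - 1 \<Longrightarrow> E.lext phi (dprod ws) $$ i = 0" by auto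
qed

text \<open>Lists longer than \<open>K\<close> start at higher powers of X, so the coefficient of
  X^(K-1) sees only those of length \<open>K\<close>.\<close>

lemma lowest_terms:
  assumes S: "finite S" "\<And>ws. ws \<in> S \<Longrightarrow> set ws \<subseteq> brack_words n - {Letter 0} \<and> length ws \<ge> K"
    and rel: "(\<Sum>ws\<in>S. a ws *\<^sub>s dprod ws) \<in> relation_ideal n X1"
  shows "(\<Sum>ws\<in>{ws \<in> S. length ws = K}. \<iota> (a ws) * evl x 0 X1 ws)
    \<in> span (evl x 0 X1 ` {ws. set ws \<subseteq> brack_words n \<and> length ws < K})"
proof -
  let ?p = "\<Sum>ws\<in>S. a ws *\<^sub>s dprod ws"
  let ?V = "span (evl x 0 X1 ` {ws. set ws \<subseteq> brack_words n \<and> length ws < K})"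
  have "phip False ?p $$ (int K - 1) \<in> F (0 + (int K - 1)) False" "phip True ?p $$ (int K - 1) \<in> F (0 + (int K - 1)) True"
    using rel relation_ideal_model_kernel by (auto simp: model_kernel_def laurent_filt_def)
  \<comment> \<open>In total degree 0 the coefficient of X^(K-1) has filtration degree K - 1, which
    means fewer than \<open>K\<close> bracket factors.\<close>
  moreover have "F (0 + (int K - 1)) s \<subseteq> ?V" for s
    unfolding filt_def filt_gen_def by (rule span_mono) auto
  ultimately have "(phip False ?p + phip True ?p) $$ (int K - 1) \<in> ?V"
    by (simp add: span_add subset_iff)
  then have V: "E.lext phi ?p $$ (int K - 1) \<in> ?V"
    by (simp only: E.evp_sum)
  have "E.lext phi (\<Sum>ws\<in>T. a ws *\<^sub>s dprod ws) = (\<Sum>ws\<in>T. fls_const (\<iota> (a ws)) * E.lext phi (dprod ws))" for T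
    by (induction T rule: infinite_finite_induct) (simp_all add: E.lext_simps)
  then have "E.lext phi ?p $$ (int K - 1) = (\<Sum>ws\<in>S. \<iota> (a ws) * E.lext phi (dprod ws) $$ (int K - 1))"
    by (simp add: fls_nth_sum)
  also have "\<dots> = (\<Sum>ws\<in>S. if length ws = K then \<iota> (a ws) * evl x 0 X1 ws else 0)"
  proof (rule sum.cong)
    fix ws assume "ws \<in> S"
    with S(2) phi_dprod(1)[of ws] phi_dprod(2)[of ws "int K - 1"]
    show "\<iota> (a ws) * E.lext phi (dprod ws) $$ (int K - 1) = (if length ws = K then \<iota> (a ws) * evl x 0 X1 ws else 0)"
      by (cases "length ws = K") fastforce+
  qed simp
  also have "\<dots> = (\<Sum>ws\<in>{ws \<in> S. length ws = K}. \<iota> (a ws) * evl x 0 X1 ws)"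
    using S(1) by (simp add: sum.inter_filter)
  finally show ?thesis using V by simp
qed

end

section \<open>Spanning\<close>

locale gen_poisson =
  fixes n :: nat and X1 :: "nat set" and I :: "(mon \<Rightarrow>\<^sub>0 'k::field_char_0) set"
  assumes X1: "X1 \<subseteq> {1..n}"
    and I_def: "I = relation_ideal n X1"
begin

lemma even_0: "0 \<notin> X1"
  using X1 by auto

lemma I_closed:
  "p \<in> I \<Longrightarrow> p \<in> DX n" "p \<in> I \<Longrightarrow> q \<in> I \<Longrightarrow> p + q \<in> I" "p \<in> I \<Longrightarrow> q \<in> I \<Longrightarrow> p - q \<in> I"
  "p \<in> I \<Longrightarrow> c *\<^sub>s p \<in> I"
  "p \<in> I \<Longrightarrow> a \<in> DX n \<Longrightarrow> a \<star> p \<in> I" "p \<in> I \<Longrightarrow> a \<in> DX n \<Longrightarrow> p \<star> a \<in> I"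
  "p \<in> I \<Longrightarrow> a \<in> DX n \<Longrightarrow> \<lbrace>a, p\<rbrace> \<in> I" "p \<in> I \<Longrightarrow> a \<in> DX n \<Longrightarrow> \<lbrace>p, a\<rbrace> \<in> I"
  using relation_ideal_closed(3)[of p n X1 "- q"] relation_ideal_uminus[of q n X1]
  by (simp_all add: I_def relation_ideal_closed)

lemma subspace_I: "dv.subspace I"
  using relation_ideal_closed(2) by (auto simp: dv.subspace_def I_closed I_def[symmetric]) (simp add: I_def relation_ideal_closed)

lemma relators:
  "a \<in> DX n \<Longrightarrow> b \<in> DX n \<Longrightarrow> c \<in> DX n \<Longrightarrow> (a \<star> b) \<star> c - a \<star> (b \<star> c) \<in> I"
  "a \<in> DX_part n X1 s \<Longrightarrow> b \<in> DX_part n X1 t \<Longrightarrow> a \<star> b - koszul s t *\<^sub>s (b \<star> a) \<in> I"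
  "a \<in> DX n \<Longrightarrow> dmon (Letter 0) \<star> a - a \<in> I"
  "a \<in> DX_part n X1 s \<Longrightarrow> b \<in> DX_part n X1 t \<Longrightarrow> \<lbrace>a, b\<rbrace> - (- (koszul s t *\<^sub>s \<lbrace>b, a\<rbrace>)) \<in> I"
  "a \<in> DX_part n X1 s \<Longrightarrow> b \<in> DX_part n X1 t \<Longrightarrow> c \<in> DX_part n X1 r \<Longrightarrow>
    \<lbrace>a, b \<star> c\<rbrace> - (\<lbrace>a, b\<rbrace> \<star> c + koszul s t *\<^sub>s (b \<star> \<lbrace>a, c\<rbrace>) - \<lbrace>a, dmon (Letter 0)\<rbrace> \<star> (b \<star> c)) \<in> I"
  "a \<in> DX_part n X1 s \<Longrightarrow> b \<in> DX_part n X1 t \<Longrightarrow> c \<in> DX_part n X1 r \<Longrightarrow>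
    \<lbrace>a, \<lbrace>b, c\<rbrace>\<rbrace> - (\<lbrace>\<lbrace>a, b\<rbrace>, c\<rbrace> + koszul s t *\<^sub>s \<lbrace>b, \<lbrace>a, c\<rbrace>\<rbrace>) \<in> I"
  unfolding I_def by - (rule subsetD[OF relators_relation_ideal], unfold relators_def Un_iff mem_Collect_eq, metis)+

lemma dmon_brack_DX: "w \<in> brack_words n \<Longrightarrow> dmon w \<in> DX n"
  by (intro DX_dmon brack_words_letters)

lemma dmon_brack_DX_part: "w \<in> brack_words n \<Longrightarrow> dmon w \<in> DX_part n X1 (odd_mon X1 w)"
  by (intro dmon_DX_part brack_words_letters)

sublocale lie_congruence n X1 I
proof
  show "dv.subspace I" by (rule subspace_I)
  show "u \<in> brack_words n \<Longrightarrow> p \<in> I \<Longrightarrow> \<lbrace>dmon u, p\<rbrace> \<in> I" "u \<in> brack_words n \<Longrightarrow> p \<in> I \<Longrightarrow> \<lbrace>p, dmon u\<rbrace> \<in> I" for u p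
    by (simp_all add: I_closed dmon_brack_DX)
  show "dmon (Brack u v) + koszul (odd_mon X1 u) (odd_mon X1 v) *\<^sub>s dmon (Brack v u) \<in> I"
    if "u \<in> brack_words n" "v \<in> brack_words n" for u v
    using relators(4)[OF dmon_brack_DX_part[OF that(1)] dmon_brack_DX_part[OF that(2)]]
    by (simp add: dops_simps)
  show "dmon (Brack u (Brack v w)) - (dmon (Brack (Brack u v) w) +
      koszul (odd_mon X1 u) (odd_mon X1 v) *\<^sub>s dmon (Brack v (Brack u w))) \<in> I"
    if "u \<in> brack_words n" "v \<in> brack_words n" "w \<in> brack_words n" for u v w
    using relators(6)[OF dmon_brack_DX_part[OF that(1)] dmon_brack_DX_part[OF that(2)] dmon_brack_DX_part[OF that(3)]]
    by (simp add: dops_simps)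
qed

lemma unit_DX: "dmon (Letter 0) \<in> DX n" and unit_DX_part: "dmon (Letter 0) \<in> DX_part n X1 False"
  using dmon_brack_DX[of "Letter 0"] dmon_brack_DX_part[of "Letter 0"] even_0 by auto

lemma dprod_DX_part: "set ws \<subseteq> brack_words n \<Longrightarrow> \<exists>s. (dprod ws :: mon \<Rightarrow>\<^sub>0 'k) \<in> DX_part n X1 s"
proof (induction ws)
  case Nil
  then show ?case using unit_DX_part by auto
next
  case (Cons w ws)
  then obtain s where "(dprod ws :: mon \<Rightarrow>\<^sub>0 'k) \<in> DX_part n X1 s" by auto
  then have "(dprod (w # ws) :: mon \<Rightarrow>\<^sub>0 'k) \<in> DX_part n X1 (odd_mon X1 w \<noteq> s)"
    unfolding dprod.simps
    by (rule DX_part_closed(1)[OF dmon_brack_DX_part, rotated]) (use Cons.prems in auto)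
  then show ?case by blast
qed

lemma dprod_DX: "set ws \<subseteq> brack_words n \<Longrightarrow> (dprod ws :: mon \<Rightarrow>\<^sub>0 'k) \<in> DX n"
  using dprod_DX_part DX_part_DX by blast

text \<open>Adjoining \<open>I\<close> to the generators expresses spanning of the quotient inside
  the formal space, without cosets.\<close>

definition mod_span :: "mon list set \<Rightarrow> (mon \<Rightarrow>\<^sub>0 'k) set" where
  "mod_span B = dv.span (dprod ` B \<union> I)"

lemma subspace_mod_span [simp]: "dv.subspace (mod_span B)"
  by (simp add: mod_span_def)

lemma mod_span_I: "p \<in> I \<Longrightarrow> p \<in> mod_span B"
  by (simp add: mod_span_def dv.span_base)

lemma mod_span_base: "ws \<in> B \<Longrightarrow> dprod ws \<in> mod_span B"
  by (simp add: mod_span_def dv.span_base)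

lemma mod_span_cong: "p - q \<in> I \<Longrightarrow> p \<in> mod_span B \<longleftrightarrow> q \<in> mod_span B"
proof -
  assume "p - q \<in> I"
  then have "p - q \<in> mod_span B" by (rule mod_span_I)
  then show ?thesis
    using dv.subspace_add[OF subspace_mod_span, of "p - q" B q] dv.subspace_diff[OF subspace_mod_span, of p B "p - q"]
    by auto
qed

lemma I_trans: "p - q \<in> I \<Longrightarrow> q - r \<in> I \<Longrightarrow> p - r \<in> I"
  using I_closed(2)[of "p - q" "q - r"] by simp

section \<open>Reduction to products of bracket words\<close>

abbreviation "brack_span \<equiv> mod_span {ws. set ws \<subseteq> brack_words n}"

lemma dprod_append:
  "set ws \<subseteq> brack_words n \<Longrightarrow> set vs \<subseteq> brack_words n \<Longrightarrow> dprod ws \<star> dprod vs - dprod (ws @ vs) \<in> I"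
proof (induction ws)
  case Nil
  then show ?case by (simp add: relators(3) dprod_DX)
next
  case (Cons w ws)
  then have "dmon w \<star> (dprod ws \<star> dprod vs - dprod (ws @ vs)) \<in> I"
    by (intro I_closed(5)) (auto intro: dmon_brack_DX)
  then have "dmon w \<star> (dprod ws \<star> dprod vs) - dprod ((w # ws) @ vs) \<in> I"
    by (simp add: dmul_diff)
  moreover have "(dmon w \<star> dprod ws) \<star> dprod vs - dmon w \<star> (dprod ws \<star> dprod vs) \<in> I"
    using Cons.prems by (intro relators(1) dmon_brack_DX dprod_DX) auto
  ultimately show ?case
    using I_trans by simp
qed

lemma brack_span_mult: "p \<in> brack_span \<Longrightarrow> q \<in> brack_span \<Longrightarrow> p \<star> q \<in> brack_span"
proof -
  assume "p \<in> brack_span" "q \<in> brack_span"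
  show ?thesis
  proof (rule dv.bilinear_in_subspace[where f = dmul and S = brack_span])
    show "p \<in> dv.span (dprod ` {ws. set ws \<subseteq> brack_words n} \<union> I)"
      "q \<in> dv.span (dprod ` {ws. set ws \<subseteq> brack_words n} \<union> I)"
      using \<open>p \<in> brack_span\<close> \<open>q \<in> brack_span\<close> by (simp_all add: mod_span_def)
    fix a b assume a: "a \<in> dprod ` {ws. set ws \<subseteq> brack_words n} \<union> I"
      and b: "b \<in> dprod ` {ws. set ws \<subseteq> brack_words n} \<union> I"
    then have DX: "a \<in> DX n" "b \<in> DX n"
      using I_closed(1) dprod_DX by blast+
    show "a \<star> b \<in> brack_span"
    proof (cases "a \<in> I \<or> b \<in> I")
      case True
      with DX show ?thesis by (auto intro: mod_span_I I_closed(5,6))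
    next
      case False
      with a b obtain ws vs where *: "set ws \<subseteq> brack_words n" "set vs \<subseteq> brack_words n"
        "a = dprod ws" "b = dprod vs" by auto
      with mod_span_base[of "ws @ vs" "{ws. set ws \<subseteq> brack_words n}"] show ?thesis
        by (simp add: mod_span_cong[OF dprod_append[OF *(1,2)]])
    qed
  qed (simp_all add: dops_simps)
qed

lemma dmon_dprod: "w \<in> brack_words n \<Longrightarrow> dprod [w] - dmon w \<in> I"
  using I_trans[OF relators(2)[OF dmon_brack_DX_part unit_DX_part] ] relators(3)[OF dmon_brack_DX]
  by (simp add: koszul_simps dscale_simps)

lemma dmon_brack_span: "w \<in> brack_words n \<Longrightarrow> dmon w \<in> brack_span"
  using mod_span_cong[OF dmon_dprod[of w], of "{ws. set ws \<subseteq> brack_words n}"] mod_span_base[of "[w]" "{ws. set ws \<subseteq> brack_words n}"]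
  by simp

text \<open>The Leibniz rule peels off one factor at a time. Its correction term brackets
  \<open>a\<close> with \<open>Letter 0\<close>, which is a bracket word itself, so
  \<open>gen\<close> covers that term too.\<close>

lemma brack_span_bracket_dprod:
  assumes a: "a \<in> DX_part n X1 s" and gen: "\<And>v. v \<in> brack_words n \<Longrightarrow> \<lbrace>a, dmon v\<rbrace> \<in> brack_span"
  shows "set vs \<subseteq> brack_words n \<Longrightarrow> \<lbrace>a, dprod vs\<rbrace> \<in> brack_span"
proof (induction vs)
  case Nil
  then show ?case by (simp add: gen)
next
  case (Cons v vs)
  then obtain r where r: "(dprod vs :: mon \<Rightarrow>\<^sub>0 'k) \<in> DX_part n X1 r"
    using dprod_DX_part[of vs] by auto
  have v: "v \<in> brack_words n" and vs: "dprod vs \<in> brack_span"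
    using Cons.prems by (auto intro: mod_span_base)
  have "\<lbrace>a, dmon v\<rbrace> \<star> dprod vs + koszul s (odd_mon X1 v) *\<^sub>s (dmon v \<star> \<lbrace>a, dprod vs\<rbrace>)
      - \<lbrace>a, dmon (Letter 0)\<rbrace> \<star> (dmon v \<star> dprod vs) \<in> brack_span"
    using Cons v vs
    by (intro dv.subspace_add dv.subspace_diff dv.subspace_scale brack_span_mult gen dmon_brack_span subspace_mod_span) auto
  then show ?case
    using mod_span_cong[OF relators(5)[OF a dmon_brack_DX_part[OF v] r]] by simp
qed

text \<open>The Leibniz rule expands only the right argument. So a word is bracketed with a product
  first, anticommutativity exchanges the two, and then the product on the left can serve as the
  fixed argument.\<close>

lemma brack_span_bracket_dprods:
  assumes "set ws \<subseteq> brack_words n" "set vs \<subseteq> brack_words n"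
  shows "\<lbrace>dprod ws, dprod vs\<rbrace> \<in> brack_span"
proof -
  from assms(1) obtain s where s: "(dprod ws :: mon \<Rightarrow>\<^sub>0 'k) \<in> DX_part n X1 s"
    using dprod_DX_part by blast
  have 1: "\<lbrace>dmon v, dprod ws\<rbrace> \<in> brack_span" if "v \<in> brack_words n" for v
    by (rule brack_span_bracket_dprod[OF dmon_brack_DX_part[OF that] _ assms(1)])
      (use that in \<open>simp add: dops_simps dmon_brack_span\<close>)
  have "\<lbrace>dprod ws, dmon v\<rbrace> \<in> brack_span" if v: "v \<in> brack_words n" for v
  proof -
    have "- (koszul s (odd_mon X1 v) *\<^sub>s \<lbrace>dmon v, dprod ws\<rbrace>) \<in> brack_span"
      using 1[OF v] by (intro dv.subspace_neg dv.subspace_scale subspace_mod_span)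
    then show ?thesis
      using mod_span_cong[OF relators(4)[OF s dmon_brack_DX_part[OF v]]] by simp
  qed
  from brack_span_bracket_dprod[OF s this assms(2)] show ?thesis .
qed

lemma brack_span_bracket: "p \<in> brack_span \<Longrightarrow> q \<in> brack_span \<Longrightarrow> \<lbrace>p, q\<rbrace> \<in> brack_span"
proof -
  assume "p \<in> brack_span" "q \<in> brack_span"
  show ?thesis
  proof (rule dv.bilinear_in_subspace[where f = dbrack and S = brack_span])
    show "p \<in> dv.span (dprod ` {ws. set ws \<subseteq> brack_words n} \<union> I)"
      "q \<in> dv.span (dprod ` {ws. set ws \<subseteq> brack_words n} \<union> I)"
      using \<open>p \<in> brack_span\<close> \<open>q \<in> brack_span\<close> by (simp_all add: mod_span_def)
    fix a b assume "a \<in> dprod ` {ws. set ws \<subseteq> brack_words n} \<union> I"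
      "b \<in> dprod ` {ws. set ws \<subseteq> brack_words n} \<union> I"
    then show "\<lbrace>a, b\<rbrace> \<in> brack_span"
      by (auto intro!: brack_span_bracket_dprods intro: mod_span_I I_closed(1,7,8) dprod_DX)
  qed (simp_all add: dops_simps)
qed

lemma dmon_in_brack_span: "letters w \<subseteq> {0..n} \<Longrightarrow> dmon w \<in> brack_span"
proof (induction w)
  case (Letter i)
  then show ?case by (simp add: dmon_brack_span)
next
  case (Prod u v)
  then have "dmon u \<star> dmon v \<in> brack_span" by (intro brack_span_mult) auto
  then show ?case by (simp add: dops_simps)
next
  case (Brack u v)
  then have "\<lbrace>dmon u, dmon v\<rbrace> \<in> brack_span" by (intro brack_span_bracket) auto
  then show ?case by (simp add: dops_simps)
qed

lemma DX_brack_span: "p \<in> DX n \<Longrightarrow> p \<in> brack_span"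
proof -
  assume p: "p \<in> DX n"
  have "(\<Sum>w\<in>Poly_Mapping.keys p. Poly_Mapping.lookup p w *\<^sub>s dmon w) \<in> brack_span"
    using p by (intro dv.subspace_sum dv.subspace_scale subspace_mod_span dmon_in_brack_span) (auto simp: DX_def)
  then show ?thesis by (simp flip: sum_dmon)
qed

section \<open>Reduction to ordered products of words of M\<close>

lemma dprod_M_words:
  "set ws \<subseteq> brack_words n \<Longrightarrow> dprod ws \<in> mod_span {ws. set ws \<subseteq> M_words n X1}"
proof (induction ws)
  case Nil
  then show ?case by (intro mod_span_base) simp
next
  case (Cons w ws)
  let ?V = "mod_span {ws. set ws \<subseteq> M_words n X1}"
  have "dmon w \<star> dprod ws \<in> ?V"
  proof (rule dv.bilinear_in_subspace[where f = dmul and S = ?V])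
    show "dmon w \<in> dv.span (dmon ` {m \<in> M_words n X1. deg m = deg w} \<union> I)"
      using Cons.prems reducible_brack_words[of w] by (simp add: reducible_def)
    show "dprod ws \<in> dv.span (dprod ` {ws. set ws \<subseteq> M_words n X1} \<union> I)"
      using Cons by (simp add: mod_span_def)
    have bw: "set ws \<subseteq> brack_words n" if "set ws \<subseteq> M_words n X1" for ws
      using that M_words_brack_words by blast
    fix a b assume a: "a \<in> dmon ` {m \<in> M_words n X1. deg m = deg w} \<union> I"
      and b: "b \<in> dprod ` {ws. set ws \<subseteq> M_words n X1} \<union> I"
    then have DX: "a \<in> DX n" "b \<in> DX n"
      using I_closed(1) dmon_brack_DX[OF M_words_brack_words] dprod_DX[OF bw] by blast+
    show "a \<star> b \<in> ?V"
    proof (cases "a \<in> I \<or> b \<in> I")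
      case True
      with DX show ?thesis by (auto intro: mod_span_I I_closed(5,6))
    next
      case False
      with a b obtain m vs where "m \<in> M_words n X1" "set vs \<subseteq> M_words n X1" "a = dmon m" "b = dprod vs"
        by auto
      then show ?thesis using mod_span_base[of "m # vs" "{ws. set ws \<subseteq> M_words n X1}"] by simp
    qed
  qed (simp_all add: dops_simps)
  then show ?case by simp
qed

text \<open>Unlike in the associative algebra, exchanging factors leaves no shorter correction term:
  the product is supercommutative modulo \<open>I\<close>.\<close>

lemma dprod_swap:
  "set (xs @ a # b # ys) \<subseteq> brack_words n \<Longrightarrow>
   dprod (xs @ a # b # ys) - koszul (odd_mon X1 a) (odd_mon X1 b) *\<^sub>s dprod (xs @ b # a # ys) \<in> I"
proof (induction xs)
  case Nil
  let ?k = "koszul (odd_mon X1 a) (odd_mon X1 b) :: 'k" and ?P = "dprod ys :: mon \<Rightarrow>\<^sub>0 'k"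
  have *: "dmon a \<in> DX n" "dmon b \<in> DX n" "?P \<in> DX n" "a \<in> brack_words n" "b \<in> brack_words n"
    using Nil by (auto intro: dmon_brack_DX dprod_DX)
  have 1: "(dmon a \<star> dmon b) \<star> ?P - dmon a \<star> (dmon b \<star> ?P) \<in> I"
    by (intro relators *)
  have 2: "?k *\<^sub>s ((dmon b \<star> dmon a) \<star> ?P - dmon b \<star> (dmon a \<star> ?P)) \<in> I"
    by (intro I_closed relators *)
  have "(dmon a \<star> dmon b - ?k *\<^sub>s (dmon b \<star> dmon a)) \<star> ?P \<in> I"
    by (intro I_closed(6) relators(2) dmon_brack_DX_part *)
  moreover have "(dmon a \<star> dmon b - ?k *\<^sub>s (dmon b \<star> dmon a)) \<star> ?P
      = (dmon a \<star> dmon b) \<star> ?P - ?k *\<^sub>s ((dmon b \<star> dmon a) \<star> ?P)"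
    by (simp only: dmul_diff dops_simps(5))
  ultimately have "(dmon a \<star> dmon b) \<star> ?P - ?k *\<^sub>s ((dmon b \<star> dmon a) \<star> ?P) \<in> I" by simp
  from I_closed(2)[OF I_closed(3)[OF this 1] 2] show ?case
    by (simp add: dscale_simps algebra_simps)
next
  case (Cons x xs)
  let ?k = "koszul (odd_mon X1 a) (odd_mon X1 b) :: 'k"
  let ?p = "dprod (xs @ a # b # ys) :: mon \<Rightarrow>\<^sub>0 'k" and ?q = "dprod (xs @ b # a # ys) :: mon \<Rightarrow>\<^sub>0 'k"
  have "dmon x \<star> (?p - ?k *\<^sub>s ?q) \<in> I"
    using Cons by (intro I_closed(5)) (auto intro: dmon_brack_DX)
  moreover have "dmon x \<star> (?p - ?k *\<^sub>s ?q) = dmon x \<star> ?p - ?k *\<^sub>s (dmon x \<star> ?q)"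
    by (simp only: dmul_diff dops_simps(6))
  ultimately show ?case by simp
qed

abbreviation "basis_lists \<equiv> {ws \<in> pbw_lists n X1. Letter 0 \<notin> set ws}"

text \<open>The induction on length serves to delete factors 1 by the unit law. A product with a
  repeated odd factor is its own negative modulo \<open>I\<close> and hence lies in
  \<open>I\<close>.\<close>

lemma dprod_basis_lists:
  "set ws \<subseteq> M_words n X1 \<Longrightarrow> dprod ws \<in> mod_span basis_lists"
proof (induction "length ws" arbitrary: ws rule: less_induct)
  case (less ws)
  let ?P = "\<lambda>ws. set ws \<subseteq> M_words n X1 \<and> dprod ws \<in> mod_span basis_lists"
  have bw: "set ws \<subseteq> brack_words n" if "set ws \<subseteq> M_words n X1" for ws
    using that M_words_brack_words by blast
  have swap: "?P (xs @ b # a # ys)" if P: "?P (xs @ a # b # ys)" for xs a b ys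
  proof -
    have "koszul (odd_mon X1 b) (odd_mon X1 a) *\<^sub>s dprod (xs @ a # b # ys) \<in> mod_span basis_lists"
      using P by (intro dv.subspace_scale subspace_mod_span) simp
    moreover have "set (xs @ b # a # ys) \<subseteq> brack_words n"
      using P by (intro bw) auto
    ultimately have "dprod (xs @ b # a # ys) \<in> mod_span basis_lists"
      using mod_span_cong[OF dprod_swap] by blast
    with P show ?thesis by auto
  qed
  have perm: "dprod ws \<in> mod_span basis_lists" if "?P vs" "mset vs = mset ws" for vs
    using adjacent_swaps[of ?P, OF swap that(2,1)] by blast
  show ?case
  proof (cases "Letter 0 \<in> set ws")
    case True
    then obtain xs ys where ws: "ws = xs @ Letter 0 # ys" by (meson split_list)
    then have "dprod (xs @ ys) \<in> mod_span basis_lists"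
      using less.prems by (intro less.hyps) auto
    moreover have "dprod (Letter 0 # xs @ ys) - dprod (xs @ ys) \<in> I"
      using less.prems bw[of ws] ws by (simp, intro relators(3) dprod_DX) auto
    ultimately have "dprod (Letter 0 # xs @ ys) \<in> mod_span basis_lists"
      using mod_span_cong by blast
    with less.prems ws show ?thesis
      by (intro perm[of "Letter 0 # xs @ ys"]) auto
  next
    case no_0: False
    show ?thesis
    proof (cases "\<forall>w\<in>set ws. odd_mon X1 w \<longrightarrow> count (mset ws) w = 1")
      case True
      with less.prems no_0 have "sort ws \<in> basis_lists"
        by (auto simp: pbw_lists_def)
      with less.prems show ?thesis
        by (intro perm[of "sort ws"]) (auto intro: mod_span_base)
    next
      case False
      then obtain w rest where w: "odd_mon X1 w" "mset ws = mset (w # w # rest)"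
        by (rule repeated_odd)
      have set: "set ws = set (w # w # rest)" using w(2) by (rule mset_eq_setD)
      let ?p = "dprod (w # w # rest) :: mon \<Rightarrow>\<^sub>0 'k"
      have "?p - koszul True True *\<^sub>s ?p \<in> I"
        using dprod_swap[of "[]" w w rest] bw[OF less.prems] set w(1) by simp
      then have "(1 / 2) *\<^sub>s (?p - koszul True True *\<^sub>s ?p) \<in> I"
        by (rule I_closed)
      also have "(1 / 2) *\<^sub>s (?p - koszul True True *\<^sub>s ?p) = ?p"
        by (rule poly_mapping_eqI) (simp add: koszul_simps lookup_minus lookup_add del: dprod.simps)
      finally have "?p \<in> mod_span basis_lists" by (rule mod_span_I)
      with less.prems set w(2) show ?thesis
        by (intro perm[of "w # w # rest"]) auto
    qed
  qed
qed

lemma DX_mod_span: "DX n \<subseteq> mod_span basis_lists"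
proof
  fix p :: "mon \<Rightarrow>\<^sub>0 'k" assume "p \<in> DX n"
  then have "p \<in> brack_span" by (rule DX_brack_span)
  moreover have "brack_span \<subseteq> mod_span {ws. set ws \<subseteq> M_words n X1}"
    unfolding mod_span_def[of "{ws. set ws \<subseteq> brack_words n}"]
    by (rule dv.span_minimal) (auto intro: dprod_M_words mod_span_I)
  moreover have "mod_span {ws. set ws \<subseteq> M_words n X1} \<subseteq> mod_span basis_lists"
    unfolding mod_span_def[of "{ws. set ws \<subseteq> M_words n X1}"]
    by (rule dv.span_minimal) (auto intro: dprod_basis_lists mod_span_I)
  ultimately show "p \<in> mod_span basis_lists" by blast
qed

end

section \<open>Independence\<close>

context gen_poisson
begin

lemma dprod_independent:
  fixes a :: "mon list \<Rightarrow> 'k"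
  assumes S: "finite S" "S \<subseteq> basis_lists"
    and rel: "(\<Sum>ws\<in>S. a ws *\<^sub>s dprod ws) \<in> I"
  shows "\<forall>ws\<in>S. a ws = 0"
proof (rule ccontr)
  assume "\<not> (\<forall>ws\<in>S. a ws = 0)"
  then obtain v where v: "v \<in> S" "a v \<noteq> 0" by blast
  let ?S = "{ws \<in> S. a ws \<noteq> 0}"
  \<comment> \<open>The shortest lists with nonzero coefficient are those reaching the lowest power
    of X.\<close>
  define K where "K = Min (length ` ?S)"
  have fin: "finite ?S" using S(1) by simp
  have K: "K \<le> length ws" if "ws \<in> ?S" for ws
    unfolding K_def using fin that by (intro Min_le) auto
  have "K \<in> length ` ?S"
    unfolding K_def using fin v by (intro Min_in) auto
  then obtain w where w: "w \<in> ?S" "length w = K" by auto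
  interpret L: laurent_model "free_const :: 'k \<Rightarrow> 'k free_algebra" "\<lambda>i. word [i]" n X1
    by unfold_locales (rule even_0)
  have bw: "set ws \<subseteq> brack_words n - {Letter 0}" if "ws \<in> ?S" for ws
    using S(2) that M_words_brack_words by (fastforce simp: pbw_lists_def)
  have "(\<Sum>ws\<in>?S. a ws *\<^sub>s dprod ws) = (\<Sum>ws\<in>S. a ws *\<^sub>s dprod ws)"
    using S(1) by (intro sum.mono_neutral_left) (auto simp: dscale_simps)
  with rel have "(\<Sum>ws\<in>?S. a ws *\<^sub>s dprod ws) \<in> relation_ideal n X1"
    by (simp add: I_def)
  with fin K bw have low: "(\<Sum>ws\<in>{ws \<in> ?S. length ws = K}. free_const (a ws) * free_evl X1 ws)
      \<in> free.span (free_evl X1 ` {ws. set ws \<subseteq> brack_words n \<and> length ws < K})"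
    by (intro L.lowest_terms) blast+
  \<comment> \<open>Straightening never lengthens a product, so arbitrary products of fewer than
    \<open>K\<close> brackets become ordered ones of fewer than \<open>K\<close> factors.\<close>
  have "free.span (free_evl X1 ` {ws. set ws \<subseteq> brack_words n \<and> length ws < K})
      \<subseteq> (free.span (free_evl X1 ` {vs \<in> pbw_lists n X1. length vs < K}) :: 'k free_algebra set)"
  proof (rule free.span_minimal; clarify?)
    fix ws assume "set ws \<subseteq> brack_words n" "length ws < K"
    then show "(free_evl X1 ws :: 'k free_algebra) \<in> free.span (free_evl X1 ` {vs \<in> pbw_lists n X1. length vs < K})"
      by (intro subsetD[OF free.span_mono free.evl_pbw_lists[of ws n]]) auto
  qed
  with low have "(\<Sum>ws\<in>{ws \<in> ?S. length ws = K}. free_const (a ws) * free_evl X1 ws)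
      \<in> free.span (free_evl X1 ` {vs \<in> pbw_lists n X1. length vs < K})"
    by blast
  then have "a w = 0"
    by (rule free_pbw_top[rotated 4]) (use S w in auto)
  with w show False by simp
qed

lemma coset_eq_iff_I: "coset n X1 p = coset n X1 q \<longleftrightarrow> p - q \<in> I"
  by (simp add: coset_eq_iff I_def)

text \<open>Two lists with the same coset would give a relation with coefficients 1 and -1.\<close>

lemma inj_on_coset_dprod: "inj_on (\<lambda>ws. coset n X1 (dprod ws) :: (mon \<Rightarrow>\<^sub>0 'k) set) basis_lists"
proof (rule inj_onI, rule ccontr)
  fix ws vs assume *: "ws \<in> basis_lists" "vs \<in> basis_lists" "ws \<noteq> vs"
    and "coset n X1 (dprod ws) = (coset n X1 (dprod vs) :: (mon \<Rightarrow>\<^sub>0 'k) set)"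
  then have "(\<Sum>us\<in>{ws, vs}. (if us = ws then 1 else - 1) *\<^sub>s dprod us) \<in> I"
    by (simp add: coset_eq_iff_I dscale_simps)
  from dprod_independent[OF _ _ this] * show False by simp
qed

section \<open>From monomials with exponents to lists of factors\<close>

definition monomial_list :: "(mon \<times> nat) list \<Rightarrow> mon list" where
  "monomial_list es = concat (map (\<lambda>(e, k). replicate k e) es)"

text \<open>Powers grow on the right, while \<open>dprod\<close> nests to the right. The last factor
  is therefore reassociated into the list, which is why the induction needs arbitrary
  \<open>ws\<close>.\<close>

lemma coset_power_mult:
  assumes "e \<in> brack_words n"
  shows "set ws \<subseteq> brack_words n \<Longrightarrow>
    (coset n X1 (dmon e) [^]\<^bsub>GenP n X1\<^esub> k) \<otimes>\<^bsub>GenP n X1\<^esub> coset n X1 (dprod ws)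
      = (coset n X1 (dprod (replicate k e @ ws)) :: (mon \<Rightarrow>\<^sub>0 'k) set)"
proof (induction k arbitrary: ws)
  case 0
  then show ?case
    using relators(3)[OF dprod_DX]
    by (simp add: nat_pow_def GenP_one GenP_ops unit_DX dprod_DX coset_eq_iff_I)
next
  case (Suc k)
  have e: "(dmon e :: mon \<Rightarrow>\<^sub>0 'k) \<in> DX n" using assms by (rule dmon_brack_DX)
  have "\<exists>p \<in> DX n. coset n X1 (dmon e) [^]\<^bsub>GenP n X1\<^esub> k = (coset n X1 p :: (mon \<Rightarrow>\<^sub>0 'k) set)"
  proof (induction k)
    case 0
    show ?case using unit_DX by (auto simp: nat_pow_def GenP_one)
  next
    case (Suc k)
    then obtain p where "p \<in> DX n" "coset n X1 (dmon e) [^]\<^bsub>GenP n X1\<^esub> k = (coset n X1 p :: (mon \<Rightarrow>\<^sub>0 'k) set)"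
      by blast
    with e show ?case
      by (intro bexI[of _ "p \<star> dmon e"]) (simp_all add: nat_pow_def GenP_ops DX_closed)
  qed
  then obtain p where p: "p \<in> DX n" "coset n X1 (dmon e) [^]\<^bsub>GenP n X1\<^esub> k = (coset n X1 p :: (mon \<Rightarrow>\<^sub>0 'k) set)"
    by blast
  have ws: "(dprod ws :: mon \<Rightarrow>\<^sub>0 'k) \<in> DX n" using Suc.prems by (rule dprod_DX)
  have "coset n X1 (dmon e) [^]\<^bsub>GenP n X1\<^esub> Suc k
      = coset n X1 (dmon e) [^]\<^bsub>GenP n X1\<^esub> k \<otimes>\<^bsub>GenP n X1\<^esub> (coset n X1 (dmon e) :: (mon \<Rightarrow>\<^sub>0 'k) set)"
    by (simp add: nat_pow_def)
  then have "(coset n X1 (dmon e) [^]\<^bsub>GenP n X1\<^esub> Suc k) \<otimes>\<^bsub>GenP n X1\<^esub> coset n X1 (dprod ws)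
      = (coset n X1 ((p \<star> dmon e) \<star> dprod ws) :: (mon \<Rightarrow>\<^sub>0 'k) set)"
    by (simp add: p GenP_ops e ws DX_closed)
  also have "\<dots> = coset n X1 (p \<star> dprod (e # ws))"
    using relators(1)[OF p(1) e ws] by (simp add: coset_eq_iff_I)
  also have "\<dots> = (coset n X1 (dmon e) [^]\<^bsub>GenP n X1\<^esub> k) \<otimes>\<^bsub>GenP n X1\<^esub> coset n X1 (dprod (e # ws))"
    using p Suc.prems assms by (simp add: GenP_ops dprod_DX DX_closed e del: dprod.simps)
  also have "\<dots> = coset n X1 (dprod (replicate k e @ e # ws))"
    using Suc.prems assms by (intro Suc.IH) auto
  also have "replicate k e @ e # ws = replicate (Suc k) e @ ws"
    by (simp add: replicate_app_Cons_same)
  finally show ?case .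
qed

lemma monomial_value_dprod:
  assumes "fst ` set es \<subseteq> brack_words n"
  shows "monomial_value n X1 es = (coset n X1 (dprod (monomial_list es)) :: (mon \<Rightarrow>\<^sub>0 'k) set)"
  using assms
proof (induction es)
  case Nil
  then show ?case by (simp add: monomial_value_def monomial_list_def GenP_one)
next
  case (Cons ek es)
  obtain e k where ek: "ek = (e, k)" by force
  have "set (monomial_list es) \<subseteq> brack_words n"
    using Cons.prems by (fastforce simp: monomial_list_def split: if_splits)
  from coset_power_mult[OF _ this] Cons show ?case
    by (simp add: monomial_value_def monomial_list_def ek)
qed

end

text \<open>Excluding 1 as first factor excludes it altogether, because \<open>Letter 0\<close> is
  the least word and the factors increase strictly.\<close>

lemma ordered_monomials_iff:
  "es \<in> ordered_monomials n X1 \<longleftrightarrow> sorted_wrt (<) (map fst es) \<and>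
     (\<forall>(e, k)\<in>set es. e \<in> M_words n X1 \<and> e \<noteq> Letter 0 \<and> k \<ge> 1 \<and> (odd_mon X1 e \<longrightarrow> k = 1))"
    (is "_ \<longleftrightarrow> ?R es")
proof -
  have sorted: "sorted_wrt (\<prec>) (map fst es) \<longleftrightarrow> sorted_wrt (<) (map fst es)"
    if "\<forall>(e, k)\<in>set es. e \<in> M_words n X1"
  proof -
    have "e \<in> brack_words n" if "e \<in> set (map fst es)" for e
      using that \<open>\<forall>(e, k)\<in>set es. e \<in> M_words n X1\<close> M_words_brack_words by fastforce
    then show ?thesis
      using sorted_wrt_mono_rel[of "map fst es" "(\<prec>)" "(<)"] sorted_wrt_mono_rel[of "map fst es" "(<)" "(\<prec>)"]
      by (meson wless_iff_less)
  qed
  have no_0: "e \<noteq> Letter 0"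
    if "es \<noteq> []" "sorted_wrt (<) (map fst es)" "fst (hd es) \<noteq> Letter 0" "(e, k) \<in> set es" for e k
  proof (cases es)
    case (Cons a as)
    with that show ?thesis
      using Letter_0_le[of "fst a"] by fastforce
  qed (use that in simp)
  show ?thesis
  proof
    assume "es \<in> ordered_monomials n X1"
    then show "?R es"
      using sorted no_0 by (fastforce simp: ordered_monomials_def)
  next
    assume R: "?R es"
    then have M: "\<forall>(e, k)\<in>set es. e \<in> M_words n X1" by blast
    show "es \<in> ordered_monomials n X1"
    proof (cases "es = []")
      case False
      then have "hd es \<in> set es" by simp
      with R have "fst (hd es) \<noteq> Letter 0" by (auto simp: split_beta)
      with R sorted[OF M] False show ?thesis by (auto simp: ordered_monomials_def)
    qed (simp add: ordered_monomials_def)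
  qed
qed

context gen_poisson
begin

lemma monomial_list_simps [simp]:
  "monomial_list [] = []" "monomial_list ((e, k) # es) = replicate k e @ monomial_list es"
  by (simp_all add: monomial_list_def)

lemma set_monomial_list: "set (monomial_list es) = {e. \<exists>k>0. (e, k) \<in> set es}"
proof (induction es)
  case (Cons ek es)
  then show ?case by (cases ek) auto
qed simp

lemma count_monomial_list:
  "distinct (map fst es) \<Longrightarrow> (e, k) \<in> set es \<Longrightarrow> count (mset (monomial_list es)) e = k"
proof (induction es)
  case (Cons ek es)
  obtain e' k' where ek: "ek = (e', k')" by force
  show ?case
  proof (cases "(e, k) = ek")
    case True
    with Cons.prems have "e \<notin> set (monomial_list es)"
      by (force simp: set_monomial_list)
    with True ek show ?thesis by (simp add: count_replicate_mset[symmetric] not_in_iff)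
  next
    case False
    with Cons.prems have in_es: "(e, k) \<in> set es" by simp
    with Cons.prems ek have "e \<noteq> e'" by force
    with Cons in_es ek show ?thesis by simp
  qed
qed simp

lemma sorted_monomial_list: "sorted_wrt (<) (map fst es) \<Longrightarrow> sorted (monomial_list es)"
proof (induction es)
  case (Cons ek es)
  obtain e k where ek: "ek = (e, k)" by force
  have "\<forall>e'\<in>set (monomial_list es). e \<le> e'"
    using Cons.prems ek by (force simp: set_monomial_list)
  with Cons ek show ?case
    by (auto simp: sorted_append)
qed simp

lemma monomial_list_basis_lists: "es \<in> ordered_monomials n X1 \<Longrightarrow> monomial_list es \<in> basis_lists"
proof -
  assume "es \<in> ordered_monomials n X1"
  then have es: "sorted_wrt (<) (map fst es)"
    "\<And>e k. (e, k) \<in> set es \<Longrightarrow> e \<in> M_words n X1 \<and> e \<noteq> Letter 0 \<and> k \<ge> 1 \<and> (odd_mon X1 e \<longrightarrow> k = 1)"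
    unfolding ordered_monomials_iff by auto
  from es(1) have d: "distinct (map fst es)"
    by (simp add: strict_sorted_iff)
  show ?thesis
    using es(2) count_monomial_list[OF d] sorted_monomial_list[OF es(1)]
    by (fastforce simp: pbw_lists_def set_monomial_list)
qed

text \<open>The inverse lists the distinct factors in increasing order with their multiplicities;
  exponents are positive, so no factor disappears.\<close>

lemma inj_on_monomial_list: "inj_on monomial_list (ordered_monomials n X1)"
proof
  fix es fs assume es: "es \<in> ordered_monomials n X1" and fs: "fs \<in> ordered_monomials n X1"
    and eq: "monomial_list es = monomial_list fs"
  have *: "es = map (\<lambda>e. (e, count (mset (monomial_list es)) e)) (sorted_list_of_set (set (monomial_list es)))"
    if "es \<in> ordered_monomials n X1" for es
  proof -
    from that have es: "sorted_wrt (<) (map fst es)" "\<And>e k. (e, k) \<in> set es \<Longrightarrow> k \<ge> 1"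
      unfolding ordered_monomials_iff by auto
    from es(1) have d: "distinct (map fst es)" by (simp add: strict_sorted_iff)
    have pos: "(\<exists>k>0. (e, k) \<in> set es) \<longleftrightarrow> (\<exists>k. (e, k) \<in> set es)" for e
      using es(2)[of e] by (metis One_nat_def Suc_le_eq)
    have fst: "e \<in> set (map fst es) \<longleftrightarrow> (\<exists>k. (e, k) \<in> set es)" for e
      by force
    have "set (monomial_list es) = set (map fst es)"
      by (rule Set.set_eqI) (simp only: set_monomial_list mem_Collect_eq pos fst)
    then have "sorted_list_of_set (set (monomial_list es)) = map fst es"
      using es(1) by (metis sorted_list_of_set.idem_if_sorted_distinct strict_sorted_iff)
    moreover have "map (\<lambda>ek. (fst ek, count (mset (monomial_list es)) (fst ek))) es = map id es"
      using count_monomial_list[OF d] by (intro map_cong) auto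
    ultimately show ?thesis by (simp add: comp_def)
  qed
  show "es = fs"
    using *[OF es] *[OF fs] eq by simp
qed

lemma monomial_list_onto: "basis_lists \<subseteq> monomial_list ` ordered_monomials n X1"
proof
  fix ws assume ws: "ws \<in> basis_lists"
  define es where "es = map (\<lambda>e. (e, count (mset ws) e)) (sorted_list_of_set (set ws))"
  have es: "es \<in> ordered_monomials n X1"
    unfolding ordered_monomials_iff es_def using ws
    by (auto simp: pbw_lists_def comp_def Suc_le_eq)
  have "count (mset (monomial_list es)) e = count (mset ws) e" for e
  proof (cases "e \<in> set ws")
    case True
    then have "(e, count (mset ws) e) \<in> set es" by (simp add: es_def)
    moreover have "distinct (map fst es)" by (simp add: es_def comp_def)
    ultimately show ?thesis by (simp add: count_monomial_list)
  next
    case False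
    then have "e \<notin> set (monomial_list es)" by (auto simp: es_def set_monomial_list)
    with False show ?thesis by (metis count_mset_0_iff)
  qed
  then have "mset (monomial_list es) = mset ws" by (rule multiset_eqI)
  moreover have "sorted (monomial_list es)" "sorted ws"
    using monomial_list_basis_lists[OF es] ws by (auto simp: pbw_lists_def)
  ultimately have "monomial_list es = ws"
    by (metis properties_for_sort)
  with es show "ws \<in> monomial_list ` ordered_monomials n X1" by blast
qed

lemma monomial_value_ordered:
  assumes "es \<in> ordered_monomials n X1"
  shows "monomial_value n X1 es = (coset n X1 (dprod (monomial_list es)) :: (mon \<Rightarrow>\<^sub>0 'k) set)"
proof (rule monomial_value_dprod)
  show "fst ` set es \<subseteq> brack_words n"
    using assms M_words_brack_words by (fastforce simp: ordered_monomials_iff)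
qed

lemma inj_on_monomial_value:
  "inj_on (monomial_value n X1 :: _ \<Rightarrow> (mon \<Rightarrow>\<^sub>0 'k) set) (ordered_monomials n X1)"
proof -
  have "inj_on ((\<lambda>ws. coset n X1 (dprod ws) :: (mon \<Rightarrow>\<^sub>0 'k) set) \<circ> monomial_list) (ordered_monomials n X1)"
    by (intro comp_inj_on inj_on_monomial_list inj_on_subset[OF inj_on_coset_dprod])
      (use monomial_list_basis_lists in blast)
  then show ?thesis
    by (rule inj_on_cong[THEN iffD1, rotated]) (simp add: monomial_value_ordered)
qed

lemma monomial_value_image:
  "monomial_value n X1 ` ordered_monomials n X1 =
     ((\<lambda>ws. coset n X1 (dprod ws)) ` basis_lists :: (mon \<Rightarrow>\<^sub>0 'k) set set)"
proof -
  have "monomial_list ` ordered_monomials n X1 = basis_lists"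
    using monomial_list_onto monomial_list_basis_lists by blast
  then have "(\<lambda>ws. coset n X1 (dprod ws)) ` basis_lists
      = ((\<lambda>es. coset n X1 (dprod (monomial_list es))) ` ordered_monomials n X1 :: (mon \<Rightarrow>\<^sub>0 'k) set set)"
    by (simp add: image_image flip: \<open>_ = basis_lists\<close>)
  then show ?thesis
    by (simp add: monomial_value_ordered cong: image_cong)
qed

lemma basis_lists_DX: "ws \<in> basis_lists \<Longrightarrow> (dprod ws :: mon \<Rightarrow>\<^sub>0 'k) \<in> DX n"
  by (rule dprod_DX) (use M_words_brack_words in \<open>auto simp: pbw_lists_def\<close>)

lemma basis_GenP:
  "vectorspace.basis (class_ring :: 'k ring) (GenP n X1) ((\<lambda>ws. coset n X1 (dprod ws)) ` basis_lists)"
proof -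
  let ?V = "GenP n X1 :: ('k, _) bracket_algebra"
  let ?c = "\<lambda>ws. coset n X1 (dprod ws) :: (mon \<Rightarrow>\<^sub>0 'k) set"
  interpret V: vectorspace "class_ring :: 'k ring" ?V
    by (rule vectorspace_GenP)
  have A: "?c ` basis_lists \<subseteq> carrier ?V"
    using basis_lists_DX by (auto simp: GenP_carrier)
  \<comment> \<open>Because the cosets are distinct, a linear combination in the quotient lifts term
    by term to a formal one indexed by lists.\<close>
  have lincomb: "V.lincomb a (?c ` T) = coset n X1 (\<Sum>ws\<in>T. a (?c ws) *\<^sub>s dprod ws)
      \<and> (\<Sum>ws\<in>T. a (?c ws) *\<^sub>s dprod ws) \<in> DX n"
    if "finite T" "T \<subseteq> basis_lists" for T a
    using that
  proof (induction T rule: finite_induct)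
    case empty
    then show ?case by (simp add: V.lincomb_def GenP_zero)
  next
    case (insert w T)
    have "?c w \<notin> ?c ` T"
      using insert.hyps insert.prems inj_onD[OF inj_on_coset_dprod] by blast
    moreover have "(dprod w :: mon \<Rightarrow>\<^sub>0 'k) \<in> DX n"
      using insert.prems by (intro basis_lists_DX) auto
    ultimately have "V.lincomb a (?c ` insert w T) = a (?c w) \<odot>\<^bsub>?V\<^esub> ?c w \<oplus>\<^bsub>?V\<^esub> V.lincomb a (?c ` T)"
      unfolding V.lincomb_def image_insert using insert A
      by (subst V.finsum_insert) (auto simp: GenP_carrier GenP_ops DX_closed basis_lists_DX)
    with insert \<open>dprod w \<in> DX n\<close> show ?case
      by (simp add: GenP_ops DX_closed)
  qed
  have "\<not> V.lin_dep (?c ` basis_lists)"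
  proof
    assume "V.lin_dep (?c ` basis_lists)"
    then obtain B a v where B: "finite B" "B \<subseteq> ?c ` basis_lists" "V.lincomb a B = \<zero>\<^bsub>?V\<^esub>" "v \<in> B" "a v \<noteq> 0"
      unfolding V.lin_dep_def by auto
    from B(2) obtain T where T: "T \<subseteq> basis_lists" "inj_on ?c T" "B = ?c ` T"
      unfolding subset_image_inj by blast
    have "finite T" using B(1) T(2,3) by (simp add: finite_image_iff)
    with lincomb[OF this T(1), of a] B(3) T have "(\<Sum>ws\<in>T. a (?c ws) *\<^sub>s dprod ws) \<in> I"
      by (simp add: GenP_zero coset_eq_iff_I)
    from dprod_independent[OF \<open>finite T\<close> T(1) this] B(4,5) T(3) show False by auto
  qed
  moreover have "V.gen_set (?c ` basis_lists)"
  proof -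
    \<comment> \<open>The span in the quotient is pulled back to the formal space, where it is a
      subspace containing \<open>I\<close> and the basis products, hence all of \<open>DX n\<close>
      by \<open>DX_mod_span\<close>.\<close>
    let ?P = "{p \<in> DX n. coset n X1 p \<in> V.span (?c ` basis_lists)}"
    have sub: "submodule (class_ring :: 'k ring) (V.span (?c ` basis_lists)) ?V"
      by (rule V.span_is_submodule[OF A])
    have zero: "coset n X1 0 \<in> V.span (?c ` basis_lists)"
      using submodule.zero_closed[OF sub] by (simp add: GenP_zero)
    have base: "?c ws \<in> V.span (?c ` basis_lists)" if "ws \<in> basis_lists" for ws
      using V.in_own_span[OF A] that by blast
    have "dv.subspace ?P"
      unfolding dv.subspace_def
    proof (intro conjI allI ballI)
      fix p q :: "mon \<Rightarrow>\<^sub>0 'k" and c assume "p \<in> ?P"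
      then show "c *\<^sub>s p \<in> ?P"
        using submodule.smult_closed[OF sub, of c "coset n X1 p"]
        by (simp add: GenP_ops(4)[OF _ DX_0] DX_closed)
      assume "q \<in> ?P"
      with \<open>p \<in> ?P\<close> show "p + q \<in> ?P"
        using submodule.m_closed[OF sub, of "coset n X1 p" "coset n X1 q"] by (simp add: GenP_ops DX_closed)
    qed (simp add: zero)
    moreover have "coset n X1 p = coset n X1 0" if "p \<in> I" for p
      using that by (simp add: coset_eq_iff_I)
    ultimately have "mod_span basis_lists \<subseteq> ?P"
      unfolding mod_span_def
      by (intro dv.span_minimal)
        (auto simp: basis_lists_DX zero I_closed(1) base)
    with DX_mod_span have "carrier ?V \<subseteq> V.span (?c ` basis_lists)"
      by (auto simp: GenP_carrier)
    moreover have "V.span (?c ` basis_lists) \<subseteq> carrier ?V"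
      by (rule V.span_is_subset2[OF A])
    ultimately show ?thesis by blast
  qed
  ultimately show ?thesis
    using A by (simp add: V.basis_def)
qed

end

theorem theorem2:
  fixes n :: nat and X1 :: "nat set"
  assumes "X1 \<subseteq> {1..n}"
  shows "inj_on (monomial_value n X1 :: _ \<Rightarrow> (mon \<Rightarrow>\<^sub>0 'k::field_char_0) set) (ordered_monomials n X1) \<and>
    vectorspace.basis (class_ring :: 'k ring) (GenP n X1)
      (monomial_value n X1 ` ordered_monomials n X1)"
proof -
  interpret gen_poisson n X1 "relation_ideal n X1 :: (mon \<Rightarrow>\<^sub>0 'k) set"
    by unfold_locales (use assms in auto)
  show ?thesis
    using inj_on_monomial_value basis_GenP by (simp only: monomial_value_image)
qed

end
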